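(* Let $R$ be a rig in $\mathscr V$. The theory $\mathrm{Mat}_R^{\mathrm{aff}}$ of left $R$-affine spaces is the commutant of the theory $\mathrm{Mat}_{R^{\mathrm{op}}}^*$ of pointed right $R$-modules, where both are considered as theories over the full theory $\underline{\mathscr V}_R$ of $R$ in $\underline{\mathscr V}$. Symbolically, $\mathrm{Mat}_R^{\mathrm{aff}}\cong(\mathrm{Mat}_{R^{\mathrm{op}}}^* )^\perp$ over $\underline{\mathscr V}_R$.
   Context: $\mathscr V$ is a locally small cartesian closed category with equalizers, countable colimits, and intersections of countable families of strong subobjects; $\underline{\mathscr V}$ is $\mathscr V$ as a $\mathscr V$-category, with internal homs $\underline{\mathscr V}(V,W)$. Algebraic formulas below are to be read for generalized elements. \emph{Theories.} A theory (discretely finitary, enriched in $\mathscr V$) is a $\mathscr V$-category $\mathscr T$ whose objects are the natural numbers, equipped for each $n$ with morphisms $\pi_i:n\to1$ ($1\le i\le n$) exhibiting $n$ as a conical ($\mathscr V$-enriched) $n$-th power of $1$, with $\pi_1=\mathrm{id}$ if $n=1$. Morphisms of theories are identity-on-objects $\mathscr V$-functors preserving the designated $\pi_i$; $\mathrm{Th}$ is the resulting category. A $\mathscr T$-algebra is a $\mathscr V$-functor $A:\mathscr T\to\underline{\mathscr V}$ preserving conical finite powers, with carrier $|A|=A(1)$; it is normal if it sends the designated power $n$ of $1$ to the designated power $|A|^n$. $\mathscr T\text{-Alg}$ is the $\mathscr V$-category of $\mathscr T$-algebras, with hom-objects the objects of $\mathscr V$-natural transformations; limits in it are pointwise. \emph{Commutants.}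 For $X\in\mathscr V$, the full theory $\underline{\mathscr V}_X$ has $\underline{\mathscr V}_X(n,m)=\underline{\mathscr V}(X^n,X^m)$, composition as in $\underline{\mathscr V}$, and the product projections as designated $\pi_i$. A theory over $\underline{\mathscr V}_X$ is a theory $\mathscr T$ with a morphism $A:\mathscr T\to\underline{\mathscr V}_X$; it amounts to a $\mathscr T$-algebra $n\mapsto X^n$ with carrier $X$, also called $A$. Its commutant $\mathscr T^\perp$ is the theory with $\mathscr T^\perp(n,m)=\mathscr T\text{-Alg}(A^n,A^m)$, with composition as in $\mathscr T\text{-Alg}$; the forgetful morphisms $\mathscr T\text{-Alg}(A^n,A^m)\hookrightarrow\underline{\mathscr V}(X^n,X^m)$ make $\mathscr T^\perp$ a theory over $\underline{\mathscr V}_X$. Isomorphisms "over $\underline{\mathscr V}_X$" are isomorphisms in $\mathrm{Th}/\underline{\mathscr V}_X$. \emph{Rigs.} A rig in $\mathscr V$ is an object $R$ with a commutative monoid structure $(+,0)$ and a monoid structure $(\bullet,1)$ in $\mathscr V$ such that $\bullet$ preserves $+$ and $0$ in each variable separately; $R^{\mathrm{op}}$ has reversed multiplication, and right $R$-modules are left $R^{\mathrm{op}}$-modules. \emph{Affine spaces.} $\mathrm{Mat}_R$ is the theory with $\mathrm{Mat}_R(n,m)=R^{m\times n}$, composition given by matrix multiplication, identities the identity matrices, and designated projections the standard basis row vectors. $\mathrm{Mat}_R^{\mathrm{aff}}$ is its subtheory in which $\mathrm{Mat}_R^{\mathrm{aff}}(n,m)\hookrightarrow R^{m\times n}$ is the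 equalizer expressing that each row of the matrix sums to $1$. Normal $\mathrm{Mat}_R^{\mathrm{aff}}$-algebras are called left $R$-affine spaces. It is a theory over $\underline{\mathscr V}_R$ via the left $R$-affine space $R$, i.e. via $a\mapsto\big(x\mapsto(\sum_ia_{ji}x_i)_j\big)$. \emph{Pointed modules.} A pointed right $R$-module is a right $R$-module $M$ in $\mathscr V$ with a morphism $*:1\to M$ in $\mathscr V$. Pointed right $R$-modules are the normal algebras of the theory $\mathrm{Mat}_{R^{\mathrm{op}}}^*$ with $\mathrm{Mat}_{R^{\mathrm{op}}}^*(n,m)=(R^{1+n})^m$, where $u=(u_0,u_1,\dots,u_n)\in R^{1+n}=\mathrm{Mat}_{R^{\mathrm{op}}}^*(n,1)$ acts on a pointed right $R$-module $M$ as $x\mapsto *\,u_0+\sum_{i=1}^nx_iu_i:M^n\to M$; composition of $u\in(R^{1+n})^m$ and $v\in(R^{1+m})^\ell$ is by substitution: $(v\circ u)_{k0}=v_{k0}+\sum_ju_{j0}v_{kj}$, $(v\circ u)_{ki}=\sum_ju_{ji}v_{kj}$. It is a theory over $\underline{\mathscr V}_R$ via the pointed right $R$-module $(R,1)$, i.e. via the morphism $\Phi^R:\mathrm{Mat}_{R^{\mathrm{op}}}^*\to\underline{\mathscr V}_R$ sending $u\in R^{1+n}$ to $x\mapsto u_0+\sum_{i=1}^nx_iu_i$. *)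

theory Defs
  imports Main
begin

section \<open>Categories\<close>

record ('o, 'a) category =
  Obj :: "'o set"
  Arr :: "'a set"
  Dom :: "'a \<Rightarrow> 'o"
  Cod :: "'a \<Rightarrow> 'o"
  Ide :: "'o \<Rightarrow> 'a"
  Comp :: "'a \<Rightarrow> 'a \<Rightarrow> 'a"  (infixl "\<cdot>\<index>" 70)

context
  fixes V :: "('o, 'a, 'z) category_scheme" (structure)
begin

definition hom :: "'o \<Rightarrow> 'o \<Rightarrow> 'a set" where
  "hom X Y = {f \<in> Arr V. Dom V f = X \<and> Cod V f = Y}"

definition is_category :: bool where
  "is_category \<longleftrightarrow>
     (\<forall>f\<in>Arr V. Dom V f \<in> Obj V \<and> Cod V f \<in> Obj V) \<and>
     (\<forall>X\<in>Obj V. Ide V X \<in> hom X X) \<and>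
     (\<forall>X Y Z f g. f \<in> hom X Y \<longrightarrow> g \<in> hom Y Z \<longrightarrow> g \<cdot> f \<in> hom X Z) \<and>
     (\<forall>X Y f. f \<in> hom X Y \<longrightarrow> f \<cdot> Ide V X = f \<and> Ide V Y \<cdot> f = f) \<and>
     (\<forall>W X Y Z f g h. f \<in> hom W X \<longrightarrow> g \<in> hom X Y \<longrightarrow> h \<in> hom Y Z \<longrightarrow>
        h \<cdot> g \<cdot> f = h \<cdot> (g \<cdot> f))"

definition is_equalizer :: "'a \<Rightarrow> 'a \<Rightarrow> 'o \<Rightarrow> 'a \<Rightarrow> bool" where
  "is_equalizer f g E e \<longleftrightarrow>
     E \<in> Obj V \<and> e \<in> hom E (Dom V f) \<and> f \<cdot> e = g \<cdot> e \<and>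
     (\<forall>Z\<in>Obj V. \<forall>h\<in>hom Z (Dom V f). f \<cdot> h = g \<cdot> h \<longrightarrow> (\<exists>!k. k \<in> hom Z E \<and> e \<cdot> k = h))"

definition has_equalizers :: bool where
  "has_equalizers \<longleftrightarrow>
     (\<forall>X\<in>Obj V. \<forall>Y\<in>Obj V. \<forall>f\<in>hom X Y. \<forall>g\<in>hom X Y. \<exists>E e. is_equalizer f g E e)"

definition is_mono :: "'a \<Rightarrow> bool" where
  "is_mono m \<longleftrightarrow> m \<in> Arr V \<and>
     (\<forall>Z\<in>Obj V. \<forall>f\<in>hom Z (Dom V m). \<forall>g\<in>hom Z (Dom V m). m \<cdot> f = m \<cdot> g \<longrightarrow> f = g)"

definition is_epi :: "'a \<Rightarrow> bool" where
  "is_epi e \<longleftrightarrow> e \<in> Arr V \<and>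
     (\<forall>Z\<in>Obj V. \<forall>f\<in>hom (Cod V e) Z. \<forall>g\<in>hom (Cod V e) Z. f \<cdot> e = g \<cdot> e \<longrightarrow> f = g)"

definition is_strong_mono :: "'a \<Rightarrow> bool" where
  "is_strong_mono m \<longleftrightarrow> is_mono m \<and>
     (\<forall>e f g. is_epi e \<longrightarrow> f \<in> hom (Dom V e) (Dom V m) \<longrightarrow> g \<in> hom (Cod V e) (Cod V m) \<longrightarrow>
        m \<cdot> f = g \<cdot> e \<longrightarrow>
        (\<exists>!d. d \<in> hom (Cod V e) (Dom V m) \<and> d \<cdot> e = f \<and> m \<cdot> d = g))"

definition is_intersection :: "'o \<Rightarrow> 'i set \<Rightarrow> ('i \<Rightarrow> 'a) \<Rightarrow> 'a \<Rightarrow> bool" where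
  "is_intersection B I m p \<longleftrightarrow>
     is_mono p \<and> Cod V p = B \<and>
     (\<forall>i\<in>I. \<exists>h\<in>hom (Dom V p) (Dom V (m i)). m i \<cdot> h = p) \<and>
     (\<forall>Z\<in>Obj V. \<forall>f\<in>hom Z B. (\<forall>i\<in>I. \<exists>h\<in>hom Z (Dom V (m i)). m i \<cdot> h = f) \<longrightarrow>
        (\<exists>h\<in>hom Z (Dom V p). p \<cdot> h = f))"

definition has_countable_strong_intersections :: bool where
  "has_countable_strong_intersections \<longleftrightarrow>
     (\<forall>B\<in>Obj V. \<forall>(I :: nat set) m.
        (\<forall>i\<in>I. is_strong_mono (m i) \<and> Cod V (m i) = B) \<longrightarrow> (\<exists>p. is_intersection B I m p))"

definition is_diagram ::
  "('j, 'u) category \<Rightarrow> ('j \<Rightarrow> 'o) \<Rightarrow> ('u \<Rightarrow> 'a) \<Rightarrow> bool" where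
  "is_diagram J Fo Fa \<longleftrightarrow>
     (\<forall>j\<in>Obj J. Fo j \<in> Obj V \<and> Fa (Ide J j) = Ide V (Fo j)) \<and>
     (\<forall>u\<in>Arr J. Fa u \<in> hom (Fo (Dom J u)) (Fo (Cod J u))) \<and>
     (\<forall>u\<in>Arr J. \<forall>v\<in>Arr J. Cod J u = Dom J v \<longrightarrow> Fa (v \<cdot>\<^bsub>J\<^esub> u) = Fa v \<cdot> Fa u)"

definition is_cocone ::
  "('j, 'u) category \<Rightarrow> ('j \<Rightarrow> 'o) \<Rightarrow> ('u \<Rightarrow> 'a) \<Rightarrow> 'o \<Rightarrow> ('j \<Rightarrow> 'a) \<Rightarrow> bool" where
  "is_cocone J Fo Fa L c \<longleftrightarrow>
     L \<in> Obj V \<and> (\<forall>j\<in>Obj J. c j \<in> hom (Fo j) L) \<and>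
     (\<forall>u\<in>Arr J. c (Cod J u) \<cdot> Fa u = c (Dom J u))"

definition is_colimit ::
  "('j, 'u) category \<Rightarrow> ('j \<Rightarrow> 'o) \<Rightarrow> ('u \<Rightarrow> 'a) \<Rightarrow> 'o \<Rightarrow> ('j \<Rightarrow> 'a) \<Rightarrow> bool" where
  "is_colimit J Fo Fa L c \<longleftrightarrow>
     is_cocone J Fo Fa L c \<and>
     (\<forall>M d. is_cocone J Fo Fa M d \<longrightarrow>
        (\<exists>!h. h \<in> hom L M \<and> (\<forall>j\<in>Obj J. h \<cdot> c j = d j)))"

end

text \<open>Up to isomorphism, the countable categories are those whose objects and arrows are
  natural numbers.\<close>

definition has_countable_colimits :: "('o, 'a, 'z) category_scheme \<Rightarrow> bool" where
  "has_countable_colimits V \<longleftrightarrow>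
     (\<forall>(J :: (nat, nat) category) Fo Fa. is_category J \<longrightarrow> is_diagram V J Fo Fa \<longrightarrow>
        (\<exists>L c. is_colimit V J Fo Fa L c))"


section \<open>Cartesian closed categories\<close>

text \<open>The finite products and the internal homs are chosen; \<open>Exp X Y\<close> is the internal hom
  from \<open>X\<close> to \<open>Y\<close>.\<close>

record ('o, 'a) ccc = "('o, 'a) category" +
  Unit :: 'o  ("\<one>\<index>")
  Prod :: "'o \<Rightarrow> 'o \<Rightarrow> 'o"  (infixl "\<otimes>\<index>" 75)
  Pr1 :: "'o \<Rightarrow> 'o \<Rightarrow> 'a"
  Pr2 :: "'o \<Rightarrow> 'o \<Rightarrow> 'a"
  Exp :: "'o \<Rightarrow> 'o \<Rightarrow> 'o"
  Ev :: "'o \<Rightarrow> 'o \<Rightarrow> 'a"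

definition pair :: "('o, 'a) ccc \<Rightarrow> 'a \<Rightarrow> 'a \<Rightarrow> 'a"  ("\<langle>_, _\<rangle>\<index>") where
  "\<langle>f, g\<rangle>\<^bsub>V\<^esub> = (THE h. h \<in> hom V (Dom V f) (Cod V f \<otimes>\<^bsub>V\<^esub> Cod V g) \<and>
     Pr1 V (Cod V f) (Cod V g) \<cdot>\<^bsub>V\<^esub> h = f \<and> Pr2 V (Cod V f) (Cod V g) \<cdot>\<^bsub>V\<^esub> h = g)"

section \<open>Enriched categories and functors\<close>

record ('x, 'o, 'a) vcat =
  VObj :: "'x set"
  VHom :: "'x \<Rightarrow> 'x \<Rightarrow> 'o"
  VId :: "'x \<Rightarrow> 'a"
  VComp :: "'x \<Rightarrow> 'x \<Rightarrow> 'x \<Rightarrow> 'a"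

record ('x, 'y, 'a) vfun =
  FObj :: "'x \<Rightarrow> 'y"
  FArr :: "'x \<Rightarrow> 'x \<Rightarrow> 'a"

text \<open>A theory has all natural numbers as objects; \<open>VProj T n i\<close> is the designated projection
  from \<open>n\<close> to 1 with index \<open>i < n\<close>.\<close>

record ('o, 'a) vtheory = "(nat, 'o, 'a) vcat" +
  VProj :: "nat \<Rightarrow> nat \<Rightarrow> 'a"

record ('o, 'a) rig =
  Car :: 'o
  Add :: 'a
  Zero :: 'a
  Mul :: 'a
  One :: 'a

context
  fixes V :: "('o, 'a) ccc" (structure)
begin

definition bang :: "'o \<Rightarrow> 'a" where
  "bang Z = (THE h. h \<in> hom V Z \<one>)"

definition curry_arr :: "'o \<Rightarrow> 'o \<Rightarrow> 'o \<Rightarrow> 'a \<Rightarrow> 'a" where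
  "curry_arr Z X Y f =
     (THE g. g \<in> hom V Z (Exp V X Y) \<and> Ev V X Y \<cdot> \<langle>g \<cdot> Pr1 V Z X, Pr2 V Z X\<rangle> = f)"

definition is_ccc :: bool where
  "is_ccc \<longleftrightarrow>
     is_category V \<and>
     \<one> \<in> Obj V \<and> (\<forall>Z\<in>Obj V. \<exists>!h. h \<in> hom V Z \<one>) \<and>
     (\<forall>X\<in>Obj V. \<forall>Y\<in>Obj V. X \<otimes> Y \<in> Obj V \<and>
        Pr1 V X Y \<in> hom V (X \<otimes> Y) X \<and> Pr2 V X Y \<in> hom V (X \<otimes> Y) Y \<and>
        (\<forall>Z\<in>Obj V. \<forall>f\<in>hom V Z X. \<forall>g\<in>hom V Z Y.
           \<exists>!h. h \<in> hom V Z (X \<otimes> Y) \<and> Pr1 V X Y \<cdot> h = f \<and> Pr2 V X Y \<cdot> h = g)) \<and>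
     (\<forall>X\<in>Obj V. \<forall>Y\<in>Obj V. Exp V X Y \<in> Obj V \<and> Ev V X Y \<in> hom V (Exp V X Y \<otimes> X) Y \<and>
        (\<forall>Z\<in>Obj V. \<forall>f\<in>hom V (Z \<otimes> X) Y.
           \<exists>!g. g \<in> hom V Z (Exp V X Y) \<and> Ev V X Y \<cdot> \<langle>g \<cdot> Pr1 V Z X, Pr2 V Z X\<rangle> = f))"

definition is_base :: bool where
  "is_base \<longleftrightarrow> is_ccc \<and> has_equalizers V \<and> has_countable_colimits V \<and>
     has_countable_strong_intersections V"

text \<open>The product of two arrows, and the factorization of \<open>f\<close> through a monomorphism \<open>m\<close>.\<close>

definition prod_arr :: "'a \<Rightarrow> 'a \<Rightarrow> 'a" where
  "prod_arr f g = \<langle>f \<cdot> Pr1 V (Dom V f) (Dom V g), g \<cdot> Pr2 V (Dom V f) (Dom V g)\<rangle>"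

definition factor :: "'a \<Rightarrow> 'a \<Rightarrow> 'a" where
  "factor m f = (THE h. h \<in> hom V (Dom V f) (Dom V m) \<and> m \<cdot> h = f)"

definition is_power :: "'o \<Rightarrow> nat \<Rightarrow> 'o \<Rightarrow> (nat \<Rightarrow> 'a) \<Rightarrow> bool" where
  "is_power X n P q \<longleftrightarrow>
     P \<in> Obj V \<and> (\<forall>i<n. q i \<in> hom V P X) \<and>
     (\<forall>Z\<in>Obj V. \<forall>f. (\<forall>i<n. f i \<in> hom V Z X) \<longrightarrow>
        (\<exists>!h. h \<in> hom V Z P \<and> (\<forall>i<n. q i \<cdot> h = f i)))"

text \<open>The designated finite powers, with projections indexed from 0; the first power of \<open>X\<close> is \<open>X\<close> itself.\<close>

fun pow :: "'o \<Rightarrow> nat \<Rightarrow> 'o" where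
  "pow X 0 = \<one>"
| "pow X (Suc 0) = X"
| "pow X (Suc (Suc n)) = pow X (Suc n) \<otimes> X"

fun pproj :: "'o \<Rightarrow> nat \<Rightarrow> nat \<Rightarrow> 'a" where
  "pproj X 0 i = undefined"
| "pproj X (Suc 0) i = Ide V X"
| "pproj X (Suc (Suc n)) i =
     (if i = Suc n then Pr2 V (pow X (Suc n)) X
      else pproj X (Suc n) i \<cdot> Pr1 V (pow X (Suc n)) X)"

definition tuple :: "'o \<Rightarrow> nat \<Rightarrow> 'o \<Rightarrow> (nat \<Rightarrow> 'a) \<Rightarrow> 'a" where
  "tuple X n Z f = (THE h. h \<in> hom V Z (pow X n) \<and> (\<forall>i<n. pproj X n i \<cdot> h = f i))"

text \<open>Generalized elements of stage \<open>Z\<close> are arrows with domain \<open>Z\<close>; \<open>gcomp\<close> composes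
  generalized elements of homs of a \<open>\<V>\<close>-category.\<close>

definition gcomp :: "('x, 'o, 'a, 'z) vcat_scheme \<Rightarrow> 'x \<Rightarrow> 'x \<Rightarrow> 'x \<Rightarrow> 'a \<Rightarrow> 'a \<Rightarrow> 'a" where
  "gcomp C x y z g f = VComp C x y z \<cdot> \<langle>g, f\<rangle>"

definition is_vcat :: "('x, 'o, 'a, 'z) vcat_scheme \<Rightarrow> bool" where
  "is_vcat C \<longleftrightarrow>
     (\<forall>x\<in>VObj C. \<forall>y\<in>VObj C. VHom C x y \<in> Obj V) \<and>
     (\<forall>x\<in>VObj C. VId C x \<in> hom V \<one> (VHom C x x)) \<and>
     (\<forall>x\<in>VObj C. \<forall>y\<in>VObj C. \<forall>z\<in>VObj C.
        VComp C x y z \<in> hom V (VHom C y z \<otimes> VHom C x y) (VHom C x z)) \<and>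
     (\<forall>x\<in>VObj C. \<forall>y\<in>VObj C. \<forall>Z\<in>Obj V. \<forall>f\<in>hom V Z (VHom C x y).
        gcomp C x x y f (VId C x \<cdot> bang Z) = f \<and> gcomp C x y y (VId C y \<cdot> bang Z) f = f) \<and>
     (\<forall>w\<in>VObj C. \<forall>x\<in>VObj C. \<forall>y\<in>VObj C. \<forall>z\<in>VObj C. \<forall>Z\<in>Obj V.
        \<forall>f\<in>hom V Z (VHom C w x). \<forall>g\<in>hom V Z (VHom C x y). \<forall>h\<in>hom V Z (VHom C y z).
        gcomp C w x z (gcomp C x y z h g) f = gcomp C w y z h (gcomp C w x y g f))"

definition self_vcat :: "('o, 'o, 'a) vcat" where
  "self_vcat = \<lparr>
     VObj = Obj V,
     VHom = Exp V,
     VId = (\<lambda>X. curry_arr \<one> X X (Pr2 V \<one> X)),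
     VComp = (\<lambda>X Y Z.
       let W = Exp V Y Z \<otimes> Exp V X Y;
           g = Pr1 V (Exp V Y Z) (Exp V X Y) \<cdot> Pr1 V W X;
           f = Pr2 V (Exp V Y Z) (Exp V X Y) \<cdot> Pr1 V W X;
           x = Pr2 V W X
       in curry_arr W X Z (Ev V Y Z \<cdot> \<langle>g, Ev V X Y \<cdot> \<langle>f, x\<rangle>\<rangle>)) \<rparr>"

definition is_vfun ::
  "('x, 'o, 'a, 'z) vcat_scheme \<Rightarrow> ('y, 'o, 'a, 'w) vcat_scheme \<Rightarrow> ('x, 'y, 'a) vfun \<Rightarrow> bool" where
  "is_vfun C D F \<longleftrightarrow>
     (\<forall>x\<in>VObj C. FObj F x \<in> VObj D) \<and>
     (\<forall>x\<in>VObj C. \<forall>y\<in>VObj C.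
        FArr F x y \<in> hom V (VHom C x y) (VHom D (FObj F x) (FObj F y))) \<and>
     (\<forall>x\<in>VObj C. FArr F x x \<cdot> VId C x = VId D (FObj F x)) \<and>
     (\<forall>x\<in>VObj C. \<forall>y\<in>VObj C. \<forall>z\<in>VObj C.
        FArr F x z \<cdot> VComp C x y z =
        VComp D (FObj F x) (FObj F y) (FObj F z) \<cdot> prod_arr (FArr F y z) (FArr F x y))"

text \<open>\<open>q i\<close>, for \<open>i < n\<close>, are arrows from the unit to \<open>VHom C p x\<close> that exhibit \<open>p\<close> as a conical
  \<open>n\<close>-th power of \<open>x\<close> in \<open>C\<close>: the induced arrows from \<open>VHom C z p\<close> to \<open>VHom C z x\<close> exhibit the
  former as an \<open>n\<close>-th power of the latter.\<close>

definition is_conical_power ::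
  "('x, 'o, 'a, 'z) vcat_scheme \<Rightarrow> 'x \<Rightarrow> nat \<Rightarrow> 'x \<Rightarrow> (nat \<Rightarrow> 'a) \<Rightarrow> bool" where
  "is_conical_power C x n p q \<longleftrightarrow>
     x \<in> VObj C \<and> p \<in> VObj C \<and> (\<forall>i<n. q i \<in> hom V \<one> (VHom C p x)) \<and>
     (\<forall>z\<in>VObj C. is_power (VHom C z x) n (VHom C z p)
        (\<lambda>i. gcomp C z p x (q i \<cdot> bang (VHom C z p)) (Ide V (VHom C z p))))"


section \<open>Natural transformations\<close>

text \<open>\<open>\<theta> x\<close> is a generalized element of stage \<open>Z\<close> of \<open>VHom D (FObj F x) (FObj G x)\<close>, natural in
  \<open>x\<close>.  For \<open>Z\<close> the unit this is a \<open>\<V>\<close>-natural transformation from \<open>F\<close> to \<open>G\<close>; the object of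
  \<open>\<V>\<close>-natural transformations is the universal such family.\<close>

definition is_vnat ::
  "('x, 'o, 'a, 'z) vcat_scheme \<Rightarrow> ('y, 'o, 'a, 'w) vcat_scheme \<Rightarrow>
   ('x, 'y, 'a) vfun \<Rightarrow> ('x, 'y, 'a) vfun \<Rightarrow> 'o \<Rightarrow> ('x \<Rightarrow> 'a) \<Rightarrow> bool" where
  "is_vnat C D F G Z \<theta> \<longleftrightarrow>
     (\<forall>x\<in>VObj C. \<theta> x \<in> hom V Z (VHom D (FObj F x) (FObj G x))) \<and>
     (\<forall>x\<in>VObj C. \<forall>y\<in>VObj C.
        let e = Pr1 V Z (VHom C x y); t = Pr2 V Z (VHom C x y) in
        gcomp D (FObj F x) (FObj G x) (FObj G y) (FArr G x y \<cdot> t) (\<theta> x \<cdot> e) =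
        gcomp D (FObj F x) (FObj F y) (FObj G y) (\<theta> y \<cdot> e) (FArr F x y \<cdot> t))"

definition is_nat_object ::
  "('x, 'o, 'a, 'z) vcat_scheme \<Rightarrow> ('y, 'o, 'a, 'w) vcat_scheme \<Rightarrow>
   ('x, 'y, 'a) vfun \<Rightarrow> ('x, 'y, 'a) vfun \<Rightarrow> 'o \<Rightarrow> ('x \<Rightarrow> 'a) \<Rightarrow> bool" where
  "is_nat_object C D F G E \<epsilon> \<longleftrightarrow>
     E \<in> Obj V \<and> is_vnat C D F G E \<epsilon> \<and>
     (\<forall>Z\<in>Obj V. \<forall>\<theta>. is_vnat C D F G Z \<theta> \<longrightarrow>
        (\<exists>!h. h \<in> hom V Z E \<and> (\<forall>x\<in>VObj C. \<epsilon> x \<cdot> h = \<theta> x)))"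


section \<open>Theories and their algebras\<close>

definition is_theory :: "('o, 'a) vtheory \<Rightarrow> bool" where
  "is_theory T \<longleftrightarrow>
     is_vcat T \<and> VObj T = UNIV \<and>
     (\<forall>n. is_conical_power T 1 n n (VProj T n)) \<and> VProj T 1 0 = VId T 1"

text \<open>A morphism of theories is the identity on objects, so it is given by its action on homs.\<close>

definition is_theory_mor ::
  "('o, 'a) vtheory \<Rightarrow> ('o, 'a) vtheory \<Rightarrow> (nat \<Rightarrow> nat \<Rightarrow> 'a) \<Rightarrow> bool" where
  "is_theory_mor S T F \<longleftrightarrow>
     is_vfun S T \<lparr> FObj = (\<lambda>n. n), FArr = F \<rparr> \<and>
     (\<forall>n. \<forall>i<n. F n 1 \<cdot> VProj S n i = VProj T n i)"

definition is_theory_over ::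
  "('o, 'a) vtheory \<Rightarrow> ('o, 'a) vtheory \<Rightarrow> (nat \<Rightarrow> nat \<Rightarrow> 'a) \<Rightarrow> bool" where
  "is_theory_over W T A \<longleftrightarrow> is_theory W \<and> is_theory T \<and> is_theory_mor T W A"

definition is_mor_over ::
  "('o, 'a) vtheory \<Rightarrow> (nat \<Rightarrow> nat \<Rightarrow> 'a) \<Rightarrow> ('o, 'a) vtheory \<Rightarrow> (nat \<Rightarrow> nat \<Rightarrow> 'a) \<Rightarrow>
   (nat \<Rightarrow> nat \<Rightarrow> 'a) \<Rightarrow> bool" where
  "is_mor_over S A T B F \<longleftrightarrow> is_theory_mor S T F \<and> (\<forall>n m. B n m \<cdot> F n m = A n m)"

text \<open>Isomorphism of \<open>(S, A)\<close> and \<open>(T, B)\<close> in the slice category of theories over \<open>W\<close>.\<close>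

definition iso_over ::
  "('o, 'a) vtheory \<Rightarrow> ('o, 'a) vtheory \<Rightarrow> (nat \<Rightarrow> nat \<Rightarrow> 'a) \<Rightarrow>
   ('o, 'a) vtheory \<Rightarrow> (nat \<Rightarrow> nat \<Rightarrow> 'a) \<Rightarrow> bool" where
  "iso_over W S A T B \<longleftrightarrow>
     is_theory_over W S A \<and> is_theory_over W T B \<and>
     (\<exists>F G. is_mor_over S A T B F \<and> is_mor_over T B S A G \<and>
        (\<forall>n m. G n m \<cdot> F n m = Ide V (VHom S n m) \<and> F n m \<cdot> G n m = Ide V (VHom T n m)))"

definition full_theory :: "'o \<Rightarrow> ('o, 'a) vtheory" where
  "full_theory X = \<lparr>
     VObj = UNIV,
     VHom = (\<lambda>n m. VHom self_vcat (pow X n) (pow X m)),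
     VId = (\<lambda>n. VId self_vcat (pow X n)),
     VComp = (\<lambda>n m l. VComp self_vcat (pow X n) (pow X m) (pow X l)),
     VProj = (\<lambda>n i. curry_arr \<one> (pow X n) X (pproj X n i \<cdot> Pr2 V \<one> (pow X n))) \<rparr>"

definition is_algebra :: "('o, 'a) vtheory \<Rightarrow> (nat, 'o, 'a) vfun \<Rightarrow> bool" where
  "is_algebra T A \<longleftrightarrow>
     is_vfun T self_vcat A \<and>
     (\<forall>x n p q. is_conical_power T x n p q \<longrightarrow>
        is_conical_power self_vcat (FObj A x) n (FObj A p) (\<lambda>i. FArr A p x \<cdot> q i))"

text \<open>A chosen object of \<open>\<V>\<close>-natural transformations with its components.\<close>

definition nat_object ::
  "('o, 'a) vtheory \<Rightarrow> (nat, 'o, 'a) vfun \<Rightarrow> (nat, 'o, 'a) vfun \<Rightarrow> 'o \<times> (nat \<Rightarrow> 'a)" where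
  "nat_object T A B = (SOME Ee. is_nat_object T self_vcat A B (fst Ee) (snd Ee))"

definition alg_hom :: "('o, 'a) vtheory \<Rightarrow> (nat, 'o, 'a) vfun \<Rightarrow> (nat, 'o, 'a) vfun \<Rightarrow> 'o" where
  "alg_hom T A B = fst (nat_object T A B)"

definition alg_cmpt ::
  "('o, 'a) vtheory \<Rightarrow> (nat, 'o, 'a) vfun \<Rightarrow> (nat, 'o, 'a) vfun \<Rightarrow> nat \<Rightarrow> 'a" where
  "alg_cmpt T A B = snd (nat_object T A B)"

text \<open>The arrow \<open>Z \<rightarrow> alg_hom T A B\<close> with components \<open>\<theta>\<close>.\<close>

definition alg_lift ::
  "('o, 'a) vtheory \<Rightarrow> (nat, 'o, 'a) vfun \<Rightarrow> (nat, 'o, 'a) vfun \<Rightarrow> 'o \<Rightarrow> (nat \<Rightarrow> 'a) \<Rightarrow> 'a" where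
  "alg_lift T A B Z \<theta> =
     (THE h. h \<in> hom V Z (alg_hom T A B) \<and> (\<forall>k. alg_cmpt T A B k \<cdot> h = \<theta> k))"

definition Alg :: "('o, 'a) vtheory \<Rightarrow> ((nat, 'o, 'a) vfun, 'o, 'a) vcat" where
  "Alg T = \<lparr>
     VObj = {A. is_algebra T A},
     VHom = alg_hom T,
     VId = (\<lambda>A. alg_lift T A A \<one> (\<lambda>k. VId self_vcat (FObj A k))),
     VComp = (\<lambda>A B C.
       let Z = alg_hom T B C \<otimes> alg_hom T A B;
           g = Pr1 V (alg_hom T B C) (alg_hom T A B);
           f = Pr2 V (alg_hom T B C) (alg_hom T A B)
       in alg_lift T A C Z (\<lambda>k.
            gcomp self_vcat (FObj A k) (FObj B k) (FObj C k)
              (alg_cmpt T B C k \<cdot> g) (alg_cmpt T A B k \<cdot> f))) \<rparr>"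


section \<open>Commutants\<close>

text \<open>The algebra \<open>n \<mapsto> X\<^sup>n\<close> of a theory over the full theory of \<open>X\<close>, and the pointwise powers
  \<open>A\<^sup>n\<close> of an algebra, with their projections to \<open>A\<close>.\<close>

definition alg_over :: "'o \<Rightarrow> (nat \<Rightarrow> nat \<Rightarrow> 'a) \<Rightarrow> (nat, 'o, 'a) vfun" where
  "alg_over X A = \<lparr> FObj = pow X, FArr = A \<rparr>"

definition alg_pow ::
  "('o, 'a) vtheory \<Rightarrow> (nat, 'o, 'a) vfun \<Rightarrow> nat \<Rightarrow> (nat, 'o, 'a) vfun" where
  "alg_pow T A n = \<lparr>
     FObj = (\<lambda>k. pow (FObj A k) n),
     FArr = (\<lambda>k l.
       let H = VHom T k l; P = pow (FObj A k) n
       in curry_arr H P (pow (FObj A l) n)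
            (tuple (FObj A l) n (H \<otimes> P) (\<lambda>i.
               Ev V (FObj A k) (FObj A l) \<cdot>
                 \<langle>FArr A k l \<cdot> Pr1 V H P, pproj (FObj A k) n i \<cdot> Pr2 V H P\<rangle>))) \<rparr>"

definition alg_pow_proj :: "('o, 'a) vtheory \<Rightarrow> (nat, 'o, 'a) vfun \<Rightarrow> nat \<Rightarrow> nat \<Rightarrow> 'a" where
  "alg_pow_proj T A n i = alg_lift T (alg_pow T A n) (alg_pow T A 1) \<one>
     (\<lambda>k. let P = pow (FObj A k) n
          in curry_arr \<one> P (FObj A k) (pproj (FObj A k) n i \<cdot> Pr2 V \<one> P))"

definition commutant :: "'o \<Rightarrow> ('o, 'a) vtheory \<Rightarrow> (nat \<Rightarrow> nat \<Rightarrow> 'a) \<Rightarrow> ('o, 'a) vtheory" where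
  "commutant X T A =
     (let P = alg_pow T (alg_over X A) in \<lparr>
     VObj = UNIV,
     VHom = (\<lambda>n m. VHom (Alg T) (P n) (P m)),
     VId = (\<lambda>n. VId (Alg T) (P n)),
     VComp = (\<lambda>n m l. VComp (Alg T) (P n) (P m) (P l)),
     VProj = alg_pow_proj T (alg_over X A) \<rparr>)"

text \<open>The forgetful morphism takes the component at 1.\<close>

definition commutant_mor ::
  "'o \<Rightarrow> ('o, 'a) vtheory \<Rightarrow> (nat \<Rightarrow> nat \<Rightarrow> 'a) \<Rightarrow> nat \<Rightarrow> nat \<Rightarrow> 'a" where
  "commutant_mor X T A n m =
     alg_cmpt T (alg_pow T (alg_over X A) n) (alg_pow T (alg_over X A) m) 1"


section \<open>Rigs\<close>

text \<open>The rig operations on generalized elements.\<close>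

definition gadd :: "('o, 'a) rig \<Rightarrow> 'a \<Rightarrow> 'a \<Rightarrow> 'a" where
  "gadd R f g = Add R \<cdot> \<langle>f, g\<rangle>"

definition gmul :: "('o, 'a) rig \<Rightarrow> 'a \<Rightarrow> 'a \<Rightarrow> 'a" where
  "gmul R f g = Mul R \<cdot> \<langle>f, g\<rangle>"

definition gzero :: "('o, 'a) rig \<Rightarrow> 'o \<Rightarrow> 'a" where
  "gzero R Z = Zero R \<cdot> bang Z"

definition gone :: "('o, 'a) rig \<Rightarrow> 'o \<Rightarrow> 'a" where
  "gone R Z = One R \<cdot> bang Z"

primrec gsum :: "('o, 'a) rig \<Rightarrow> 'o \<Rightarrow> (nat \<Rightarrow> 'a) \<Rightarrow> nat \<Rightarrow> 'a" where
  "gsum R Z f 0 = gzero R Z"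
| "gsum R Z f (Suc n) = gadd R (gsum R Z f n) (f n)"

definition is_rig :: "('o, 'a) rig \<Rightarrow> bool" where
  "is_rig R \<longleftrightarrow>
     Car R \<in> Obj V \<and>
     Add R \<in> hom V (Car R \<otimes> Car R) (Car R) \<and> Zero R \<in> hom V \<one> (Car R) \<and>
     Mul R \<in> hom V (Car R \<otimes> Car R) (Car R) \<and> One R \<in> hom V \<one> (Car R) \<and>
     (\<forall>Z\<in>Obj V. \<forall>a\<in>hom V Z (Car R). \<forall>b\<in>hom V Z (Car R). \<forall>c\<in>hom V Z (Car R).
        gadd R (gadd R a b) c = gadd R a (gadd R b c) \<and>
        gadd R a b = gadd R b a \<and>
        gadd R a (gzero R Z) = a \<and>
        gmul R (gmul R a b) c = gmul R a (gmul R b c) \<and>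
        gmul R a (gone R Z) = a \<and>
        gmul R (gone R Z) a = a \<and>
        gmul R a (gadd R b c) = gadd R (gmul R a b) (gmul R a c) \<and>
        gmul R (gadd R a b) c = gadd R (gmul R a c) (gmul R b c) \<and>
        gmul R a (gzero R Z) = gzero R Z \<and>
        gmul R (gzero R Z) a = gzero R Z)"


section \<open>Affine spaces\<close>

text \<open>Matrices with \<open>m\<close> rows and \<open>n\<close> columns form the object \<open>(R\<^sup>n)\<^sup>m\<close>, the \<open>m\<close>-tuples of rows.
  \<open>mat\<close> forms a generalized element from its entries, \<open>ent\<close> returns the entry in row \<open>j\<close> and
  column \<open>i\<close>.\<close>

definition Mats :: "'o \<Rightarrow> nat \<Rightarrow> nat \<Rightarrow> 'o" where
  "Mats X n m = pow (pow X n) m"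

definition mat :: "'o \<Rightarrow> nat \<Rightarrow> nat \<Rightarrow> 'o \<Rightarrow> (nat \<Rightarrow> nat \<Rightarrow> 'a) \<Rightarrow> 'a" where
  "mat X n m Z a = tuple (pow X n) m Z (\<lambda>j. tuple X n Z (\<lambda>i. a j i))"

definition ent :: "'o \<Rightarrow> nat \<Rightarrow> nat \<Rightarrow> 'a \<Rightarrow> nat \<Rightarrow> nat \<Rightarrow> 'a" where
  "ent X n m u j i = pproj X n i \<cdot> (pproj (pow X n) m j \<cdot> u)"

definition gdelta :: "('o, 'a) rig \<Rightarrow> 'o \<Rightarrow> nat \<Rightarrow> nat \<Rightarrow> 'a" where
  "gdelta R Z i j = (if i = j then gone R Z else gzero R Z)"

definition Mat :: "('o, 'a) rig \<Rightarrow> ('o, 'a) vtheory" where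
  "Mat R = \<lparr>
     VObj = UNIV,
     VHom = Mats (Car R),
     VId = (\<lambda>n. mat (Car R) n n \<one> (\<lambda>j i. gdelta R \<one> j i)),
     VComp = (\<lambda>n m l.
       let Hv = Mats (Car R) m l; Hu = Mats (Car R) n m; Z = Hv \<otimes> Hu;
           v = ent (Car R) m l (Pr1 V Hv Hu); u = ent (Car R) n m (Pr2 V Hv Hu)
       in mat (Car R) n l Z (\<lambda>k i. gsum R Z (\<lambda>j. gmul R (v k j) (u j i)) m)),
     VProj = (\<lambda>n i. mat (Car R) n 1 \<one> (\<lambda>_ i'. gdelta R \<one> i i')) \<rparr>"

text \<open>The action \<open>x \<mapsto> (\<Sum>\<^sub>i a\<^sub>j\<^sub>i x\<^sub>i)\<^sub>j\<close> of matrices on \<open>R\<close>.\<close>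

definition Mat_mor :: "('o, 'a) rig \<Rightarrow> nat \<Rightarrow> nat \<Rightarrow> 'a" where
  "Mat_mor R n m =
     (let H = Mats (Car R) n m; P = pow (Car R) n; Z = H \<otimes> P;
          a = ent (Car R) n m (Pr1 V H P); x = (\<lambda>i. pproj (Car R) n i \<cdot> Pr2 V H P)
      in curry_arr H P (pow (Car R) m)
           (tuple (Car R) m Z (\<lambda>j. gsum R Z (\<lambda>i. gmul R (a j i) (x i)) n)))"

definition row_sums :: "('o, 'a) rig \<Rightarrow> nat \<Rightarrow> nat \<Rightarrow> 'a" where
  "row_sums R n m =
     (let H = Mats (Car R) n m; a = ent (Car R) n m (Ide V H)
      in tuple (Car R) m H (\<lambda>j. gsum R H (\<lambda>i. a j i) n))"

definition const_ones :: "('o, 'a) rig \<Rightarrow> nat \<Rightarrow> nat \<Rightarrow> 'a" where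
  "const_ones R n m = (let H = Mats (Car R) n m in tuple (Car R) m H (\<lambda>_. gone R H))"

definition aff_equalizer :: "('o, 'a) rig \<Rightarrow> nat \<Rightarrow> nat \<Rightarrow> 'o \<times> 'a" where
  "aff_equalizer R n m =
     (SOME Ee. is_equalizer V (row_sums R n m) (const_ones R n m) (fst Ee) (snd Ee))"

definition aff_incl :: "('o, 'a) rig \<Rightarrow> nat \<Rightarrow> nat \<Rightarrow> 'a" where
  "aff_incl R n m = snd (aff_equalizer R n m)"

definition Mat_aff :: "('o, 'a) rig \<Rightarrow> ('o, 'a) vtheory" where
  "Mat_aff R = \<lparr>
     VObj = UNIV,
     VHom = (\<lambda>n m. fst (aff_equalizer R n m)),
     VId = (\<lambda>n. factor (aff_incl R n n) (VId (Mat R) n)),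
     VComp = (\<lambda>n m l. factor (aff_incl R n l)
       (VComp (Mat R) n m l \<cdot> prod_arr (aff_incl R m l) (aff_incl R n m))),
     VProj = (\<lambda>n i. factor (aff_incl R n 1) (VProj (Mat R) n i)) \<rparr>"

definition Mat_aff_mor :: "('o, 'a) rig \<Rightarrow> nat \<Rightarrow> nat \<Rightarrow> 'a" where
  "Mat_aff_mor R n m = Mat_mor R n m \<cdot> aff_incl R n m"


section \<open>Pointed right modules\<close>

text \<open>The theory whose normal algebras are the pointed right \<open>R\<close>-modules.  In a row
  \<open>(u\<^sub>0, u\<^sub>1, \<dots>, u\<^sub>n)\<close>, index 0 is the coefficient of the point, and \<open>Suc i\<close> that of the
  variable with index \<open>i\<close>.\<close>

definition PMat_op :: "('o, 'a) rig \<Rightarrow> ('o, 'a) vtheory" where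
  "PMat_op R = \<lparr>
     VObj = UNIV,
     VHom = (\<lambda>n m. Mats (Car R) (Suc n) m),
     VId = (\<lambda>n. mat (Car R) (Suc n) n \<one> (\<lambda>j i. gdelta R \<one> (Suc j) i)),
     VComp = (\<lambda>n m l.
       let Hv = Mats (Car R) (Suc m) l; Hu = Mats (Car R) (Suc n) m; Z = Hv \<otimes> Hu;
           v = ent (Car R) (Suc m) l (Pr1 V Hv Hu); u = ent (Car R) (Suc n) m (Pr2 V Hv Hu)
       in mat (Car R) (Suc n) l Z (\<lambda>k i.
            let s = gsum R Z (\<lambda>j. gmul R (u j i) (v k (Suc j))) m
            in if i = 0 then gadd R (v k 0) s else s)),
     VProj = (\<lambda>n i. mat (Car R) (Suc n) 1 \<one> (\<lambda>_ i'. gdelta R \<one> (Suc i) i')) \<rparr>"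

text \<open>The action \<open>x \<mapsto> (u\<^sub>j\<^sub>0 + \<Sum>\<^sub>i x\<^sub>i u\<^sub>j\<^sub>i)\<^sub>j\<close> on the pointed right module \<open>(R, 1)\<close>.\<close>

definition PMat_op_mor :: "('o, 'a) rig \<Rightarrow> nat \<Rightarrow> nat \<Rightarrow> 'a" where
  "PMat_op_mor R n m =
     (let H = Mats (Car R) (Suc n) m; P = pow (Car R) n; Z = H \<otimes> P;
          u = ent (Car R) (Suc n) m (Pr1 V H P); x = (\<lambda>i. pproj (Car R) n i \<cdot> Pr2 V H P)
      in curry_arr H P (pow (Car R) m)
           (tuple (Car R) m Z (\<lambda>j.
              gadd R (u j 0) (gsum R Z (\<lambda>i. gmul R (x i) (u j (Suc i))) n))))"

end

end

theory Submission
  imports Defs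
begin

text \<open>
  The monomorphism \<open>Mat_aff_mor\<close> identifies the affine \<open>m \<times> n\<close> matrices over \<open>R\<close> with certain
  arrows from \<open>R\<^sup>n\<close> to \<open>R\<^sup>m\<close>, and the claim is that these are exactly the arrows commuting with
  all operations \<open>x \<mapsto> u\<^sub>0 + \<Sum>\<^sub>i x\<^sub>i u\<^sub>i\<close> of the pointed right module \<open>(R, 1)\<close>.

  A left linear map \<open>x \<mapsto> a x\<close> commutes with sums and with right multiplications by
  associativity and distributivity, and it commutes with the constant \<open>u\<^sub>0\<close> when the rows of
  \<open>a\<close> sum to 1 (\<open>Mat_act_natural\<close>).

  Conversely, let \<open>\<theta>\<^sub>l : (R\<^sup>l)\<^sup>n \<rightarrow> (R\<^sup>l)\<^sup>m\<close> be natural in the object \<open>l\<close> of the theory of pointed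
  right modules (\<open>vnat_is_Mat_act\<close>).  The carrier of the algebra \<open>l \<mapsto> R\<^sup>l\<close> at \<open>l = n\<close>, raised to
  the power \<open>n\<close>, contains the identity matrix, and every \<open>X\<close> in \<open>(R\<^sup>l)\<^sup>n\<close> is the image of the
  identity matrix under an operation from \<open>n\<close> to \<open>l\<close>: the homogeneous linear one
  whose coefficients are the entries of \<open>X\<close>.  Hence naturality determines \<open>\<theta>\<close> from \<open>a = \<theta>\<^sub>n(1)\<close>, and \<open>\<theta>\<^sub>l(X) = a X\<close>.
  Naturality for the constant operation \<open>1\<close> says that \<open>a\<close> carries the vector of ones in \<open>R\<^sup>n\<close>
  to that in \<open>R\<^sup>m\<close>, i.e. that the rows of \<open>a\<close> sum to 1.  All this is carried out for
  generalized elements, so it shows that the object of affine matrices is the object of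
  \<open>\<V>\<close>-natural transformations (\<open>Mat_aff_nat_object\<close>).

  The rest is formal.  Both the affine matrices and the commutant embed by monomorphisms into the
  full theory of \<open>R\<close>.  A family of subobjects of the homs of a theory that contains the identities
  and the projections, and is closed under composition and under tupling, is a theory
  (\<open>subtheory\<close>); and two such families that factor through each other are isomorphic over the
  ambient theory (\<open>iso_over_mono\<close>).  Therefore any subtheory of the full theory whose homs are
  the objects of \<open>\<V>\<close>-natural transformations is the commutant (\<open>commutant_iso\<close>).
\<close>

section \<open>Generalized elements in a cartesian closed category\<close>

text \<open>Typing of arrows is left to the simplifier: with hom-sets unfolded, domains and codomains of
  composite expressions are computed by rewriting, and no intermediate object has to be guessed.\<close>

lemma in_hom_iff [simp]:
  "f \<in> hom V X Y \<longleftrightarrow> f \<in> Arr V \<and> Dom V f = X \<and> Cod V f = Y"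
  by (auto simp: hom_def)

lemma ex1_eqD: "\<exists>!x. P x \<Longrightarrow> P a \<Longrightarrow> P b \<Longrightarrow> a = b"
  by blast

declare Mats_def [simp]

locale cartesian_closed =
  fixes V :: "('o, 'a) ccc" (structure)
  assumes ccc: "is_ccc V"
begin

lemma category: "is_category V"
  using ccc unfolding is_ccc_def by (elim conjE)

lemma dom_obj [simp]: "f \<in> Arr V \<Longrightarrow> Dom V f \<in> Obj V"
  and cod_obj [simp]: "f \<in> Arr V \<Longrightarrow> Cod V f \<in> Obj V"
  using category unfolding is_category_def by blast+

lemma ide_arr [simp]:
  assumes "X \<in> Obj V"
  shows "Ide V X \<in> Arr V" "Dom V (Ide V X) = X" "Cod V (Ide V X) = X"
proof -
  have "Ide V X \<in> hom V X X"
    using category assms unfolding is_category_def by blast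
  then show "Ide V X \<in> Arr V" "Dom V (Ide V X) = X" "Cod V (Ide V X) = X" by simp_all
qed

lemma comp_arr [simp]:
  assumes "f \<in> Arr V" "g \<in> Arr V" "Cod V f = Dom V g"
  shows "g \<cdot> f \<in> Arr V" "Dom V (g \<cdot> f) = Dom V f" "Cod V (g \<cdot> f) = Cod V g"
proof -
  have "f \<in> hom V (Dom V f) (Dom V g)" "g \<in> hom V (Dom V g) (Cod V g)"
    using assms by simp_all
  then have "g \<cdot> f \<in> hom V (Dom V f) (Cod V g)"
    using category unfolding is_category_def by blast
  then show "g \<cdot> f \<in> Arr V" "Dom V (g \<cdot> f) = Dom V f" "Cod V (g \<cdot> f) = Cod V g"
    by simp_all
qed

lemma comp_ide [simp]:
  assumes "f \<in> Arr V"
  shows "Dom V f = X \<Longrightarrow> f \<cdot> Ide V X = f" "Cod V f = X \<Longrightarrow> Ide V X \<cdot> f = f"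
proof -
  have "f \<in> hom V (Dom V f) (Cod V f)" using assms by simp
  then have "f \<cdot> Ide V (Dom V f) = f \<and> Ide V (Cod V f) \<cdot> f = f"
    using category unfolding is_category_def by blast
  then show "Dom V f = X \<Longrightarrow> f \<cdot> Ide V X = f" "Cod V f = X \<Longrightarrow> Ide V X \<cdot> f = f"
    by auto
qed

lemma comp_assoc [simp]:
  assumes "f \<in> Arr V" "g \<in> Arr V" "h \<in> Arr V" "Cod V f = Dom V g" "Cod V g = Dom V h"
  shows "(h \<cdot> g) \<cdot> f = h \<cdot> (g \<cdot> f)"
proof -
  have "f \<in> hom V (Dom V f) (Dom V g)" "g \<in> hom V (Dom V g) (Dom V h)"
    "h \<in> hom V (Dom V h) (Cod V h)"
    using assms by simp_all
  then show ?thesis using category unfolding is_category_def by blast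
qed

lemma unit_obj [simp]: "\<one> \<in> Obj V"
  using ccc unfolding is_ccc_def by (elim conjE)

lemma bang_ex1: "Z \<in> Obj V \<Longrightarrow> \<exists>!h. h \<in> hom V Z \<one>"
  by (rule ccc [unfolded is_ccc_def, THEN conjunct2, THEN conjunct2, THEN conjunct1, rule_format])

lemma bang_arr [simp]:
  assumes "Z \<in> Obj V"
  shows "bang V Z \<in> Arr V" "Dom V (bang V Z) = Z" "Cod V (bang V Z) = \<one>"
  using theI'[OF bang_ex1[OF assms]] by (auto simp: bang_def)

lemma unit_ext:
  "f \<in> hom V Z \<one> \<Longrightarrow> g \<in> hom V Z \<one> \<Longrightarrow> f = g"
  using bang_ex1[of Z] dom_obj by (metis in_hom_iff)

lemma bang_comp [simp]:
  assumes "p \<in> Arr V" "Cod V p = Z"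
  shows "bang V Z \<cdot> p = bang V (Dom V p)"
proof -
  have "Z \<in> Obj V" using assms by auto
  then show ?thesis using assms by - (rule unit_ext[of _ "Dom V p"], auto)
qed

lemmas products = ccc [unfolded is_ccc_def, THEN conjunct2, THEN conjunct2, THEN conjunct2,
  THEN conjunct1, rule_format]

lemmas exponentials = ccc [unfolded is_ccc_def, THEN conjunct2, THEN conjunct2, THEN conjunct2,
  THEN conjunct2, rule_format]

lemma prod_arr_obj [simp]:
  assumes "X \<in> Obj V" "Y \<in> Obj V"
  shows "X \<otimes> Y \<in> Obj V"
    and "Pr1 V X Y \<in> Arr V" "Dom V (Pr1 V X Y) = X \<otimes> Y" "Cod V (Pr1 V X Y) = X"
    and "Pr2 V X Y \<in> Arr V" "Dom V (Pr2 V X Y) = X \<otimes> Y" "Cod V (Pr2 V X Y) = Y"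
proof -
  have "X \<otimes> Y \<in> Obj V \<and> Pr1 V X Y \<in> hom V (X \<otimes> Y) X \<and> Pr2 V X Y \<in> hom V (X \<otimes> Y) Y"
    using products [OF assms] by blast
  then show "X \<otimes> Y \<in> Obj V"
    and "Pr1 V X Y \<in> Arr V" "Dom V (Pr1 V X Y) = X \<otimes> Y" "Cod V (Pr1 V X Y) = X"
    and "Pr2 V X Y \<in> Arr V" "Dom V (Pr2 V X Y) = X \<otimes> Y" "Cod V (Pr2 V X Y) = Y"
    by simp_all
qed

lemma pair_ex1:
  assumes "f \<in> hom V Z X" "g \<in> hom V Z Y"
  shows "\<exists>!h. h \<in> hom V Z (X \<otimes> Y) \<and> Pr1 V X Y \<cdot> h = f \<and> Pr2 V X Y \<cdot> h = g"
proof -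
  have XYZ: "X \<in> Obj V" "Y \<in> Obj V" "Z \<in> Obj V" using assms by auto
  show ?thesis
    by (rule products [OF XYZ(1,2), THEN conjunct2, THEN conjunct2, THEN conjunct2, rule_format,
          OF XYZ(3) assms])
qed

lemma pair_props:
  assumes "f \<in> hom V Z X" "g \<in> hom V Z Y"
  shows "\<langle>f, g\<rangle> \<in> hom V Z (X \<otimes> Y) \<and> Pr1 V X Y \<cdot> \<langle>f, g\<rangle> = f \<and> Pr2 V X Y \<cdot> \<langle>f, g\<rangle> = g"
  using theI'[OF pair_ex1[OF assms]] assms by (auto simp: pair_def)

lemma pair_arr [simp]:
  assumes "f \<in> Arr V" "g \<in> Arr V" "Dom V f = Dom V g"
  shows "\<langle>f, g\<rangle> \<in> Arr V" "Dom V \<langle>f, g\<rangle> = Dom V g" "Cod V \<langle>f, g\<rangle> = Cod V f \<otimes> Cod V g"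
  using pair_props[of f "Dom V f" "Cod V f" g "Cod V g"] assms by auto

lemma pr_pair [simp]:
  assumes "f \<in> Arr V" "g \<in> Arr V" "Dom V f = Dom V g" "Cod V f = X" "Cod V g = Y"
  shows "Pr1 V X Y \<cdot> \<langle>f, g\<rangle> = f" "Pr2 V X Y \<cdot> \<langle>f, g\<rangle> = g"
  using pair_props[of f "Dom V f" X g Y] assms by auto

lemma pair_ext:
  assumes "h \<in> hom V Z (X \<otimes> Y)" "k \<in> hom V Z (X \<otimes> Y)" "X \<in> Obj V" "Y \<in> Obj V"
    and "Pr1 V X Y \<cdot> h = Pr1 V X Y \<cdot> k" "Pr2 V X Y \<cdot> h = Pr2 V X Y \<cdot> k"
  shows "h = k"
  by (rule ex1_eqD[OF pair_ex1[of "Pr1 V X Y \<cdot> h" Z X "Pr2 V X Y \<cdot> h" Y]]) (use assms in simp_all)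

lemma pair_comp [simp]:
  assumes "f \<in> Arr V" "g \<in> Arr V" "Dom V f = Dom V g" "p \<in> Arr V" "Cod V p = Dom V g"
  shows "\<langle>f, g\<rangle> \<cdot> p = \<langle>f \<cdot> p, g \<cdot> p\<rangle>"
  by (rule pair_ext[of _ "Dom V p" "Cod V f" "Cod V g"])
     (use assms in \<open>simp_all flip: comp_assoc\<close>)

lemma pair_pr [simp]:
  assumes "X \<in> Obj V" "Y \<in> Obj V"
  shows "\<langle>Pr1 V X Y, Pr2 V X Y\<rangle> = Ide V (X \<otimes> Y)"
  by (rule pair_ext[of _ "X \<otimes> Y" X Y]) (use assms in auto)

lemma prod_arr_arr [simp]:
  assumes "f \<in> Arr V" "g \<in> Arr V"
  shows "prod_arr V f g \<in> Arr V" "Dom V (prod_arr V f g) = Dom V f \<otimes> Dom V g"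
    "Cod V (prod_arr V f g) = Cod V f \<otimes> Cod V g"
  using assms by (simp_all add: prod_arr_def)

subsection \<open>Internal homs\<close>

lemma exp_obj [simp]:
  assumes "X \<in> Obj V" "Y \<in> Obj V"
  shows "Exp V X Y \<in> Obj V"
    and "Ev V X Y \<in> Arr V" "Dom V (Ev V X Y) = Exp V X Y \<otimes> X" "Cod V (Ev V X Y) = Y"
proof -
  have "Exp V X Y \<in> Obj V \<and> Ev V X Y \<in> hom V (Exp V X Y \<otimes> X) Y"
    using exponentials [OF assms] by blast
  then show "Exp V X Y \<in> Obj V"
    and "Ev V X Y \<in> Arr V" "Dom V (Ev V X Y) = Exp V X Y \<otimes> X" "Cod V (Ev V X Y) = Y"
    by simp_all
qed

lemma curry_ex1:
  assumes "X \<in> Obj V" "Y \<in> Obj V" "Z \<in> Obj V" "f \<in> hom V (Z \<otimes> X) Y"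
  shows "\<exists>!g. g \<in> hom V Z (Exp V X Y) \<and> Ev V X Y \<cdot> \<langle>g \<cdot> Pr1 V Z X, Pr2 V Z X\<rangle> = f"
proof -
  show ?thesis
    by (rule exponentials [OF assms(1,2), THEN conjunct2, THEN conjunct2, rule_format, OF assms(3,4)])
qed

lemma curry_arr [simp]:
  assumes "X \<in> Obj V" "Y \<in> Obj V" "Z \<in> Obj V" "f \<in> Arr V" "Dom V f = Z \<otimes> X" "Cod V f = Y"
  shows "curry_arr V Z X Y f \<in> Arr V" "Dom V (curry_arr V Z X Y f) = Z"
    "Cod V (curry_arr V Z X Y f) = Exp V X Y"
  using theI'[OF curry_ex1[of X Y Z f]] assms by (auto simp: curry_arr_def)

text \<open>Application of a generalized element of an internal hom.  As a mere abbreviation it commutes with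
  change of stage by the rules for composition and pairing.\<close>

abbreviation ap :: "'o \<Rightarrow> 'o \<Rightarrow> 'a \<Rightarrow> 'a \<Rightarrow> 'a" where
  "ap X Y f x \<equiv> Ev V X Y \<cdot> \<langle>f, x\<rangle>"

lemma ap_curry_comp [simp]:
  assumes "X \<in> Obj V" "Y \<in> Obj V" "Z \<in> Obj V" "f \<in> Arr V" "Dom V f = Z \<otimes> X" "Cod V f = Y"
    "p \<in> Arr V" "x \<in> Arr V" "Dom V p = Dom V x" "Cod V p = Z" "Cod V x = X"
  shows "ap X Y (curry_arr V Z X Y f \<cdot> p) x = f \<cdot> \<langle>p, x\<rangle>"
proof -
  have "ap X Y (curry_arr V Z X Y f \<cdot> Pr1 V Z X) (Pr2 V Z X) = f"
    using theI'[OF curry_ex1[of X Y Z f]] assms by (auto simp: curry_arr_def)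
  then have "f \<cdot> \<langle>p, x\<rangle> = ap X Y (curry_arr V Z X Y f \<cdot> Pr1 V Z X) (Pr2 V Z X) \<cdot> \<langle>p, x\<rangle>"
    by simp
  also have "\<dots> = ap X Y (curry_arr V Z X Y f \<cdot> p) x"
    using assms by simp
  finally show ?thesis by simp
qed

lemma ap_curry [simp]:
  assumes "X \<in> Obj V" "Y \<in> Obj V" "Z \<in> Obj V" "f \<in> Arr V" "Dom V f = Z \<otimes> X" "Cod V f = Y"
    "x \<in> Arr V" "Dom V x = Z" "Cod V x = X"
  shows "ap X Y (curry_arr V Z X Y f) x = f \<cdot> \<langle>Ide V Z, x\<rangle>"
  using ap_curry_comp[of X Y Z f "Ide V Z" x] assms by simp

text \<open>It suffices to compare the values on the universal argument, which lives at the stage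
  \<open>Z \<otimes> X\<close>; this is the uniqueness part of currying.\<close>

lemma exp_ext:
  assumes "f \<in> hom V Z (Exp V X Y)" "g \<in> hom V Z (Exp V X Y)" "X \<in> Obj V" "Y \<in> Obj V"
    and "\<And>Z' p x. Z' \<in> Obj V \<Longrightarrow> p \<in> hom V Z' Z \<Longrightarrow> x \<in> hom V Z' X \<Longrightarrow>
      ap X Y (f \<cdot> p) x = ap X Y (g \<cdot> p) x"
  shows "f = g"
proof -
  have Z: "Z \<in> Obj V" using assms by auto
  have "ap X Y (f \<cdot> Pr1 V Z X) (Pr2 V Z X) = ap X Y (g \<cdot> Pr1 V Z X) (Pr2 V Z X)"
    by (rule assms(5)[of "Z \<otimes> X"]) (use assms Z in auto)
  moreover have "ap X Y (f \<cdot> Pr1 V Z X) (Pr2 V Z X) \<in> hom V (Z \<otimes> X) Y"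
    using assms Z by auto
  ultimately show ?thesis
    using assms(1-4) Z
    by - (rule ex1_eqD[OF curry_ex1[of X Y Z "ap X Y (f \<cdot> Pr1 V Z X) (Pr2 V Z X)"]], simp_all)
qed

subsection \<open>Finite powers and matrices\<close>

lemma is_power_cong:
  assumes "\<And>i. i < n \<Longrightarrow> q i = q' i"
  shows "is_power V X n P q = is_power V X n P q'"
  using assms by (simp add: is_power_def cong: conj_cong imp_cong)

lemma is_powerI:
  assumes "P \<in> Obj V" "\<And>i. i < n \<Longrightarrow> q i \<in> hom V P X"
    and "\<And>Z f. Z \<in> Obj V \<Longrightarrow> (\<And>i. i < n \<Longrightarrow> f i \<in> hom V Z X) \<Longrightarrow>
      \<exists>h. h \<in> hom V Z P \<and> (\<forall>i<n. q i \<cdot> h = f i)"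
    and "\<And>Z h k. Z \<in> Obj V \<Longrightarrow> h \<in> hom V Z P \<Longrightarrow> k \<in> hom V Z P \<Longrightarrow>
      (\<And>i. i < n \<Longrightarrow> q i \<cdot> h = q i \<cdot> k) \<Longrightarrow> h = k"
  shows "is_power V X n P q"
proof -
  have "\<exists>!h. h \<in> hom V Z P \<and> (\<forall>i<n. q i \<cdot> h = f i)"
    if "Z \<in> Obj V" "\<forall>i<n. f i \<in> hom V Z X" for Z f
  proof (rule ex_ex1I)
    show "\<exists>h. h \<in> hom V Z P \<and> (\<forall>i<n. q i \<cdot> h = f i)"
      by (rule assms(3)) (use that in simp_all)
  next
    fix h k
    assume "h \<in> hom V Z P \<and> (\<forall>i<n. q i \<cdot> h = f i)" "k \<in> hom V Z P \<and> (\<forall>i<n. q i \<cdot> k = f i)"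
    then show "h = k" by - (rule assms(4)[OF that(1)], simp_all)
  qed
  then show ?thesis using assms(1,2) by (simp add: is_power_def)
qed

lemma pow_arr [simp]:
  assumes "X \<in> Obj V"
  shows "pow V X n \<in> Obj V"
    "i < n \<Longrightarrow> pproj V X n i \<in> Arr V" "i < n \<Longrightarrow> Dom V (pproj V X n i) = pow V X n"
    "i < n \<Longrightarrow> Cod V (pproj V X n i) = X"
proof -
  have "pow V X n \<in> Obj V \<and> (\<forall>i<n. pproj V X n i \<in> hom V (pow V X n) X)"
    using assms
  proof (induction n)
    case (Suc n)
    then show ?case by (cases n) (auto simp: less_Suc_eq)
  qed simp
  then show "pow V X n \<in> Obj V"
    "i < n \<Longrightarrow> pproj V X n i \<in> Arr V" "i < n \<Longrightarrow> Dom V (pproj V X n i) = pow V X n"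
    "i < n \<Longrightarrow> Cod V (pproj V X n i) = X"
    by auto
qed

lemma pow_ext:
  assumes "h \<in> hom V Z (pow V X n)" "k \<in> hom V Z (pow V X n)" "X \<in> Obj V"
    and "\<And>i. i < n \<Longrightarrow> pproj V X n i \<cdot> h = pproj V X n i \<cdot> k"
  shows "h = k"
  using assms
proof (induction n arbitrary: h k)
  case 0
  then show ?case by - (rule unit_ext[of _ Z], simp_all)
next
  case (Suc n)
  show ?case
  proof (cases n)
    case 0
    then show ?thesis using Suc.prems by simp
  next
    case (Suc n')
    show ?thesis
    proof (rule pair_ext[of _ Z "pow V X n" X])
      have "pproj V X n i \<cdot> (Pr1 V (pow V X n) X \<cdot> h) = pproj V X n i \<cdot> (Pr1 V (pow V X n) X \<cdot> k)"
        if "i < n" for i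
        using Suc.prems(4)[of i] Suc.prems(1-3) that by (simp add: Suc)
      then show "Pr1 V (pow V X n) X \<cdot> h = Pr1 V (pow V X n) X \<cdot> k"
        using Suc.prems(1-3) by - (rule Suc.IH, simp_all add: Suc)
      show "Pr2 V (pow V X n) X \<cdot> h = Pr2 V (pow V X n) X \<cdot> k"
        using Suc.prems(4)[of n] by (simp add: Suc)
    qed (use Suc.prems(1-3) in \<open>simp_all add: Suc\<close>)
  qed
qed

lemma pow_tuple_exists:
  assumes "X \<in> Obj V" "Z \<in> Obj V" "\<And>i. i < n \<Longrightarrow> f i \<in> hom V Z X"
  shows "\<exists>h. h \<in> hom V Z (pow V X n) \<and> (\<forall>i<n. pproj V X n i \<cdot> h = f i)"
  using assms(3)
proof (induction n)
  case 0
  show ?case using assms(1,2) by (intro exI[of _ "bang V Z"]) simp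
next
  case (Suc n)
  show ?case
  proof (cases n)
    case 0
    then show ?thesis using Suc.prems[of 0] by (intro exI[of _ "f 0"]) simp
  next
    case (Suc n')
    obtain h where h: "h \<in> hom V Z (pow V X n)" "\<forall>i<n. pproj V X n i \<cdot> h = f i"
      using Suc.IH Suc.prems by (meson less_Suc_eq)
    then show ?thesis
      using Suc.prems[of n] assms(1) by (intro exI[of _ "\<langle>h, f n\<rangle>"]) (auto simp: Suc less_Suc_eq)
  qed
qed

lemma pow_power:
  assumes "X \<in> Obj V"
  shows "is_power V X n (pow V X n) (pproj V X n)"
  by (rule is_powerI)
     (use assms pow_tuple_exists[OF assms] pow_ext[OF _ _ assms] in simp_all)

lemma tuple_props:
  assumes "X \<in> Obj V" "Z \<in> Obj V" "\<And>i. i < n \<Longrightarrow> f i \<in> hom V Z X"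
  shows "tuple V X n Z f \<in> hom V Z (pow V X n) \<and> (\<forall>i<n. pproj V X n i \<cdot> tuple V X n Z f = f i)"
proof -
  have "\<exists>!h. h \<in> hom V Z (pow V X n) \<and> (\<forall>i<n. pproj V X n i \<cdot> h = f i)"
    using pow_power[OF assms(1), of n] assms by (simp add: is_power_def)
  from theI'[OF this] show ?thesis unfolding tuple_def .
qed

lemma tuple_arr [simp]:
  assumes "X \<in> Obj V" "Z \<in> Obj V" "\<And>i. i < n \<Longrightarrow> f i \<in> hom V Z X"
  shows "tuple V X n Z f \<in> Arr V" "Dom V (tuple V X n Z f) = Z"
    "Cod V (tuple V X n Z f) = pow V X n" "i < n \<Longrightarrow> pproj V X n i \<cdot> tuple V X n Z f = f i"
  using tuple_props[of X Z n f] assms by auto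

lemma tuple_comp [simp]:
  assumes "X \<in> Obj V" "\<And>i. i < n \<Longrightarrow> f i \<in> hom V Z X"
    "p \<in> Arr V" "Cod V p = Z"
  shows "tuple V X n Z f \<cdot> p = tuple V X n (Dom V p) (\<lambda>i. f i \<cdot> p)"
proof (rule pow_ext[of _ "Dom V p" X n])
  have Z: "Z \<in> Obj V" using assms by auto
  show "tuple V X n Z f \<cdot> p \<in> hom V (Dom V p) (pow V X n)"
    "tuple V X n (Dom V p) (\<lambda>i. f i \<cdot> p) \<in> hom V (Dom V p) (pow V X n)"
    using assms Z by simp_all
  show "pproj V X n i \<cdot> (tuple V X n Z f \<cdot> p) = pproj V X n i \<cdot> tuple V X n (Dom V p) (\<lambda>i. f i \<cdot> p)"
    if "i < n" for i
    using assms Z that by (simp flip: comp_assoc)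
qed (use assms in simp)

lemma tuple_cong [cong]:
  assumes "X = X'" "n = n'" "Z = Z'" "\<And>i. i < n' \<Longrightarrow> f i = f' i"
  shows "tuple V X n Z f = tuple V X' n' Z' f'"
  using assms by (simp add: tuple_def cong: conj_cong imp_cong)

lemma ent_arr [simp]:
  assumes "u \<in> Arr V" "Cod V u = pow V (pow V X n) m" "X \<in> Obj V" "i < n" "j < m"
  shows "ent V X n m u j i \<in> Arr V" "Dom V (ent V X n m u j i) = Dom V u"
    "Cod V (ent V X n m u j i) = X"
  using assms by (simp_all add: ent_def)

lemma ent_comp [simp]:
  assumes "u \<in> Arr V" "Cod V u = pow V (pow V X n) m" "X \<in> Obj V" "i < n" "j < m"
    "p \<in> Arr V" "Cod V p = Dom V u"
  shows "ent V X n m u j i \<cdot> p = ent V X n m (u \<cdot> p) j i"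
  using assms by (simp add: ent_def)

lemma mat_arr [simp]:
  assumes "X \<in> Obj V" "Z \<in> Obj V"
    "\<And>j i. j < m \<Longrightarrow> i < n \<Longrightarrow> a j i \<in> hom V Z X"
  shows "mat V X n m Z a \<in> Arr V" "Dom V (mat V X n m Z a) = Z"
    "Cod V (mat V X n m Z a) = pow V (pow V X n) m"
    "i < n \<Longrightarrow> j < m \<Longrightarrow> ent V X n m (mat V X n m Z a) j i = a j i"
  using assms by (simp_all add: mat_def ent_def)

lemma mat_comp [simp]:
  assumes "X \<in> Obj V"
    "\<And>j i. j < m \<Longrightarrow> i < n \<Longrightarrow> a j i \<in> hom V Z X"
    "p \<in> Arr V" "Cod V p = Z"
  shows "mat V X n m Z a \<cdot> p = mat V X n m (Dom V p) (\<lambda>j i. a j i \<cdot> p)"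
proof -
  have "Z \<in> Obj V" using assms by auto
  then show ?thesis using assms by (simp add: mat_def)
qed

lemma mat_cong [cong]:
  assumes "X = X'" "n = n'" "m = m'" "Z = Z'" "\<And>j i. j < m' \<Longrightarrow> i < n' \<Longrightarrow> a j i = a' j i"
  shows "mat V X n m Z a = mat V X' n' m' Z' a'"
  using assms by (simp add: mat_def)

lemma mat_ext:
  assumes "u \<in> hom V Z (pow V (pow V X n) m)" "v \<in> hom V Z (pow V (pow V X n) m)" "X \<in> Obj V"
    and "\<And>j i. j < m \<Longrightarrow> i < n \<Longrightarrow> ent V X n m u j i = ent V X n m v j i"
  shows "u = v"
proof (rule pow_ext[of _ Z "pow V X n" m])
  fix j assume "j < m"
  then show "pproj V (pow V X n) m j \<cdot> u = pproj V (pow V X n) m j \<cdot> v"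
    using assms by - (rule pow_ext[of _ Z X n], simp_all add: ent_def)
qed (use assms in simp_all)

lemma ent_col [simp]:
  "u \<in> Arr V \<Longrightarrow> Cod V u = pow V X m \<Longrightarrow> j < m \<Longrightarrow> X \<in> Obj V \<Longrightarrow>
    ent V X (Suc 0) m u j 0 = pproj V X m j \<cdot> u"
  by (simp add: ent_def)

section \<open>Enriched categories\<close>

lemma vcat_hom:
  assumes "is_vcat V C" "x \<in> VObj C" "y \<in> VObj C"
  shows "VHom C x y \<in> Obj V"
  using assms unfolding is_vcat_def by blast

lemma vcat_id:
  assumes "is_vcat V C" "x \<in> VObj C"
  shows "VId C x \<in> hom V \<one> (VHom C x x)"
  using assms unfolding is_vcat_def by blast

lemma vcat_comp:
  assumes "is_vcat V C" "x \<in> VObj C" "y \<in> VObj C" "z \<in> VObj C"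
  shows "VComp C x y z \<in> hom V (VHom C y z \<otimes> VHom C x y) (VHom C x z)"
  using assms unfolding is_vcat_def by blast

lemma vcat_unit:
  assumes "is_vcat V C" "x \<in> VObj C" "y \<in> VObj C" "Z \<in> Obj V" "f \<in> hom V Z (VHom C x y)"
  shows "gcomp V C x x y f (VId C x \<cdot> bang V Z) = f" "gcomp V C x y y (VId C y \<cdot> bang V Z) f = f"
  using assms unfolding is_vcat_def by blast+

lemma vcat_assoc:
  assumes "is_vcat V C" "w \<in> VObj C" "x \<in> VObj C" "y \<in> VObj C" "z \<in> VObj C" "Z \<in> Obj V"
    "f \<in> hom V Z (VHom C w x)" "g \<in> hom V Z (VHom C x y)" "h \<in> hom V Z (VHom C y z)"
  shows "gcomp V C w x z (gcomp V C x y z h g) f = gcomp V C w y z h (gcomp V C w x y g f)"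
  using assms unfolding is_vcat_def by blast

lemma is_vcatI:
  assumes "\<And>x y. x \<in> VObj C \<Longrightarrow> y \<in> VObj C \<Longrightarrow> VHom C x y \<in> Obj V"
    "\<And>x. x \<in> VObj C \<Longrightarrow> VId C x \<in> hom V \<one> (VHom C x x)"
    "\<And>x y z. x \<in> VObj C \<Longrightarrow> y \<in> VObj C \<Longrightarrow> z \<in> VObj C \<Longrightarrow>
      VComp C x y z \<in> hom V (VHom C y z \<otimes> VHom C x y) (VHom C x z)"
    "\<And>x y Z f. x \<in> VObj C \<Longrightarrow> y \<in> VObj C \<Longrightarrow> Z \<in> Obj V \<Longrightarrow> f \<in> hom V Z (VHom C x y) \<Longrightarrow>
      gcomp V C x x y f (VId C x \<cdot> bang V Z) = f"
    "\<And>x y Z f. x \<in> VObj C \<Longrightarrow> y \<in> VObj C \<Longrightarrow> Z \<in> Obj V \<Longrightarrow> f \<in> hom V Z (VHom C x y) \<Longrightarrow>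
      gcomp V C x y y (VId C y \<cdot> bang V Z) f = f"
    "\<And>w x y z Z f g h. w \<in> VObj C \<Longrightarrow> x \<in> VObj C \<Longrightarrow> y \<in> VObj C \<Longrightarrow> z \<in> VObj C \<Longrightarrow> Z \<in> Obj V \<Longrightarrow>
      f \<in> hom V Z (VHom C w x) \<Longrightarrow> g \<in> hom V Z (VHom C x y) \<Longrightarrow> h \<in> hom V Z (VHom C y z) \<Longrightarrow>
      gcomp V C w x z (gcomp V C x y z h g) f = gcomp V C w y z h (gcomp V C w x y g f)"
  shows "is_vcat V C"
  unfolding is_vcat_def by (intro conjI ballI; (rule assms; assumption))

lemma self_simps [simp]:
  "VObj (self_vcat V) = Obj V" "VHom (self_vcat V) = Exp V"
  by (simp_all add: self_vcat_def)

lemma self_id [simp]: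
  assumes "X \<in> Obj V"
  shows "VId (self_vcat V) X \<in> Arr V" "Dom V (VId (self_vcat V) X) = \<one>"
    "Cod V (VId (self_vcat V) X) = Exp V X X"
    "x \<in> Arr V \<Longrightarrow> Cod V x = X \<Longrightarrow> Dom V x = \<one> \<Longrightarrow> ap X X (VId (self_vcat V) X) x = x"
    "x \<in> Arr V \<Longrightarrow> Cod V x = X \<Longrightarrow> p \<in> Arr V \<Longrightarrow> Dom V p = Dom V x \<Longrightarrow> Cod V p = \<one> \<Longrightarrow>
      ap X X (VId (self_vcat V) X \<cdot> p) x = x"
  using assms by (simp_all add: self_vcat_def)

lemma self_comp [simp]:
  assumes "X \<in> Obj V" "Y \<in> Obj V" "Z \<in> Obj V"
  shows "VComp (self_vcat V) X Y Z \<in> Arr V"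
    "Dom V (VComp (self_vcat V) X Y Z) = Exp V Y Z \<otimes> Exp V X Y"
    "Cod V (VComp (self_vcat V) X Y Z) = Exp V X Z"
  using assms by (simp_all add: self_vcat_def Let_def)

lemma self_gcomp [simp]:
  assumes "X \<in> Obj V" "Y \<in> Obj V" "Z \<in> Obj V" "f \<in> Arr V" "g \<in> Arr V" "Dom V g = Dom V f"
    "Cod V g = Exp V Y Z" "Cod V f = Exp V X Y"
  shows "gcomp V (self_vcat V) X Y Z g f \<in> Arr V"
    "Dom V (gcomp V (self_vcat V) X Y Z g f) = Dom V f"
    "Cod V (gcomp V (self_vcat V) X Y Z g f) = Exp V X Z"
    "x \<in> Arr V \<Longrightarrow> Dom V x = Dom V f \<Longrightarrow> Cod V x = X \<Longrightarrow>
      ap X Z (gcomp V (self_vcat V) X Y Z g f) x = ap Y Z g (ap X Y f x)"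
    "p \<in> Arr V \<Longrightarrow> Cod V p = Dom V f \<Longrightarrow>
      gcomp V (self_vcat V) X Y Z g f \<cdot> p = gcomp V (self_vcat V) X Y Z (g \<cdot> p) (f \<cdot> p)"
proof -
  show "gcomp V (self_vcat V) X Y Z g f \<in> Arr V"
    "Dom V (gcomp V (self_vcat V) X Y Z g f) = Dom V f"
    "Cod V (gcomp V (self_vcat V) X Y Z g f) = Exp V X Z"
    using assms by (simp_all add: gcomp_def)
  show "ap X Z (gcomp V (self_vcat V) X Y Z g f) x = ap Y Z g (ap X Y f x)"
    if "x \<in> Arr V" "Dom V x = Dom V f" "Cod V x = X"
    using assms that by (simp add: gcomp_def self_vcat_def Let_def)
  show "gcomp V (self_vcat V) X Y Z g f \<cdot> p = gcomp V (self_vcat V) X Y Z (g \<cdot> p) (f \<cdot> p)"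
    if "p \<in> Arr V" "Cod V p = Dom V f"
    using assms that by (simp add: gcomp_def)
qed

lemma self_vcat: "is_vcat V (self_vcat V)"
proof (rule is_vcatI, unfold self_simps)
  fix X Y Z f assume "X \<in> Obj V" "Y \<in> Obj V" "Z \<in> Obj V" "f \<in> hom V Z (Exp V X Y)"
  then show "gcomp V (self_vcat V) X X Y f (VId (self_vcat V) X \<cdot> bang V Z) = f"
    "gcomp V (self_vcat V) X Y Y (VId (self_vcat V) Y \<cdot> bang V Z) f = f"
    by - (rule exp_ext[of _ Z X Y], simp_all)+
next
  fix W X Y Z S f g h
  assume "W \<in> Obj V" "X \<in> Obj V" "Y \<in> Obj V" "Z \<in> Obj V" "f \<in> hom V S (Exp V W X)"
    "g \<in> hom V S (Exp V X Y)" "h \<in> hom V S (Exp V Y Z)"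
  then show "gcomp V (self_vcat V) W X Z (gcomp V (self_vcat V) X Y Z h g) f =
      gcomp V (self_vcat V) W Y Z h (gcomp V (self_vcat V) W X Y g f)"
    by - (rule exp_ext[of _ S W Z], simp_all)
qed simp_all

subsection \<open>The full theory of an object\<close>

lemma full_simps [simp]:
  "VObj (full_theory V X) = UNIV"
  "VHom (full_theory V X) n m = Exp V (pow V X n) (pow V X m)"
  "VId (full_theory V X) n = VId (self_vcat V) (pow V X n)"
  "VComp (full_theory V X) n m l = VComp (self_vcat V) (pow V X n) (pow V X m) (pow V X l)"
  "gcomp V (full_theory V X) n m l = gcomp V (self_vcat V) (pow V X n) (pow V X m) (pow V X l)"
  by (simp_all add: full_theory_def gcomp_def fun_eq_iff)

lemma full_proj [simp]:
  assumes "X \<in> Obj V" "i < n"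
  shows "VProj (full_theory V X) n i \<in> Arr V"
    "Dom V (VProj (full_theory V X) n i) = \<one>"
    "Cod V (VProj (full_theory V X) n i) = Exp V (pow V X n) X"
    "x \<in> Arr V \<Longrightarrow> Cod V x = pow V X n \<Longrightarrow> p \<in> Arr V \<Longrightarrow> Dom V p = Dom V x \<Longrightarrow> Cod V p = \<one> \<Longrightarrow>
      ap (pow V X n) X (VProj (full_theory V X) n i \<cdot> p) x = pproj V X n i \<cdot> x"
  using assms by (simp_all add: full_theory_def)

text \<open>\<open>Exp V Y\<close> is a right adjoint, so it preserves powers.  Existence is by currying a tuple of
  evaluations, uniqueness by comparing the components of the values.\<close>

lemma exp_power:
  assumes X: "X \<in> Obj V" and Y: "Y \<in> Obj V"
  shows "is_power V (Exp V Y X) n (Exp V Y (pow V X n))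
    (\<lambda>i. gcomp V (self_vcat V) Y (pow V X n) X
      (VProj (full_theory V X) n i \<cdot> bang V (Exp V Y (pow V X n))) (Ide V (Exp V Y (pow V X n))))"
    (is "is_power V _ n ?P ?q")
proof (rule is_powerI)
  show "?P \<in> Obj V" using assms by simp
  show "?q i \<in> hom V ?P (Exp V Y X)" if "i < n" for i
    using assms that by simp
next
  fix Z f assume Z: "Z \<in> Obj V" and f: "\<And>i. i < n \<Longrightarrow> f i \<in> hom V Z (Exp V Y X)"
  define h where "h = curry_arr V Z Y (pow V X n)
    (tuple V X n (Z \<otimes> Y) (\<lambda>i. ap Y X (f i \<cdot> Pr1 V Z Y) (Pr2 V Z Y)))"
  have "h \<in> hom V Z ?P" using assms Z f by (simp add: h_def)
  moreover have "?q i \<cdot> h = f i" if "i < n" for i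
    using assms Z f that by - (rule exp_ext[of _ Z Y X], simp_all add: h_def)
  ultimately show "\<exists>h. h \<in> hom V Z ?P \<and> (\<forall>i<n. ?q i \<cdot> h = f i)" by blast
next
  fix Z h k
  assume Z: "Z \<in> Obj V" and h: "h \<in> hom V Z ?P" and k: "k \<in> hom V Z ?P"
    and eq: "\<And>i. i < n \<Longrightarrow> ?q i \<cdot> h = ?q i \<cdot> k"
  show "h = k"
  proof (rule exp_ext[of _ Z Y "pow V X n"])
    fix Z' p x assume *: "Z' \<in> Obj V" "p \<in> hom V Z' Z" "x \<in> hom V Z' Y"
    have "pproj V X n i \<cdot> ap Y (pow V X n) (h \<cdot> p) x = pproj V X n i \<cdot> ap Y (pow V X n) (k \<cdot> p) x"
      if "i < n" for i
    proof -
      have "ap Y X ((?q i \<cdot> h) \<cdot> p) x = ap Y X ((?q i \<cdot> k) \<cdot> p) x"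
        using eq[OF that] by simp
      then show ?thesis using assms Z h k * that by simp
    qed
    then show "ap Y (pow V X n) (h \<cdot> p) x = ap Y (pow V X n) (k \<cdot> p) x"
      using assms h k * by - (rule pow_ext[of _ Z' X n], simp_all)
  qed (use assms h k in simp_all)
qed

lemma full_theory:
  assumes "X \<in> Obj V"
  shows "is_theory V (full_theory V X)"
  unfolding is_theory_def
proof (intro conjI allI)
  show "is_vcat V (full_theory V X)"
    using self_vcat assms unfolding is_vcat_def full_simps self_simps by simp
  show "is_conical_power V (full_theory V X) 1 n n (VProj (full_theory V X) n)" for n
    unfolding is_conical_power_def using assms exp_power[OF assms, of "pow V X _" n] by simp
  show "VProj (full_theory V X) 1 0 = VId (full_theory V X) 1"
    using assms by (simp add: full_theory_def self_vcat_def)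
qed simp

text \<open>The two projections of a product of hom-objects form the universal composable pair, so an arrow
  preserves composition as soon as it does so for generalized elements.\<close>

lemma comp_preservedI:
  assumes C: "VComp C x y z \<in> hom V (VHom C y z \<otimes> VHom C x y) (VHom C x z)"
    and H: "VHom C y z \<in> Obj V" "VHom C x y \<in> Obj V"
    and D: "VComp D x' y' z' \<in> hom V (Cod V G \<otimes> Cod V F) W"
    and F: "F \<in> Arr V" "Dom V F = VHom C x y" and G: "G \<in> Arr V" "Dom V G = VHom C y z"
    and eq: "\<And>Z f g. Z \<in> Obj V \<Longrightarrow> f \<in> hom V Z (VHom C x y) \<Longrightarrow> g \<in> hom V Z (VHom C y z) \<Longrightarrow>
      E \<cdot> gcomp V C x y z g f = gcomp V D x' y' z' (G \<cdot> g) (F \<cdot> f)"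
  shows "E \<cdot> VComp C x y z = VComp D x' y' z' \<cdot> prod_arr V G F"
proof -
  let ?g = "Pr1 V (VHom C y z) (VHom C x y)" and ?f = "Pr2 V (VHom C y z) (VHom C x y)"
  have "E \<cdot> gcomp V C x y z ?g ?f = gcomp V D x' y' z' (G \<cdot> ?g) (F \<cdot> ?f)"
    by (rule eq[of "VHom C y z \<otimes> VHom C x y"]) (use H in simp_all)
  then show ?thesis using C H F G by (simp add: gcomp_def prod_arr_def)
qed

lemma is_theory_morI:
  assumes "VObj S = UNIV" "VObj T = UNIV"
    "\<And>n m. F n m \<in> hom V (VHom S n m) (VHom T n m)"
    "\<And>n. F n n \<cdot> VId S n = VId T n"
    "\<And>n m l. F n l \<cdot> VComp S n m l = VComp T n m l \<cdot> prod_arr V (F m l) (F n m)"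
    "\<And>n i. i < n \<Longrightarrow> F n 1 \<cdot> VProj S n i = VProj T n i"
  shows "is_theory_mor V S T F"
  using assms by (simp add: is_theory_mor_def is_vfun_def)

subsection \<open>Subtheories\<close>

lemma is_power_ex1:
  assumes "is_power V X n P q" "Z \<in> Obj V" "\<And>i. i < n \<Longrightarrow> f i \<in> hom V Z X"
  shows "\<exists>!h. h \<in> hom V Z P \<and> (\<forall>i<n. q i \<cdot> h = f i)"
  using assms(1) [unfolded is_power_def, THEN conjunct2, THEN conjunct2, rule_format, OF assms(2,3)] .

lemma is_power_ext:
  assumes "is_power V X n P q" "h \<in> hom V Z P" "k \<in> hom V Z P" "\<And>i. i < n \<Longrightarrow> q i \<cdot> h = q i \<cdot> k"
  shows "h = k"
proof -
  have Z: "Z \<in> Obj V" using assms(2) by auto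
  have q: "q i \<in> hom V P X" if "i < n" for i
    using assms(1) that unfolding is_power_def by blast
  have "q i \<cdot> k \<in> hom V Z X" if "i < n" for i
    using q[OF that] assms(3) by simp
  then have "\<exists>!g. g \<in> hom V Z P \<and> (\<forall>i<n. q i \<cdot> g = q i \<cdot> k)"
    by (rule is_power_ex1[OF assms(1) Z])
  from ex1_eqD[OF this] show ?thesis
    using assms(2-4) by blast
qed

lemma mono_cancel:
  assumes "is_mono V m" "f \<in> Arr V" "g \<in> Arr V" "Dom V f = Dom V g" "Cod V f = Dom V m"
    "Cod V g = Dom V m" "m \<cdot> f = m \<cdot> g"
  shows "f = g"
proof -
  have "f \<in> hom V (Dom V g) (Dom V m)" "g \<in> hom V (Dom V g) (Dom V m)" "Dom V g \<in> Obj V"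
    using assms by simp_all
  then show ?thesis using assms unfolding is_mono_def by blast
qed

text \<open>The laws of a category hold in \<open>T\<close> because they hold in \<open>W\<close> and \<open>J\<close> is monic.  For the powers,
  a tuple of elements of \<open>T\<close> is first formed in \<open>W\<close>; the assumption \<open>closed\<close> says that it lies in
  \<open>T\<close> again, since its components do.\<close>

lemma subtheory:
  assumes W: "is_theory V W"
    and obj: "VObj T = UNIV"
    and J: "\<And>n m. J n m \<in> hom V (VHom T n m) (VHom W n m)"
    and mono: "\<And>n m. is_mono V (J n m)"
    and id: "\<And>n. VId T n \<in> hom V \<one> (VHom T n n)" "\<And>n. J n n \<cdot> VId T n = VId W n"
    and comp: "\<And>n m l. VComp T n m l \<in> hom V (VHom T m l \<otimes> VHom T n m) (VHom T n l)"
      "\<And>n m l. J n l \<cdot> VComp T n m l = VComp W n m l \<cdot> prod_arr V (J m l) (J n m)"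
    and proj: "\<And>n i. i < n \<Longrightarrow> VProj T n i \<in> hom V \<one> (VHom T n 1)"
      "\<And>n i. i < n \<Longrightarrow> J n 1 \<cdot> VProj T n i = VProj W n i"
    and closed: "\<And>Z k n h f. Z \<in> Obj V \<Longrightarrow> h \<in> hom V Z (VHom W k n) \<Longrightarrow>
      (\<And>i. i < n \<Longrightarrow> f i \<in> hom V Z (VHom T k 1)) \<Longrightarrow>
      (\<And>i. i < n \<Longrightarrow> J k 1 \<cdot> f i = gcomp V W k n 1 (VProj W n i \<cdot> bang V Z) h) \<Longrightarrow>
      \<exists>h'. h' \<in> hom V Z (VHom T k n) \<and> J k n \<cdot> h' = h"
  shows "is_theory_over V W T J"
proof -
  have Wv: "is_vcat V W" and WO [simp]: "VObj W = UNIV"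
    and Wpow: "\<And>n. is_conical_power V W 1 n n (VProj W n)" and W1: "VProj W 1 0 = VId W 1"
    using W by (simp_all add: is_theory_def)
  have WH [simp]: "VHom W n m \<in> Obj V" for n m by (rule vcat_hom[OF Wv]) simp_all
  have WC [simp]: "VComp W n m l \<in> Arr V" "Dom V (VComp W n m l) = VHom W m l \<otimes> VHom W n m"
    "Cod V (VComp W n m l) = VHom W n l" for n m l
    using vcat_comp[OF Wv, of n m l] by simp_all
  have WI [simp]: "VId W n \<in> Arr V" "Dom V (VId W n) = \<one>" "Cod V (VId W n) = VHom W n n" for n
    using vcat_id[OF Wv, of n] by simp_all
  have WP [simp]: "i < n \<Longrightarrow> VProj W n i \<in> Arr V" "i < n \<Longrightarrow> Dom V (VProj W n i) = \<one>"
    "i < n \<Longrightarrow> Cod V (VProj W n i) = VHom W n (Suc 0)" for n i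
    using Wpow[of n] by (simp_all add: is_conical_power_def)
  have JA [simp]: "J n m \<in> Arr V" "Dom V (J n m) = VHom T n m" "Cod V (J n m) = VHom W n m" for n m
    using J[of n m] by simp_all
  have TH [simp]: "VHom T n m \<in> Obj V" for n m using dom_obj[of "J n m"] by simp
  have TI [simp]: "VId T n \<in> Arr V" "Dom V (VId T n) = \<one>" "Cod V (VId T n) = VHom T n n" for n
    using id(1)[of n] by simp_all
  have TC [simp]: "VComp T n m l \<in> Arr V" "Dom V (VComp T n m l) = VHom T m l \<otimes> VHom T n m"
    "Cod V (VComp T n m l) = VHom T n l" for n m l
    using comp(1)[of n m l] by simp_all
  have TP [simp]: "i < n \<Longrightarrow> VProj T n i \<in> Arr V" "i < n \<Longrightarrow> Dom V (VProj T n i) = \<one>"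
    "i < n \<Longrightarrow> Cod V (VProj T n i) = VHom T n (Suc 0)" for n i
    using proj(1)[of i n] by simp_all
  have gT [simp]: "gcomp V T n m l g f \<in> Arr V" "Dom V (gcomp V T n m l g f) = Dom V f"
    "Cod V (gcomp V T n m l g f) = VHom T n l"
    if "f \<in> Arr V" "g \<in> Arr V" "Dom V g = Dom V f" "Cod V f = VHom T n m" "Cod V g = VHom T m l"
    for n m l g f
    using that by (simp_all add: gcomp_def)
  have JC [simp]: "J n l \<cdot> gcomp V T n m l g f = gcomp V W n m l (J m l \<cdot> g) (J n m \<cdot> f)"
    if "f \<in> Arr V" "g \<in> Arr V" "Dom V g = Dom V f" "Cod V f = VHom T n m" "Cod V g = VHom T m l"
    for n m l g f
  proof -
    have "J n l \<cdot> gcomp V T n m l g f = (J n l \<cdot> VComp T n m l) \<cdot> \<langle>g, f\<rangle>"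
      using that by (simp add: gcomp_def)
    also have "\<dots> = gcomp V W n m l (J m l \<cdot> g) (J n m \<cdot> f)"
      using that by (simp add: comp(2) gcomp_def prod_arr_def)
    finally show ?thesis .
  qed
  have JI: "J n n \<cdot> (VId T n \<cdot> p) = VId W n \<cdot> p" if "p \<in> Arr V" "Cod V p = \<one>" for n p
    using that id(2)[of n] by (simp flip: comp_assoc)
  have JP: "J n 1 \<cdot> (VProj T n i \<cdot> p) = VProj W n i \<cdot> p" if "p \<in> Arr V" "Cod V p = \<one>" "i < n" for n i p
    using that proj(2)[of i n] by (simp flip: comp_assoc)
  have unit: "gcomp V T x x y f (VId T x \<cdot> bang V Z) = f" "gcomp V T x y y (VId T y \<cdot> bang V Z) f = f"
    if "Z \<in> Obj V" "f \<in> hom V Z (VHom T x y)" for x y Z f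
    using that vcat_unit[OF Wv, of x y Z "J x y \<cdot> f"]
    by - (rule mono_cancel[OF mono[of x y]], simp_all add: JI)+
  have assoc: "gcomp V T w x z (gcomp V T x y z h g) f = gcomp V T w y z h (gcomp V T w x y g f)"
    if "Z \<in> Obj V" "f \<in> hom V Z (VHom T w x)" "g \<in> hom V Z (VHom T x y)" "h \<in> hom V Z (VHom T y z)"
    for w x y z Z f g h
    using that vcat_assoc[OF Wv, of w x y z Z "J w x \<cdot> f" "J x y \<cdot> g" "J y z \<cdot> h"]
    by - (rule mono_cancel[OF mono[of w z]], simp_all)
  have vcat: "is_vcat V T"
    by (rule is_vcatI) (use unit assoc obj in simp_all)
  \<comment> \<open>The arrows exhibiting a conical power are composition with the projections; here their effect
    on generalized elements.\<close>
  have q: "gcomp V C z n 1 (VProj C n i \<cdot> bang V (VHom C z n)) (Ide V (VHom C z n)) \<cdot> h =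
      gcomp V C z n 1 (VProj C n i \<cdot> bang V Z) h"
    if "is_vcat V C" "VObj C = UNIV" "VProj C n i \<in> hom V \<one> (VHom C n 1)" "h \<in> hom V Z (VHom C z n)"
    for C :: "('o, 'a) vtheory" and z n i h Z
  proof -
    note [simp] = vcat_hom[OF that(1)] vcat_comp[OF that(1), simplified]
    show ?thesis using that by (simp add: gcomp_def)
  qed
  have Tpow: "is_conical_power V T 1 n n (VProj T n)" for n
    unfolding is_conical_power_def
  proof (intro conjI ballI)
    fix z
    let ?q = "\<lambda>i. gcomp V T z n 1 (VProj T n i \<cdot> bang V (VHom T z n)) (Ide V (VHom T z n))"
    have Wp: "is_power V (VHom W z 1) n (VHom W z n)
      (\<lambda>i. gcomp V W z n 1 (VProj W n i \<cdot> bang V (VHom W z n)) (Ide V (VHom W z n)))"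
      using Wpow[of n] by (simp add: is_conical_power_def)
    show "is_power V (VHom T z 1) n (VHom T z n) ?q"
    proof (rule is_powerI)
      show "?q i \<in> hom V (VHom T z n) (VHom T z 1)" if "i < n" for i
        using that by simp
    next
      fix Z f assume Z: "Z \<in> Obj V" and f: "\<And>i. i < n \<Longrightarrow> f i \<in> hom V Z (VHom T z 1)"
      have "\<exists>h. h \<in> hom V Z (VHom W z n) \<and> (\<forall>i<n. gcomp V W z n 1
          (VProj W n i \<cdot> bang V (VHom W z n)) (Ide V (VHom W z n)) \<cdot> h = J z 1 \<cdot> f i)"
        using f by - (rule ex1_implies_ex[OF is_power_ex1[OF Wp Z]], simp)
      then obtain h where h: "h \<in> hom V Z (VHom W z n)"
        and hf: "\<And>i. i < n \<Longrightarrow> gcomp V W z n 1 (VProj W n i \<cdot> bang V Z) h = J z 1 \<cdot> f i"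
        using q[OF Wv, of n _ _ Z z] by auto
      have "\<exists>h'. h' \<in> hom V Z (VHom T z n) \<and> J z n \<cdot> h' = h"
        by (rule closed[OF Z h, where f = f]) (use f hf in simp_all)
      then obtain h' where h': "h' \<in> hom V Z (VHom T z n)" "J z n \<cdot> h' = h" by blast
      have "?q i \<cdot> h' = f i" if "i < n" for i
      proof (rule mono_cancel[OF mono[of z 1]])
        show "J z 1 \<cdot> (?q i \<cdot> h') = J z 1 \<cdot> f i"
          using that q[OF vcat obj _ h'(1), of i] hf[of i] h' JP[of "bang V Z" i n] Z by simp
      qed (use that h' f in simp_all)
      then show "\<exists>h. h \<in> hom V Z (VHom T z n) \<and> (\<forall>i<n. ?q i \<cdot> h = f i)" using h' by blast
    next
      fix Z h k assume Z: "Z \<in> Obj V" and h: "h \<in> hom V Z (VHom T z n)" and k: "k \<in> hom V Z (VHom T z n)"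
        and eq: "\<And>i. i < n \<Longrightarrow> ?q i \<cdot> h = ?q i \<cdot> k"
      have W_ext: "h' = k'" if "h' \<in> hom V Z (VHom W z n)" "k' \<in> hom V Z (VHom W z n)"
          "\<And>i. i < n \<Longrightarrow> gcomp V W z n 1 (VProj W n i \<cdot> bang V Z) h' =
            gcomp V W z n 1 (VProj W n i \<cdot> bang V Z) k'" for h' k'
      proof (rule is_power_ext[OF Wp that(1,2)])
        fix i assume "i < n"
        then show "gcomp V W z n 1 (VProj W n i \<cdot> bang V (VHom W z n)) (Ide V (VHom W z n)) \<cdot> h' =
            gcomp V W z n 1 (VProj W n i \<cdot> bang V (VHom W z n)) (Ide V (VHom W z n)) \<cdot> k'"
          using q[OF Wv WO _ that(1), of i] q[OF Wv WO _ that(2), of i] that(3)[of i] by simp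
      qed
      have "J z n \<cdot> h = J z n \<cdot> k"
      proof (rule W_ext)
        fix i assume i: "i < n"
        have "J z 1 \<cdot> (?q i \<cdot> h) = J z 1 \<cdot> (?q i \<cdot> k)" using eq[OF i] by simp
        then show "gcomp V W z n 1 (VProj W n i \<cdot> bang V Z) (J z n \<cdot> h) =
            gcomp V W z n 1 (VProj W n i \<cdot> bang V Z) (J z n \<cdot> k)"
          using i q[OF vcat obj _ h, of i] q[OF vcat obj _ k, of i] h k JP[of "bang V Z" i n] Z by simp
      qed (use h k in simp_all)
      then show "h = k" using h k by - (rule mono_cancel[OF mono[of z n]], simp_all)
    qed simp
  qed (use obj in simp_all)
  have "VProj T 1 0 = VId T 1"
    using proj(2)[of 0 1] id(2)[of 1] W1 by - (rule mono_cancel[OF mono[of 1 1]], simp_all)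
  then have "is_theory V T" using vcat obj Tpow by (simp add: is_theory_def)
  moreover have "is_theory_mor V T W J"
    using id(2) comp(2) proj(2) by (simp add: is_theory_mor_def is_vfun_def)
  ultimately show ?thesis using W by (simp add: is_theory_over_def)
qed

text \<open>A family of arrows over \<open>W\<close> into a theory with monic \<open>K\<close> is automatically functorial: after
  composition with \<open>K\<close> each required equation becomes one for the morphism \<open>J\<close>.\<close>

lemma theory_mor_into_mono:
  assumes S: "is_theory_over V W S J" and T: "is_theory_over V W T K"
    and mono: "\<And>n m. is_mono V (K n m)"
    and F: "\<And>n m. F n m \<in> hom V (VHom S n m) (VHom T n m)" "\<And>n m. K n m \<cdot> F n m = J n m"
  shows "is_theory_mor V S T F"
proof -
  have Sv: "is_vcat V S" and Tv: "is_vcat V T" and O [simp]: "VObj S = UNIV" "VObj T = UNIV"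
      "VObj W = UNIV" and Wv: "is_vcat V W"
    using S T by (simp_all add: is_theory_over_def is_theory_def)
  have JA: "J n m \<in> hom V (VHom S n m) (VHom W n m)" for n m
    using S unfolding is_theory_over_def is_theory_mor_def is_vfun_def by simp
  have KA: "K n m \<in> hom V (VHom T n m) (VHom W n m)" for n m
    using T unfolding is_theory_over_def is_theory_mor_def is_vfun_def by simp
  have KC: "K n l \<cdot> VComp T n m l = VComp W n m l \<cdot> prod_arr V (K m l) (K n m)"
    and KI: "K n n \<cdot> VId T n = VId W n" for n m l
    using T unfolding is_theory_over_def is_theory_mor_def is_vfun_def by simp_all
  have JC: "J n l \<cdot> VComp S n m l = VComp W n m l \<cdot> prod_arr V (J m l) (J n m)"
    and JI: "J n n \<cdot> VId S n = VId W n" for n m l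
    using S unfolding is_theory_over_def is_theory_mor_def is_vfun_def by simp_all
  have KP: "K n 1 \<cdot> VProj T n i = VProj W n i" and JP: "J n 1 \<cdot> VProj S n i = VProj W n i"
    and SP: "VProj S n i \<in> hom V \<one> (VHom S n 1)" and TP: "VProj T n i \<in> hom V \<one> (VHom T n 1)"
    if "i < n" for n i
    using S T that unfolding is_theory_over_def is_theory_mor_def is_theory_def is_conical_power_def
    by simp_all
  note [simp] = vcat_hom[OF Sv] vcat_hom[OF Tv] vcat_hom[OF Wv]
    vcat_id[OF Sv, simplified] vcat_id[OF Tv, simplified]
    vcat_comp[OF Sv, simplified] vcat_comp[OF Tv, simplified] vcat_comp[OF Wv, simplified]
    SP[simplified] TP[simplified] JA[simplified] KA[simplified] F(1)[simplified]
  have KF: "K n m \<cdot> (F n m \<cdot> p) = J n m \<cdot> p" if "p \<in> Arr V" "Cod V p = VHom S n m" for n m p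
    using that F(2)[of n m] by (simp flip: comp_assoc)
  have "F n n \<cdot> VId S n = VId T n" for n
    by (rule mono_cancel[OF mono[of n n]]) (simp_all add: KF JI KI)
  moreover have "F n l \<cdot> VComp S n m l = VComp T n m l \<cdot> prod_arr V (F m l) (F n m)" for n m l
  proof (rule mono_cancel[OF mono[of n l]])
    have "K n l \<cdot> (VComp T n m l \<cdot> prod_arr V (F m l) (F n m)) =
        (K n l \<cdot> VComp T n m l) \<cdot> prod_arr V (F m l) (F n m)" by simp
    also have "\<dots> = VComp W n m l \<cdot> prod_arr V (J m l) (J n m)"
      unfolding KC by (simp add: prod_arr_def KF)
    finally show "K n l \<cdot> (F n l \<cdot> VComp S n m l) =
        K n l \<cdot> (VComp T n m l \<cdot> prod_arr V (F m l) (F n m))"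
      by (simp add: KF JC)
  qed simp_all
  moreover have "F n 1 \<cdot> VProj S n i = VProj T n i" if "i < n" for n i
    using that by - (rule mono_cancel[OF mono[of n 1]], simp_all add: KF JP[simplified] KP[simplified])
  ultimately show ?thesis by (simp add: is_theory_mor_def is_vfun_def)
qed

lemma mutual_factors_inverse:
  assumes j: "is_mono V j" and f: "f \<in> hom V A B" and g: "g \<in> hom V B A"
    and j_arr: "j \<in> hom V A C" and k: "k \<in> hom V B C" and kf: "k \<cdot> f = j" and jg: "j \<cdot> g = k"
  shows "g \<cdot> f = Ide V A"
proof -
  have [simp]: "A \<in> Obj V" using f by auto
  have "j \<cdot> (g \<cdot> f) = (j \<cdot> g) \<cdot> f" using f g j_arr by simp
  also have "\<dots> = j \<cdot> Ide V A" unfolding jg kf using j_arr by simp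
  finally show ?thesis using f g j_arr by - (rule mono_cancel[OF j], simp_all)
qed

lemma iso_over_mono:
  assumes S: "is_theory_over V W S J" and T: "is_theory_over V W T K"
    and mono: "\<And>n m. is_mono V (J n m)" "\<And>n m. is_mono V (K n m)"
    and F: "\<And>n m. F n m \<in> hom V (VHom S n m) (VHom T n m)" "\<And>n m. K n m \<cdot> F n m = J n m"
    and G: "\<And>n m. G n m \<in> hom V (VHom T n m) (VHom S n m)" "\<And>n m. J n m \<cdot> G n m = K n m"
  shows "iso_over V W S J T K"
proof -
  have J: "J n m \<in> hom V (VHom S n m) (VHom W n m)"
    and K: "K n m \<in> hom V (VHom T n m) (VHom W n m)" for n m
    using S T unfolding is_theory_over_def is_theory_mor_def is_vfun_def is_theory_def by simp_all
  have "is_mor_over V S J T K F" "is_mor_over V T K S J G"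
    using theory_mor_into_mono[OF S T mono(2) F] theory_mor_into_mono[OF T S mono(1) G] F(2) G(2)
    by (simp_all add: is_mor_over_def)
  moreover have "G n m \<cdot> F n m = Ide V (VHom S n m)" "F n m \<cdot> G n m = Ide V (VHom T n m)" for n m
    using mutual_factors_inverse[OF mono(1) F(1) G(1) J K F(2) G(2)]
      mutual_factors_inverse[OF mono(2) G(1) F(1) K J G(2) F(2)] by blast+
  ultimately show ?thesis using S T unfolding iso_over_def by blast
qed

end

section \<open>Rigs\<close>

locale rig_object = cartesian_closed V
  for V :: "('o, 'a) ccc" (structure) +
  fixes R :: "('o, 'a) rig"
  assumes rig: "is_rig V R"
begin

abbreviation K :: 'o where "K \<equiv> Car R"

lemma rig_arr [simp]:
  "K \<in> Obj V"
  "Add R \<in> Arr V" "Dom V (Add R) = K \<otimes> K" "Cod V (Add R) = K"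
  "Mul R \<in> Arr V" "Dom V (Mul R) = K \<otimes> K" "Cod V (Mul R) = K"
  "Zero R \<in> Arr V" "Dom V (Zero R) = \<one>" "Cod V (Zero R) = K"
  "One R \<in> Arr V" "Dom V (One R) = \<one>" "Cod V (One R) = K"
  using rig unfolding is_rig_def by simp_all

lemma gadd_arr [simp]:
  assumes "a \<in> Arr V" "b \<in> Arr V" "Dom V a = Dom V b" "Cod V a = K" "Cod V b = K"
  shows "gadd V R a b \<in> Arr V" "Dom V (gadd V R a b) = Dom V b" "Cod V (gadd V R a b) = K"
    "p \<in> Arr V \<Longrightarrow> Cod V p = Dom V b \<Longrightarrow> gadd V R a b \<cdot> p = gadd V R (a \<cdot> p) (b \<cdot> p)"
  using assms by (simp_all add: gadd_def)

lemma gmul_arr [simp]: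
  assumes "a \<in> Arr V" "b \<in> Arr V" "Dom V a = Dom V b" "Cod V a = K" "Cod V b = K"
  shows "gmul V R a b \<in> Arr V" "Dom V (gmul V R a b) = Dom V b" "Cod V (gmul V R a b) = K"
    "p \<in> Arr V \<Longrightarrow> Cod V p = Dom V b \<Longrightarrow> gmul V R a b \<cdot> p = gmul V R (a \<cdot> p) (b \<cdot> p)"
  using assms by (simp_all add: gmul_def)

lemma gzero_arr [simp]:
  assumes "Z \<in> Obj V"
  shows "gzero V R Z \<in> Arr V" "Dom V (gzero V R Z) = Z" "Cod V (gzero V R Z) = K"
    "p \<in> Arr V \<Longrightarrow> Cod V p = Z \<Longrightarrow> gzero V R Z \<cdot> p = gzero V R (Dom V p)"
  using assms by (simp_all add: gzero_def)

lemma gone_arr [simp]: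
  assumes "Z \<in> Obj V"
  shows "gone V R Z \<in> Arr V" "Dom V (gone V R Z) = Z" "Cod V (gone V R Z) = K"
    "p \<in> Arr V \<Longrightarrow> Cod V p = Z \<Longrightarrow> gone V R Z \<cdot> p = gone V R (Dom V p)"
  using assms by (simp_all add: gone_def)

lemma rig_laws:
  assumes "a \<in> hom V Z K" "b \<in> hom V Z K" "c \<in> hom V Z K"
  shows "gadd V R (gadd V R a b) c = gadd V R a (gadd V R b c)"
    "gadd V R a b = gadd V R b a"
    "gadd V R a (gzero V R Z) = a"
    "gmul V R (gmul V R a b) c = gmul V R a (gmul V R b c)"
    "gmul V R a (gone V R Z) = a"
    "gmul V R (gone V R Z) a = a"
    "gmul V R a (gadd V R b c) = gadd V R (gmul V R a b) (gmul V R a c)"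
    "gmul V R (gadd V R a b) c = gadd V R (gmul V R a c) (gmul V R b c)"
    "gmul V R a (gzero V R Z) = gzero V R Z"
    "gmul V R (gzero V R Z) a = gzero V R Z"
proof -
  have Z: "Z \<in> Obj V" using assms(1) by auto
  note laws = rig [unfolded is_rig_def, THEN conjunct2, THEN conjunct2, THEN conjunct2,
      THEN conjunct2, THEN conjunct2, rule_format, OF Z assms]
  show "gadd V R (gadd V R a b) c = gadd V R a (gadd V R b c)"
    "gadd V R a b = gadd V R b a"
    "gadd V R a (gzero V R Z) = a"
    "gmul V R (gmul V R a b) c = gmul V R a (gmul V R b c)"
    "gmul V R a (gone V R Z) = a"
    "gmul V R (gone V R Z) a = a"
    "gmul V R a (gadd V R b c) = gadd V R (gmul V R a b) (gmul V R a c)"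
    "gmul V R (gadd V R a b) c = gadd V R (gmul V R a c) (gmul V R b c)"
    "gmul V R a (gzero V R Z) = gzero V R Z"
    "gmul V R (gzero V R Z) a = gzero V R Z"
    using laws by blast+
qed

lemma rig_units [simp]:
  assumes "a \<in> Arr V" "Dom V a = Z" "Cod V a = K"
  shows "gadd V R a (gzero V R Z) = a" "gadd V R (gzero V R Z) a = a"
    "gmul V R a (gone V R Z) = a" "gmul V R (gone V R Z) a = a"
    "gmul V R a (gzero V R Z) = gzero V R Z" "gmul V R (gzero V R Z) a = gzero V R Z"
proof -
  have Z: "Z \<in> Obj V" and a: "a \<in> hom V Z K" using assms by auto
  show "gadd V R a (gzero V R Z) = a" "gmul V R a (gone V R Z) = a" "gmul V R (gone V R Z) a = a"
    "gmul V R a (gzero V R Z) = gzero V R Z" "gmul V R (gzero V R Z) a = gzero V R Z"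
    by (rule rig_laws[OF a a a])+
  then show "gadd V R (gzero V R Z) a = a"
    using rig_laws(2)[OF _ a a, of "gzero V R Z"] Z by simp
qed

lemma gadd_swap:
  assumes "a \<in> hom V Z K" "b \<in> hom V Z K" "c \<in> hom V Z K" "d \<in> hom V Z K"
  shows "gadd V R (gadd V R a b) (gadd V R c d) = gadd V R (gadd V R a c) (gadd V R b d)"
proof -
  have "gadd V R (gadd V R a b) (gadd V R c d) = gadd V R a (gadd V R (gadd V R b c) d)"
    using assms rig_laws(1)[of a Z b "gadd V R c d"] rig_laws(1)[of b Z c d] by simp
  also have "\<dots> = gadd V R a (gadd V R (gadd V R c b) d)"
    using rig_laws(2)[OF assms(2,3,3)] by simp
  also have "\<dots> = gadd V R (gadd V R a c) (gadd V R b d)"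
    using assms rig_laws(1)[of a Z c "gadd V R b d"] rig_laws(1)[of c Z b d] by simp
  finally show ?thesis .
qed

subsection \<open>Finite sums\<close>

lemma gsum_cong [cong]:
  assumes "Z = Z'" "n = n'" "\<And>i. i < n' \<Longrightarrow> f i = f' i"
  shows "gsum V R Z f n = gsum V R Z' f' n'"
proof -
  have "(\<And>i. i < k \<Longrightarrow> f i = f' i) \<Longrightarrow> gsum V R Z f k = gsum V R Z f' k" for k
    by (induction k) simp_all
  then show ?thesis using assms by blast
qed

lemma gsum_arr [simp]:
  assumes "Z \<in> Obj V" "\<And>i. i < n \<Longrightarrow> f i \<in> hom V Z K"
  shows "gsum V R Z f n \<in> Arr V" "Dom V (gsum V R Z f n) = Z" "Cod V (gsum V R Z f n) = K"
proof -
  have "gsum V R Z f n \<in> hom V Z K"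
    using assms(2) by (induction n) (use assms(1) in simp_all)
  then show "gsum V R Z f n \<in> Arr V" "Dom V (gsum V R Z f n) = Z" "Cod V (gsum V R Z f n) = K"
    by simp_all
qed

lemma gsum_comp [simp]:
  assumes "p \<in> Arr V" "Cod V p = Z" "\<And>i. i < n \<Longrightarrow> f i \<in> hom V Z K"
  shows "gsum V R Z f n \<cdot> p = gsum V R (Dom V p) (\<lambda>i. f i \<cdot> p) n"
proof -
  have "Z \<in> Obj V" using assms by auto
  then show ?thesis using assms(3) by (induction n) (use assms(1,2) in simp_all)
qed

lemma gsum_zero [simp]: "Z \<in> Obj V \<Longrightarrow> gsum V R Z (\<lambda>_. gzero V R Z) n = gzero V R Z"
  by (induction n) simp_all

lemma gsum_add:
  assumes "Z \<in> Obj V" "\<And>i. i < n \<Longrightarrow> f i \<in> hom V Z K" "\<And>i. i < n \<Longrightarrow> g i \<in> hom V Z K"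
  shows "gsum V R Z (\<lambda>i. gadd V R (f i) (g i)) n = gadd V R (gsum V R Z f n) (gsum V R Z g n)"
  using assms(2,3)
proof (induction n)
  case (Suc n)
  then show ?case
    using assms(1) gadd_swap[of "gsum V R Z f n" Z "gsum V R Z g n" "f n" "g n"] by simp
qed (use assms(1) in simp)

lemma gsum_mul:
  assumes "a \<in> hom V Z K" "\<And>i. i < n \<Longrightarrow> f i \<in> hom V Z K"
  shows "gmul V R a (gsum V R Z f n) = gsum V R Z (\<lambda>i. gmul V R a (f i)) n"
    "gmul V R (gsum V R Z f n) a = gsum V R Z (\<lambda>i. gmul V R (f i) a) n"
proof -
  have Z: "Z \<in> Obj V" using assms(1) by auto
  show "gmul V R a (gsum V R Z f n) = gsum V R Z (\<lambda>i. gmul V R a (f i)) n"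
    using assms(2)
  proof (induction n)
    case (Suc n)
    then show ?case using assms(1) Z rig_laws(7)[of a Z "gsum V R Z f n" "f n"] by simp
  qed (use assms(1) in simp)
  show "gmul V R (gsum V R Z f n) a = gsum V R Z (\<lambda>i. gmul V R (f i) a) n"
    using assms(2)
  proof (induction n)
    case (Suc n)
    then show ?case using assms(1) Z rig_laws(8)[of "gsum V R Z f n" Z "f n" a] by simp
  qed (use assms(1) in simp)
qed

lemma gsum_swap:
  assumes "Z \<in> Obj V" "\<And>i j. i < n \<Longrightarrow> j < m \<Longrightarrow> f i j \<in> hom V Z K"
  shows "gsum V R Z (\<lambda>i. gsum V R Z (f i) m) n = gsum V R Z (\<lambda>j. gsum V R Z (\<lambda>i. f i j) n) m"
  using assms(2)
proof (induction n)
  case (Suc n)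
  then show ?case
    using assms(1) gsum_add[of Z m "\<lambda>j. gsum V R Z (\<lambda>i. f i j) n" "f n"] by simp
qed (use assms(1) in simp)

text \<open>The associativity \<open>(a b) c = a (b c)\<close> of matrix products, for one row \<open>a\<close> and one column \<open>c\<close>.
  It accounts for the associativity of composition in the theories of matrices, for their actions
  being functorial, and for the naturality of affine maps.\<close>

lemma gsum_bilinear_assoc:
  assumes Z: "Z \<in> Obj V" and a: "\<And>j. j < m \<Longrightarrow> a j \<in> hom V Z K"
    and b: "\<And>j i. j < m \<Longrightarrow> i < n \<Longrightarrow> b j i \<in> hom V Z K"
    and c: "\<And>i. i < n \<Longrightarrow> c i \<in> hom V Z K"
  shows "gsum V R Z (\<lambda>i. gmul V R (gsum V R Z (\<lambda>j. gmul V R (a j) (b j i)) m) (c i)) n =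
    gsum V R Z (\<lambda>j. gmul V R (a j) (gsum V R Z (\<lambda>i. gmul V R (b j i) (c i)) n)) m"
proof -
  have "gsum V R Z (\<lambda>i. gmul V R (gsum V R Z (\<lambda>j. gmul V R (a j) (b j i)) m) (c i)) n =
      gsum V R Z (\<lambda>i. gsum V R Z (\<lambda>j. gmul V R (a j) (gmul V R (b j i) (c i))) m) n"
    using assms by (simp add: gsum_mul rig_laws(4)[of _ Z])
  also have "\<dots> = gsum V R Z (\<lambda>j. gsum V R Z (\<lambda>i. gmul V R (a j) (gmul V R (b j i) (c i))) n) m"
    using assms by - (rule gsum_swap, simp_all)
  also have "\<dots> = gsum V R Z (\<lambda>j. gmul V R (a j) (gsum V R Z (\<lambda>i. gmul V R (b j i) (c i)) n)) m"
    using assms by (simp add: gsum_mul)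
  finally show ?thesis .
qed

lemma gsum_Suc_shift:
  assumes "Z \<in> Obj V" "\<And>i. i < Suc n \<Longrightarrow> f i \<in> hom V Z K"
  shows "gsum V R Z f (Suc n) = gadd V R (f 0) (gsum V R Z (\<lambda>i. f (Suc i)) n)"
  using assms(2)
proof (induction n)
  case (Suc n)
  have "gsum V R Z f (Suc (Suc n)) = gadd V R (gadd V R (f 0) (gsum V R Z (\<lambda>i. f (Suc i)) n)) (f (Suc n))"
    using Suc by simp
  then show ?case
    using Suc.prems assms(1) rig_laws(1)[of "f 0" Z "gsum V R Z (\<lambda>i. f (Suc i)) n" "f (Suc n)"] by simp
qed (use assms(1) in simp)

lemma gdelta_arr [simp]:
  assumes "Z \<in> Obj V"
  shows "gdelta V R Z i j \<in> Arr V" "Dom V (gdelta V R Z i j) = Z" "Cod V (gdelta V R Z i j) = K"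
    "p \<in> Arr V \<Longrightarrow> Cod V p = Z \<Longrightarrow> gdelta V R Z i j \<cdot> p = gdelta V R (Dom V p) i j"
  using assms by (simp_all add: gdelta_def)

lemma gdelta_simps [simp]:
  "gdelta V R Z i i = gone V R Z" "gdelta V R Z (Suc i) (Suc j) = gdelta V R Z i j"
  "gdelta V R Z (Suc i) 0 = gzero V R Z" "gdelta V R Z 0 (Suc i) = gzero V R Z"
  by (simp_all add: gdelta_def)

lemma gsum_single:
  assumes Z: "Z \<in> Obj V" and f: "\<And>i. i < n \<Longrightarrow> f i \<in> hom V Z K"
    and 0: "\<And>i. i < n \<Longrightarrow> i \<noteq> k \<Longrightarrow> f i = gzero V R Z"
  shows "gsum V R Z f n = (if k < n then f k else gzero V R Z)"
  using f 0
proof (induction n)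
  case (Suc n)
  then show ?case using Z by (cases "k = n") (simp_all add: less_Suc_eq)
qed simp

lemma gsum_delta [simp]:
  assumes "Z \<in> Obj V" "\<And>i. i < n \<Longrightarrow> f i \<in> hom V Z K" "k < n"
  shows "gsum V R Z (\<lambda>i. gmul V R (gdelta V R Z k i) (f i)) n = f k"
    "gsum V R Z (\<lambda>i. gmul V R (gdelta V R Z i k) (f i)) n = f k"
    "gsum V R Z (\<lambda>i. gmul V R (f i) (gdelta V R Z k i)) n = f k"
    "gsum V R Z (\<lambda>i. gmul V R (f i) (gdelta V R Z i k)) n = f k"
proof -
  show "gsum V R Z (\<lambda>i. gmul V R (gdelta V R Z k i) (f i)) n = f k"
    "gsum V R Z (\<lambda>i. gmul V R (gdelta V R Z i k) (f i)) n = f k"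
    "gsum V R Z (\<lambda>i. gmul V R (f i) (gdelta V R Z k i)) n = f k"
    "gsum V R Z (\<lambda>i. gmul V R (f i) (gdelta V R Z i k)) n = f k"
    using assms by (subst gsum_single[where k = k], simp_all add: gdelta_def)+
qed

section \<open>The theory of pointed right modules\<close>

text \<open>Homogeneous coordinates.  The affine operation \<open>u\<^sub>0 + \<Sum>\<^sub>i x\<^sub>i u\<^sub>i\<close> is the product of the vector
  \<open>(1, x\<^sub>1, \<dots>, x\<^sub>n)\<close> with \<open>(u\<^sub>0, \<dots>, u\<^sub>n)\<close>, and substitution is multiplication of matrices to which
  the row \<open>(1, 0, \<dots>, 0)\<close> is added on top.  This turns all computations with pointed modules into
  ones with matrix products.\<close>

definition prepend_one :: "'o \<Rightarrow> (nat \<Rightarrow> 'a) \<Rightarrow> nat \<Rightarrow> 'a" where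
  "prepend_one Z x i = (case i of 0 \<Rightarrow> gone V R Z | Suc i \<Rightarrow> x i)"

definition prepend_row :: "'o \<Rightarrow> (nat \<Rightarrow> nat \<Rightarrow> 'a) \<Rightarrow> nat \<Rightarrow> nat \<Rightarrow> 'a" where
  "prepend_row Z u j i = (case j of 0 \<Rightarrow> gdelta V R Z 0 i | Suc j \<Rightarrow> u j i)"

lemma prepend_one_simps [simp]:
  "prepend_one Z x 0 = gone V R Z" "prepend_one Z x (Suc i) = x i"
  by (simp_all add: prepend_one_def)

lemma prepend_row_simps [simp]:
  "prepend_row Z u 0 i = gdelta V R Z 0 i" "prepend_row Z u (Suc j) i = u j i"
  by (simp_all add: prepend_row_def)

lemma prepend_one_arr [simp]:
  assumes "Z \<in> Obj V" "\<And>k. i = Suc k \<Longrightarrow> x k \<in> hom V Z K"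
  shows "prepend_one Z x i \<in> Arr V" "Dom V (prepend_one Z x i) = Z" "Cod V (prepend_one Z x i) = K"
  using assms by (cases i; simp)+

lemma prepend_row_arr [simp]:
  assumes "Z \<in> Obj V" "\<And>k. j = Suc k \<Longrightarrow> u k i \<in> hom V Z K"
  shows "prepend_row Z u j i \<in> Arr V" "Dom V (prepend_row Z u j i) = Z"
    "Cod V (prepend_row Z u j i) = K"
  using assms by (cases j; simp)+

lemma PMat_simps [simp]:
  "VObj (PMat_op V R) = UNIV" "VHom (PMat_op V R) n m = pow V (pow V K (Suc n)) m"
  by (simp_all add: PMat_op_def)

lemma PMat_id [simp]:
  "VId (PMat_op V R) n \<in> Arr V" "Dom V (VId (PMat_op V R) n) = \<one>"
  "Cod V (VId (PMat_op V R) n) = pow V (pow V K (Suc n)) n"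
  "p \<in> Arr V \<Longrightarrow> Cod V p = \<one> \<Longrightarrow> j < n \<Longrightarrow> i < Suc n \<Longrightarrow>
    ent V K (Suc n) n (VId (PMat_op V R) n \<cdot> p) j i = gdelta V R (Dom V p) (Suc j) i"
  by (simp_all add: PMat_op_def)

lemma PMat_proj [simp]:
  "VProj (PMat_op V R) n i \<in> Arr V" "Dom V (VProj (PMat_op V R) n i) = \<one>"
  "Cod V (VProj (PMat_op V R) n i) = pow V K (Suc n)"
  "p \<in> Arr V \<Longrightarrow> Cod V p = \<one> \<Longrightarrow> i' < Suc n \<Longrightarrow>
    ent V K (Suc n) (Suc 0) (VProj (PMat_op V R) n i \<cdot> p) 0 i' = gdelta V R (Dom V p) (Suc i) i'"
  by (simp_all add: PMat_op_def)

lemma PMat_comp [simp]: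
  "VComp (PMat_op V R) n m l \<in> Arr V"
  "Dom V (VComp (PMat_op V R) n m l) = pow V (pow V K (Suc m)) l \<otimes> pow V (pow V K (Suc n)) m"
  "Cod V (VComp (PMat_op V R) n m l) = pow V (pow V K (Suc n)) l"
  by (simp_all add: PMat_op_def Let_def)

lemma PMat_gcomp [simp]:
  assumes "u \<in> Arr V" "v \<in> Arr V" "Dom V v = Dom V u" "Cod V u = pow V (pow V K (Suc n)) m"
    "Cod V v = pow V (pow V K (Suc m)) l"
  shows "gcomp V (PMat_op V R) n m l v u \<in> Arr V"
    "Dom V (gcomp V (PMat_op V R) n m l v u) = Dom V u"
    "Cod V (gcomp V (PMat_op V R) n m l v u) = pow V (pow V K (Suc n)) l"
    "k < l \<Longrightarrow> i < Suc n \<Longrightarrow> ent V K (Suc n) l (gcomp V (PMat_op V R) n m l v u) k i =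
      gsum V R (Dom V u) (\<lambda>j. gmul V R (prepend_row (Dom V u) (ent V K (Suc n) m u) j i)
        (ent V K (Suc m) l v k j)) (Suc m)"
    "p \<in> Arr V \<Longrightarrow> Cod V p = Dom V u \<Longrightarrow>
      gcomp V (PMat_op V R) n m l v u \<cdot> p = gcomp V (PMat_op V R) n m l (v \<cdot> p) (u \<cdot> p)"
proof -
  show "gcomp V (PMat_op V R) n m l v u \<in> Arr V"
    "Dom V (gcomp V (PMat_op V R) n m l v u) = Dom V u"
    "Cod V (gcomp V (PMat_op V R) n m l v u) = pow V (pow V K (Suc n)) l"
    "p \<in> Arr V \<Longrightarrow> Cod V p = Dom V u \<Longrightarrow>
      gcomp V (PMat_op V R) n m l v u \<cdot> p = gcomp V (PMat_op V R) n m l (v \<cdot> p) (u \<cdot> p)"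
    using assms by (simp_all add: gcomp_def)
  show "ent V K (Suc n) l (gcomp V (PMat_op V R) n m l v u) k i =
      gsum V R (Dom V u) (\<lambda>j. gmul V R (prepend_row (Dom V u) (ent V K (Suc n) m u) j i)
        (ent V K (Suc m) l v k j)) (Suc m)" if "k < l" "i < Suc n"
    using assms that
    by (subst gsum_Suc_shift; cases i) (simp_all add: gcomp_def PMat_op_def Let_def)
qed

text \<open>The added row of a composite is the product of the added rows, so that the description of the
  entries in \<open>PMat_gcomp\<close> can be iterated.\<close>

lemma prepend_row_gcomp:
  assumes "u \<in> hom V Z (pow V (pow V K (Suc n)) m)" "v \<in> hom V Z (pow V (pow V K (Suc m)) l)"
    "k < Suc l" "i < Suc n"
  shows "prepend_row Z (ent V K (Suc n) l (gcomp V (PMat_op V R) n m l v u)) k i =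
    gsum V R Z (\<lambda>j. gmul V R (prepend_row Z (ent V K (Suc n) m u) j i)
      (prepend_row Z (ent V K (Suc m) l v) k j)) (Suc m)"
proof -
  have "Z \<in> Obj V" using assms(1) by auto
  \<comment> \<open>The recursion equations are removed to keep the sum over \<open>Suc m\<close> terms in one piece.\<close>
  then show ?thesis using assms by (cases k) (simp_all del: gsum.simps)
qed

lemma PMat_vcat: "is_vcat V (PMat_op V R)"
proof (rule is_vcatI)
  fix n m Z u assume Z: "Z \<in> Obj V" and u: "u \<in> hom V Z (VHom (PMat_op V R) n m)"
  show "gcomp V (PMat_op V R) n n m u (VId (PMat_op V R) n \<cdot> bang V Z) = u"
  proof (rule mat_ext[of _ Z K "Suc n" m])
    fix j i assume "j < m" "i < Suc n"
    moreover have "prepend_row Z (ent V K (Suc n) n (VId (PMat_op V R) n \<cdot> bang V Z)) j i =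
        gdelta V R Z j i" if "j < Suc n" for j
      using that Z \<open>i < Suc n\<close> by (cases j) simp_all
    ultimately show "ent V K (Suc n) m (gcomp V (PMat_op V R) n n m u (VId (PMat_op V R) n \<cdot> bang V Z)) j i =
        ent V K (Suc n) m u j i"
      using Z u by (simp del: gsum.simps)
  qed (use u Z in simp_all)
  show "gcomp V (PMat_op V R) n m m (VId (PMat_op V R) m \<cdot> bang V Z) u = u"
    by (rule mat_ext[of _ Z K "Suc n" m]) (use u Z in \<open>simp_all del: gsum.simps\<close>)
next
  fix k l m n Z u v w
  assume Z: "Z \<in> Obj V" and u: "u \<in> hom V Z (VHom (PMat_op V R) k l)"
    and v: "v \<in> hom V Z (VHom (PMat_op V R) l m)" and w: "w \<in> hom V Z (VHom (PMat_op V R) m n)"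
  show "gcomp V (PMat_op V R) k l n (gcomp V (PMat_op V R) l m n w v) u =
      gcomp V (PMat_op V R) k m n w (gcomp V (PMat_op V R) k l m v u)"
  proof (rule mat_ext[of _ Z K "Suc k" n])
    fix j i assume "j < n" "i < Suc k"
    then show "ent V K (Suc k) n (gcomp V (PMat_op V R) k l n (gcomp V (PMat_op V R) l m n w v) u) j i =
        ent V K (Suc k) n (gcomp V (PMat_op V R) k m n w (gcomp V (PMat_op V R) k l m v u)) j i"
      using Z u v w by (simp del: gsum.simps add: prepend_row_gcomp gsum_bilinear_assoc)
  qed (use u v w Z in simp_all)
qed simp_all

lemma PMat_theory: "is_theory V (PMat_op V R)"
  unfolding is_theory_def
proof (intro conjI allI)
  show "is_conical_power V (PMat_op V R) 1 n n (VProj (PMat_op V R) n)" for n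
    unfolding is_conical_power_def
  proof (intro conjI ballI)
    fix z
    have "gcomp V (PMat_op V R) z n 1 (VProj (PMat_op V R) n p \<cdot> bang V (VHom (PMat_op V R) z n))
        (Ide V (VHom (PMat_op V R) z n)) = pproj V (pow V K (Suc z)) n p" if "p < n" for p
      using that
      by - (rule mat_ext[of _ "VHom (PMat_op V R) z n" K "Suc z" "Suc 0"],
          simp_all del: gsum.simps, simp add: ent_def)
    then show "is_power V (VHom (PMat_op V R) z 1) n (VHom (PMat_op V R) z n)
       (\<lambda>i. gcomp V (PMat_op V R) z n 1 (VProj (PMat_op V R) n i \<cdot> bang V (VHom (PMat_op V R) z n))
         (Ide V (VHom (PMat_op V R) z n)))"
      using pow_power[of "pow V K (Suc z)" n]
      by (subst is_power_cong[where q' = "pproj V (pow V K (Suc z)) n"]) simp_all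
  qed simp_all
  show "VProj (PMat_op V R) 1 0 = VId (PMat_op V R) 1"
    unfolding PMat_op_def by (simp, rule mat_cong) simp_all
qed (simp_all add: PMat_vcat)

lemma PMat_mor_arr [simp]:
  "PMat_op_mor V R n m \<in> Arr V"
  "Dom V (PMat_op_mor V R n m) = pow V (pow V K (Suc n)) m"
  "Cod V (PMat_op_mor V R n m) = Exp V (pow V K n) (pow V K m)"
  by (simp_all add: PMat_op_mor_def Let_def)

lemma PMat_mor_apply [simp]:
  assumes "u \<in> Arr V" "x \<in> Arr V" "Dom V u = Dom V x" "Cod V u = pow V (pow V K (Suc n)) m"
    "Cod V x = pow V K n" "j < m"
  shows "pproj V K m j \<cdot> ap (pow V K n) (pow V K m) (PMat_op_mor V R n m \<cdot> u) x =
    gsum V R (Dom V x) (\<lambda>i. gmul V R (prepend_one (Dom V x) (\<lambda>i. pproj V K n i \<cdot> x) i)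
      (ent V K (Suc n) m u j i)) (Suc n)"
  using assms by (subst gsum_Suc_shift) (simp_all add: PMat_op_mor_def Let_def)

text \<open>The counterpart of \<open>prepend_row_gcomp\<close> for the action on vectors.\<close>

lemma prepend_one_apply:
  assumes "u \<in> Arr V" "x \<in> Arr V" "Dom V u = Z" "Dom V x = Z"
    "Cod V u = pow V (pow V K (Suc n)) m" "Cod V x = pow V K n" "j < Suc m"
  shows "prepend_one Z (\<lambda>j. pproj V K m j \<cdot> ap (pow V K n) (pow V K m) (PMat_op_mor V R n m \<cdot> u) x) j =
    gsum V R Z (\<lambda>i. gmul V R (prepend_one Z (\<lambda>i. pproj V K n i \<cdot> x) i)
      (prepend_row Z (ent V K (Suc n) m u) j i)) (Suc n)"
proof -
  have "Z \<in> Obj V" using assms by auto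
  then show ?thesis using assms by (cases j) (simp_all del: gsum.simps)
qed

lemma PMat_mor: "is_theory_mor V (PMat_op V R) (full_theory V K) (PMat_op_mor V R)"
proof (rule is_theory_morI)
  fix n
  show "PMat_op_mor V R n n \<cdot> VId (PMat_op V R) n = VId (full_theory V K) n"
  proof (rule exp_ext[of _ \<one> "pow V K n" "pow V K n"])
    fix Z p x assume "Z \<in> Obj V" "p \<in> hom V Z \<one>" "x \<in> hom V Z (pow V K n)"
    then show "ap (pow V K n) (pow V K n) ((PMat_op_mor V R n n \<cdot> VId (PMat_op V R) n) \<cdot> p) x =
        ap (pow V K n) (pow V K n) (VId (full_theory V K) n \<cdot> p) x"
      by - (rule pow_ext[of _ Z K n], simp_all del: gsum.simps)
  qed simp_all
next
  fix n m l
  show "PMat_op_mor V R n l \<cdot> VComp (PMat_op V R) n m l = VComp (full_theory V K) n m l \<cdot>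
      prod_arr V (PMat_op_mor V R m l) (PMat_op_mor V R n m)"
  proof (rule comp_preservedI)
    fix Z u v
    assume Z: "Z \<in> Obj V" and u: "u \<in> hom V Z (VHom (PMat_op V R) n m)"
      and v: "v \<in> hom V Z (VHom (PMat_op V R) m l)"
    show "PMat_op_mor V R n l \<cdot> gcomp V (PMat_op V R) n m l v u =
        gcomp V (full_theory V K) n m l (PMat_op_mor V R m l \<cdot> v) (PMat_op_mor V R n m \<cdot> u)"
    proof (rule exp_ext[of _ Z "pow V K n" "pow V K l"])
      fix Z' p x
      assume "Z' \<in> Obj V" "p \<in> hom V Z' Z" "x \<in> hom V Z' (pow V K n)"
      then show "ap (pow V K n) (pow V K l) ((PMat_op_mor V R n l \<cdot> gcomp V (PMat_op V R) n m l v u) \<cdot> p) x =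
        ap (pow V K n) (pow V K l) (gcomp V (full_theory V K) n m l (PMat_op_mor V R m l \<cdot> v)
          (PMat_op_mor V R n m \<cdot> u) \<cdot> p) x"
        using Z u v
        by - (rule pow_ext[of _ Z' K l],
          simp_all del: gsum.simps add: prepend_one_apply gsum_bilinear_assoc)
    qed (use Z u v in simp_all)
  qed simp_all
next
  fix n i :: nat assume "i < n"
  have eq: "ap (pow V K n) K (PMat_op_mor V R n 1 \<cdot> (VProj (PMat_op V R) n i \<cdot> p)) x = pproj V K n i \<cdot> x"
    if "Z \<in> Obj V" "p \<in> hom V Z \<one>" "x \<in> hom V Z (pow V K n)" for Z p x
    using that \<open>i < n\<close> PMat_mor_apply[of "VProj (PMat_op V R) n i \<cdot> p" x n 1 0]
    by (simp del: gsum.simps PMat_mor_apply)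
  show "PMat_op_mor V R n 1 \<cdot> VProj (PMat_op V R) n i = VProj (full_theory V K) n i"
    by (rule exp_ext[of _ \<one> "pow V K n" K]) (use eq \<open>i < n\<close> in simp_all)
qed simp_all

end

section \<open>Natural transformations and commutants\<close>

context cartesian_closed
begin

text \<open>Naturality is tested on generalized elements \<open>p\<close> of the stage, \<open>t\<close> of the hom of \<open>C\<close> and \<open>a\<close> of
  the domain, all over a common stage; the defining equation is the case of the universal such
  triple.\<close>

lemma vnatI:
  assumes Z: "Z \<in> Obj V"
    and C: "\<And>x y. x \<in> VObj C \<Longrightarrow> y \<in> VObj C \<Longrightarrow> VHom C x y \<in> Obj V"
    and FG: "\<And>x. x \<in> VObj C \<Longrightarrow> FObj F x \<in> Obj V" "\<And>x. x \<in> VObj C \<Longrightarrow> FObj G x \<in> Obj V"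
      "\<And>x y. x \<in> VObj C \<Longrightarrow> y \<in> VObj C \<Longrightarrow> FArr F x y \<in> hom V (VHom C x y) (Exp V (FObj F x) (FObj F y))"
      "\<And>x y. x \<in> VObj C \<Longrightarrow> y \<in> VObj C \<Longrightarrow> FArr G x y \<in> hom V (VHom C x y) (Exp V (FObj G x) (FObj G y))"
    and \<theta>: "\<And>x. x \<in> VObj C \<Longrightarrow> \<theta> x \<in> hom V Z (Exp V (FObj F x) (FObj G x))"
    and nat: "\<And>x y Z' p t a. x \<in> VObj C \<Longrightarrow> y \<in> VObj C \<Longrightarrow> Z' \<in> Obj V \<Longrightarrow> p \<in> hom V Z' Z \<Longrightarrow>
      t \<in> hom V Z' (VHom C x y) \<Longrightarrow> a \<in> hom V Z' (FObj F x) \<Longrightarrow>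
      ap (FObj G x) (FObj G y) (FArr G x y \<cdot> t) (ap (FObj F x) (FObj G x) (\<theta> x \<cdot> p) a) =
      ap (FObj F y) (FObj G y) (\<theta> y \<cdot> p) (ap (FObj F x) (FObj F y) (FArr F x y \<cdot> t) a)"
  shows "is_vnat V C (self_vcat V) F G Z \<theta>"
  unfolding is_vnat_def Let_def
proof (intro conjI ballI)
  fix x y assume xy: "x \<in> VObj C" "y \<in> VObj C"
  note [simp] = C[OF xy] FG(1,2)[OF xy(1)] FG(1,2)[OF xy(2)] FG(3,4)[OF xy, simplified]
    \<theta>[OF xy(1), simplified] \<theta>[OF xy(2), simplified] Z
  let ?S = "Z \<otimes> VHom C x y" and ?e = "Pr1 V Z (VHom C x y)" and ?t = "Pr2 V Z (VHom C x y)"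
  show "gcomp V (self_vcat V) (FObj F x) (FObj G x) (FObj G y) (FArr G x y \<cdot> ?t) (\<theta> x \<cdot> ?e) =
      gcomp V (self_vcat V) (FObj F x) (FObj F y) (FObj G y) (\<theta> y \<cdot> ?e) (FArr F x y \<cdot> ?t)"
  proof (rule exp_ext[of _ ?S "FObj F x" "FObj G y"])
    fix S p a assume "S \<in> Obj V" "p \<in> hom V S ?S" "a \<in> hom V S (FObj F x)"
    then show "ap (FObj F x) (FObj G y) (gcomp V (self_vcat V) (FObj F x) (FObj G x) (FObj G y)
          (FArr G x y \<cdot> ?t) (\<theta> x \<cdot> ?e) \<cdot> p) a =
        ap (FObj F x) (FObj G y) (gcomp V (self_vcat V) (FObj F x) (FObj F y) (FObj G y)
          (\<theta> y \<cdot> ?e) (FArr F x y \<cdot> ?t) \<cdot> p) a"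
      using nat[OF xy, of S "?e \<cdot> p" "?t \<cdot> p" a] by simp
  qed simp_all
qed (use \<theta> in simp)

lemma vnatD:
  assumes Z: "Z \<in> Obj V"
    and C: "VHom C x y \<in> Obj V"
    and FG: "FObj F x \<in> Obj V" "FObj G x \<in> Obj V" "FObj F y \<in> Obj V" "FObj G y \<in> Obj V"
      "FArr F x y \<in> hom V (VHom C x y) (Exp V (FObj F x) (FObj F y))"
      "FArr G x y \<in> hom V (VHom C x y) (Exp V (FObj G x) (FObj G y))"
    and \<theta>: "is_vnat V C (self_vcat V) F G Z \<theta>"
    and xy: "x \<in> VObj C" "y \<in> VObj C"
    and gen: "p \<in> hom V Z' Z" "t \<in> hom V Z' (VHom C x y)" "a \<in> hom V Z' (FObj F x)"
  shows "ap (FObj G x) (FObj G y) (FArr G x y \<cdot> t) (ap (FObj F x) (FObj G x) (\<theta> x \<cdot> p) a) =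
      ap (FObj F y) (FObj G y) (\<theta> y \<cdot> p) (ap (FObj F x) (FObj F y) (FArr F x y \<cdot> t) a)"
proof -
  have [simp]: "\<theta> x \<in> Arr V" "Dom V (\<theta> x) = Z" "Cod V (\<theta> x) = Exp V (FObj F x) (FObj G x)"
      "\<theta> y \<in> Arr V" "Dom V (\<theta> y) = Z" "Cod V (\<theta> y) = Exp V (FObj F y) (FObj G y)"
    using \<theta> xy unfolding is_vnat_def by simp_all
  note [simp] = Z C FG(1-4) FG(5,6)[simplified]
  let ?e = "Pr1 V Z (VHom C x y)" and ?t = "Pr2 V Z (VHom C x y)"
  let ?L = "gcomp V (self_vcat V) (FObj F x) (FObj G x) (FObj G y) (FArr G x y \<cdot> ?t) (\<theta> x \<cdot> ?e)"
  let ?R = "gcomp V (self_vcat V) (FObj F x) (FObj F y) (FObj G y) (\<theta> y \<cdot> ?e) (FArr F x y \<cdot> ?t)"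
  have "?L = ?R" using \<theta> xy unfolding is_vnat_def Let_def by blast
  then have "ap (FObj F x) (FObj G y) (?L \<cdot> \<langle>p, t\<rangle>) a = ap (FObj F x) (FObj G y) (?R \<cdot> \<langle>p, t\<rangle>) a"
    by simp
  then show ?thesis using gen by simp
qed

end

text \<open>The data from which the pointwise powers \<open>n \<mapsto> X\<^sup>n\<close> of an algebra with carrier \<open>X\<close>
  and the natural transformations between them are formed.\<close>

locale theory_action = cartesian_closed V
  for V :: "('o, 'a) ccc" (structure) +
  fixes X :: 'o and T :: "('o, 'a) vtheory" and A :: "nat \<Rightarrow> nat \<Rightarrow> 'a"
  assumes X [simp]: "X \<in> Obj V"
    and T_obj [simp]: "VObj T = UNIV" "VHom T n m \<in> Obj V"
    and A_arr: "A n m \<in> hom V (VHom T n m) (Exp V (pow V X n) (pow V X m))"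
begin

abbreviation P :: "nat \<Rightarrow> (nat, 'o, 'a) vfun" where
  "P \<equiv> alg_pow V T (alg_over V X A)"

lemma A_arr' [simp]: "A n m \<in> Arr V" "Dom V (A n m) = VHom T n m"
  "Cod V (A n m) = Exp V (pow V X n) (pow V X m)"
  using A_arr[of n m] by simp_all

lemma alg_over_obj [simp]: "FObj (alg_over V X A) k = pow V X k"
  by (simp add: alg_over_def)

lemma P_obj [simp]: "FObj (P n) k = pow V (pow V X k) n"
  by (simp add: alg_pow_def)

lemma P_arr [simp]:
  "FArr (P n) k l \<in> Arr V" "Dom V (FArr (P n) k l) = VHom T k l"
  "Cod V (FArr (P n) k l) = Exp V (pow V (pow V X k) n) (pow V (pow V X l) n)"
  by (simp_all add: alg_pow_def alg_over_def Let_def)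

lemma P_apply [simp]:
  assumes "t \<in> Arr V" "a \<in> Arr V" "Dom V t = Dom V a" "Cod V t = VHom T k l"
    "Cod V a = pow V (pow V X k) n" "i < n"
  shows "pproj V (pow V X l) n i \<cdot>
      ap (pow V (pow V X k) n) (pow V (pow V X l) n) (FArr (P n) k l \<cdot> t) a =
    ap (pow V X k) (pow V X l) (A k l \<cdot> t) (pproj V (pow V X k) n i \<cdot> a)"
  using assms by (simp add: alg_pow_def alg_over_def Let_def)

lemma P_vnatI:
  assumes "Z \<in> Obj V"
    and "\<And>k. \<theta> k \<in> hom V Z (Exp V (pow V (pow V X k) n) (pow V (pow V X k) m))"
    and "\<And>k l Z' p t a. Z' \<in> Obj V \<Longrightarrow> p \<in> hom V Z' Z \<Longrightarrow>
      t \<in> hom V Z' (VHom T k l) \<Longrightarrow> a \<in> hom V Z' (pow V (pow V X k) n) \<Longrightarrow>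
      ap (pow V (pow V X k) m) (pow V (pow V X l) m) (FArr (P m) k l \<cdot> t)
        (ap (pow V (pow V X k) n) (pow V (pow V X k) m) (\<theta> k \<cdot> p) a) =
      ap (pow V (pow V X l) n) (pow V (pow V X l) m) (\<theta> l \<cdot> p)
        (ap (pow V (pow V X k) n) (pow V (pow V X l) n) (FArr (P n) k l \<cdot> t) a)"
  shows "is_vnat V T (self_vcat V) (P n) (P m) Z \<theta>"
  by (rule vnatI) (use assms(1,2) in simp_all, rule assms(3), simp_all)

lemma P_vnatD:
  assumes "is_vnat V T (self_vcat V) (P n) (P m) Z \<theta>" "Z \<in> Obj V" "p \<in> hom V Z' Z"
    "t \<in> hom V Z' (VHom T k l)" "a \<in> hom V Z' (pow V (pow V X k) n)"
  shows "ap (pow V (pow V X k) m) (pow V (pow V X l) m) (FArr (P m) k l \<cdot> t)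
        (ap (pow V (pow V X k) n) (pow V (pow V X k) m) (\<theta> k \<cdot> p) a) =
      ap (pow V (pow V X l) n) (pow V (pow V X l) m) (\<theta> l \<cdot> p)
        (ap (pow V (pow V X k) n) (pow V (pow V X l) n) (FArr (P n) k l \<cdot> t) a)"
  using vnatD[OF assms(2) _ _ _ _ _ _ _ assms(1), of k l p Z' t a] assms(3-5) by simp

lemma P_vnat_arr:
  assumes "is_vnat V T (self_vcat V) (P n) (P m) Z \<theta>"
  shows "\<theta> k \<in> hom V Z (Exp V (pow V (pow V X k) n) (pow V (pow V X k) m))"
  using assms unfolding is_vnat_def by simp

lemma nat_object_ex1:
  assumes "is_nat_object V T (self_vcat V) (P n) (P m) E \<epsilon>" "Z \<in> Obj V"
    "is_vnat V T (self_vcat V) (P n) (P m) Z \<theta>"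
  shows "\<exists>!h. h \<in> hom V Z E \<and> (\<forall>k. \<epsilon> k \<cdot> h = \<theta> k)"
  using assms unfolding is_nat_object_def by simp

lemma vnat_comp:
  assumes \<theta>: "is_vnat V T (self_vcat V) (P n) (P m) Z \<theta>" and f: "f \<in> hom V Z' Z"
  shows "is_vnat V T (self_vcat V) (P n) (P m) Z' (\<lambda>k. \<theta> k \<cdot> f)"
proof (rule P_vnatI)
  have [simp]: "Z \<in> Obj V" "Z' \<in> Obj V" using f by auto
  note [simp] = P_vnat_arr[OF \<theta>, simplified]
  show "Z' \<in> Obj V" by simp
  show "\<theta> k \<cdot> f \<in> hom V Z' (Exp V (pow V (pow V X k) n) (pow V (pow V X k) m))" for k
    using f by simp
  show "ap (pow V (pow V X k) m) (pow V (pow V X l) m) (FArr (P m) k l \<cdot> t)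
        (ap (pow V (pow V X k) n) (pow V (pow V X k) m) ((\<theta> k \<cdot> f) \<cdot> p) a) =
      ap (pow V (pow V X l) n) (pow V (pow V X l) m) ((\<theta> l \<cdot> f) \<cdot> p)
        (ap (pow V (pow V X k) n) (pow V (pow V X l) n) (FArr (P n) k l \<cdot> t) a)"
    if "S \<in> Obj V" "p \<in> hom V S Z'" "t \<in> hom V S (VHom T k l)" "a \<in> hom V S (pow V (pow V X k) n)"
    for k l S p t a
    using P_vnatD[OF \<theta>, of "f \<cdot> p" S t k l a] that f by simp
qed

lemma nat_object_comp_ext:
  assumes E: "is_nat_object V T (self_vcat V) (P n) (P m) E \<epsilon>"
    and hk: "h \<in> hom V Z E" "h' \<in> hom V Z E" "\<And>k. \<epsilon> k \<cdot> h = \<epsilon> k \<cdot> h'"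
  shows "h = h'"
proof -
  have "is_vnat V T (self_vcat V) (P n) (P m) E \<epsilon>" using E unfolding is_nat_object_def by blast
  from vnat_comp[OF this hk(2)] have "is_vnat V T (self_vcat V) (P n) (P m) Z (\<lambda>k. \<epsilon> k \<cdot> h')" .
  moreover have "Z \<in> Obj V" using hk(1) by auto
  ultimately have "\<exists>!g. g \<in> hom V Z E \<and> (\<forall>k. \<epsilon> k \<cdot> g = \<epsilon> k \<cdot> h')"
    by (intro nat_object_ex1[OF E])
  from ex1_eqD[OF this] show ?thesis using hk by blast
qed

text \<open>Objects of natural transformations are unique up to isomorphism, so the homs of \<open>S\<close> are isomorphic
  to the chosen ones, compatibly with the components at 1.  Hence the forgetful arrows of the
  commutant are monic and have the same image as \<open>J\<close>.  By \<open>subtheory\<close> the commutant is then a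
  theory, with closure under tupling inherited from \<open>S\<close>.\<close>

lemma commutant_iso:
  assumes S: "is_theory_over V (full_theory V X) S J"
    and mono: "\<And>n m. is_mono V (J n m)"
    and closed: "\<And>Z k n h f. Z \<in> Obj V \<Longrightarrow> h \<in> hom V Z (VHom (full_theory V X) k n) \<Longrightarrow>
      (\<And>i. i < n \<Longrightarrow> f i \<in> hom V Z (VHom S k 1)) \<Longrightarrow>
      (\<And>i. i < n \<Longrightarrow> J k 1 \<cdot> f i =
        gcomp V (full_theory V X) k n 1 (VProj (full_theory V X) n i \<cdot> bang V Z) h) \<Longrightarrow>
      \<exists>h'. h' \<in> hom V Z (VHom S k n) \<and> J k n \<cdot> h' = h"
    and nat: "\<And>n m. is_nat_object V T (self_vcat V) (P n) (P m) (VHom S n m) (\<epsilon> n m)"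
    and \<epsilon>1: "\<And>n m. \<epsilon> n m 1 = J n m"
  shows "iso_over V (full_theory V X) S J (commutant V X T A) (commutant_mor V X T A)"
proof -
  define N where "N n m = alg_hom V T (P n) (P m)" for n m
  define c where "c n m = alg_cmpt V T (P n) (P m)" for n m
  have N: "is_nat_object V T (self_vcat V) (P n) (P m) (N n m) (c n m)" for n m
    using someI[of "\<lambda>Ee. is_nat_object V T (self_vcat V) (P n) (P m) (fst Ee) (snd Ee)"
        "(VHom S n m, \<epsilon> n m)"] nat[of n m]
    by (simp add: N_def c_def alg_hom_def alg_cmpt_def nat_object_def)
  have cN: "is_vnat V T (self_vcat V) (P n) (P m) (N n m) (c n m)" and [simp]: "N n m \<in> Obj V" for n m
    using N[of n m] unfolding is_nat_object_def by blast+
  have \<epsilon>S: "is_vnat V T (self_vcat V) (P n) (P m) (VHom S n m) (\<epsilon> n m)"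
    and [simp]: "VHom S n m \<in> Obj V" for n m
    using nat[of n m] unfolding is_nat_object_def by blast+
  note [simp] = P_vnat_arr[OF cN, simplified] P_vnat_arr[OF \<epsilon>S, simplified]
  have lift: "alg_lift V T (P n) (P m) Z \<theta> \<in> hom V Z (N n m) \<and>
      (\<forall>k. c n m k \<cdot> alg_lift V T (P n) (P m) Z \<theta> = \<theta> k)"
    if "Z \<in> Obj V" "is_vnat V T (self_vcat V) (P n) (P m) Z \<theta>" for n m Z \<theta>
    using theI'[OF nat_object_ex1[OF N that]] unfolding alg_lift_def N_def c_def .
  define F where "F n m = alg_lift V T (P n) (P m) (VHom S n m) (\<epsilon> n m)" for n m
  have F: "F n m \<in> hom V (VHom S n m) (N n m)" "c n m k \<cdot> F n m = \<epsilon> n m k" for n m k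
    using lift[OF _ \<epsilon>S, of n m] by (simp_all add: F_def)
  have "\<exists>G. G \<in> hom V (N n m) (VHom S n m) \<and> (\<forall>k. \<epsilon> n m k \<cdot> G = c n m k)" for n m
    by (rule ex1_implies_ex[OF nat_object_ex1[OF nat _ cN]]) simp
  then obtain G where G: "G n m \<in> hom V (N n m) (VHom S n m)" "\<epsilon> n m k \<cdot> G n m = c n m k" for n m k
    by metis
  note [simp] = F(1)[simplified] G(1)[simplified]
  have FG: "F n m \<cdot> G n m = Ide V (N n m)" for n m
  proof (rule nat_object_comp_ext[OF N])
    fix k
    have "c n m k \<cdot> (F n m \<cdot> G n m) = (c n m k \<cdot> F n m) \<cdot> G n m" by simp
    also have "\<dots> = c n m k \<cdot> Ide V (N n m)" unfolding F(2) G(2) by simp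
    finally show "c n m k \<cdot> (F n m \<cdot> G n m) = c n m k \<cdot> Ide V (N n m)" .
  qed simp_all
  let ?K = "commutant_mor V X T A" and ?W = "full_theory V X" and ?T = "commutant V X T A"
  have K: "?K n m = c n m 1" for n m by (simp add: commutant_mor_def c_def)
  have T_simps: "VObj ?T = UNIV" "VHom ?T n m = N n m"
    "VId ?T n = alg_lift V T (P n) (P n) \<one> (\<lambda>k. VId (self_vcat V) (pow V (pow V X k) n))"
    "VComp ?T n m l = alg_lift V T (P n) (P l) (N m l \<otimes> N n m) (\<lambda>k.
       gcomp V (self_vcat V) (pow V (pow V X k) n) (pow V (pow V X k) m) (pow V (pow V X k) l)
         (c m l k \<cdot> Pr1 V (N m l) (N n m)) (c n m k \<cdot> Pr2 V (N m l) (N n m)))"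
    "VProj ?T n i = alg_lift V T (P n) (P 1) \<one> (\<lambda>k. curry_arr V \<one> (pow V (pow V X k) n) (pow V X k)
      (pproj V (pow V X k) n i \<cdot> Pr2 V \<one> (pow V (pow V X k) n)))" for n m l i
    by (simp_all add: commutant_def Let_def Alg_def N_def c_def alg_pow_proj_def)
  have KF: "?K n m \<cdot> F n m = J n m" for n m using F(2)[of n m 1] \<epsilon>1[of n m] by (simp add: K)
  have JG: "J n m \<cdot> G n m = ?K n m" for n m using G(2)[of n m 1] \<epsilon>1[of n m] by (simp add: K)
  have J_arr [simp]: "J n m \<in> Arr V" "Dom V (J n m) = VHom S n m"
    "Cod V (J n m) = Exp V (pow V X n) (pow V X m)" for n m
    unfolding \<epsilon>1[symmetric] by simp_all
  have K_arr [simp]: "?K n m \<in> Arr V" "Dom V (?K n m) = N n m"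
    "Cod V (?K n m) = Exp V (pow V X n) (pow V X m)" for n m
    by (simp_all add: K)
  have K_mono: "is_mono V (?K n m)" for n m
    unfolding is_mono_def
  proof (intro conjI ballI impI)
    fix Z f g
    assume Z: "Z \<in> Obj V" and f: "f \<in> hom V Z (Dom V (?K n m))" and g: "g \<in> hom V Z (Dom V (?K n m))"
      and eq: "?K n m \<cdot> f = ?K n m \<cdot> g"
    have "J n m \<cdot> (G n m \<cdot> f) = J n m \<cdot> (G n m \<cdot> g)"
      using eq f g by (simp add: JG flip: comp_assoc)
    then have "G n m \<cdot> f = G n m \<cdot> g"
      using f g by - (rule mono_cancel[OF mono], simp_all)
    then have "(F n m \<cdot> G n m) \<cdot> f = (F n m \<cdot> G n m) \<cdot> g" using f g by simp
    then show "f = g" using f g by (simp add: FG)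
  qed simp
  \<comment> \<open>Identities, composites and projections are natural, so that the lifts defining the structure
    of the commutant have the prescribed components.\<close>
  have id_nat: "is_vnat V T (self_vcat V) (P n) (P n) \<one> (\<lambda>k. VId (self_vcat V) (pow V (pow V X k) n))"
    for n
    by (rule P_vnatI) simp_all
  have comp_nat: "is_vnat V T (self_vcat V) (P n) (P l) (N m l \<otimes> N n m) (\<lambda>k.
       gcomp V (self_vcat V) (pow V (pow V X k) n) (pow V (pow V X k) m) (pow V (pow V X k) l)
         (c m l k \<cdot> Pr1 V (N m l) (N n m)) (c n m k \<cdot> Pr2 V (N m l) (N n m)))" for n m l
  proof (rule P_vnatI)
    fix k q Z p t a
    assume *: "Z \<in> Obj V" "p \<in> hom V Z (N m l \<otimes> N n m)" "t \<in> hom V Z (VHom T k q)"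
      "a \<in> hom V Z (pow V (pow V X k) n)"
    let ?f = "Pr2 V (N m l) (N n m) \<cdot> p" and ?g = "Pr1 V (N m l) (N n m) \<cdot> p"
    show "ap (pow V (pow V X k) l) (pow V (pow V X q) l) (FArr (P l) k q \<cdot> t)
        (ap (pow V (pow V X k) n) (pow V (pow V X k) l) (gcomp V (self_vcat V) (pow V (pow V X k) n)
          (pow V (pow V X k) m) (pow V (pow V X k) l) (c m l k \<cdot> Pr1 V (N m l) (N n m))
          (c n m k \<cdot> Pr2 V (N m l) (N n m)) \<cdot> p) a) =
      ap (pow V (pow V X q) n) (pow V (pow V X q) l) (gcomp V (self_vcat V) (pow V (pow V X q) n)
          (pow V (pow V X q) m) (pow V (pow V X q) l) (c m l q \<cdot> Pr1 V (N m l) (N n m))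
          (c n m q \<cdot> Pr2 V (N m l) (N n m)) \<cdot> p)
        (ap (pow V (pow V X k) n) (pow V (pow V X q) n) (FArr (P n) k q \<cdot> t) a)"
      using * P_vnatD[OF cN[of n m], of ?f Z t k q a]
        P_vnatD[OF cN[of m l], of ?g Z t k q
          "ap (pow V (pow V X k) n) (pow V (pow V X k) m) (c n m k \<cdot> ?f) a"]
      by simp
  qed simp_all
  have proj_nat: "is_vnat V T (self_vcat V) (P n) (P 1) \<one>
      (\<lambda>k. curry_arr V \<one> (pow V (pow V X k) n) (pow V X k)
        (pproj V (pow V X k) n i \<cdot> Pr2 V \<one> (pow V (pow V X k) n)))" if "i < n" for n i
  proof (rule P_vnatI)
    fix k l Z p t a
    assume *: "Z \<in> Obj V" "p \<in> hom V Z \<one>" "t \<in> hom V Z (VHom T k l)"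
      "a \<in> hom V Z (pow V (pow V X k) n)"
    have "ap (pow V X k) (pow V X l) (FArr (P 1) k l \<cdot> t) b = ap (pow V X k) (pow V X l) (A k l \<cdot> t) b"
      if "b \<in> hom V Z (pow V X k)" for b
      using P_apply[of t b k l 1 0] that * by (simp del: P_apply)
    with * that show "ap (pow V (pow V X k) 1) (pow V (pow V X l) 1) (FArr (P 1) k l \<cdot> t)
        (ap (pow V (pow V X k) n) (pow V (pow V X k) 1) (curry_arr V \<one> (pow V (pow V X k) n)
          (pow V X k) (pproj V (pow V X k) n i \<cdot> Pr2 V \<one> (pow V (pow V X k) n)) \<cdot> p) a) =
      ap (pow V (pow V X l) n) (pow V (pow V X l) 1) (curry_arr V \<one> (pow V (pow V X l) n)
          (pow V X l) (pproj V (pow V X l) n i \<cdot> Pr2 V \<one> (pow V (pow V X l) n)) \<cdot> p)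
        (ap (pow V (pow V X k) n) (pow V (pow V X l) n) (FArr (P n) k l \<cdot> t) a)"
      by simp
  qed (use that in simp_all)
  have T: "is_theory_over V ?W ?T ?K"
  proof (rule subtheory[OF full_theory[OF X]], unfold T_simps)
    show "?K n n \<cdot> alg_lift V T (P n) (P n) \<one> (\<lambda>k. VId (self_vcat V) (pow V (pow V X k) n)) =
        VId ?W n" for n
      using lift[OF _ id_nat, of n] by (simp add: K)
    show "alg_lift V T (P n) (P n) \<one> (\<lambda>k. VId (self_vcat V) (pow V (pow V X k) n)) \<in> hom V \<one> (N n n)" for n
      using lift[OF _ id_nat, of n] by simp
    show "alg_lift V T (P n) (P l) (N m l \<otimes> N n m) (\<lambda>k.
       gcomp V (self_vcat V) (pow V (pow V X k) n) (pow V (pow V X k) m) (pow V (pow V X k) l)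
         (c m l k \<cdot> Pr1 V (N m l) (N n m)) (c n m k \<cdot> Pr2 V (N m l) (N n m))) \<in>
         hom V (N m l \<otimes> N n m) (N n l)" for n m l
      using lift[OF _ comp_nat, of m l n] by simp
    show "?K n l \<cdot> alg_lift V T (P n) (P l) (N m l \<otimes> N n m) (\<lambda>k.
       gcomp V (self_vcat V) (pow V (pow V X k) n) (pow V (pow V X k) m) (pow V (pow V X k) l)
         (c m l k \<cdot> Pr1 V (N m l) (N n m)) (c n m k \<cdot> Pr2 V (N m l) (N n m))) =
         VComp ?W n m l \<cdot> prod_arr V (?K m l) (?K n m)" for n m l
      using lift[OF _ comp_nat, of m l n] by (simp add: K gcomp_def prod_arr_def)
    show "alg_lift V T (P n) (P 1) \<one> (\<lambda>k. curry_arr V \<one> (pow V (pow V X k) n) (pow V X k)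
      (pproj V (pow V X k) n i \<cdot> Pr2 V \<one> (pow V (pow V X k) n))) \<in> hom V \<one> (N n 1)"
      if "i < n" for n i
      using lift[OF _ proj_nat[OF that]] by simp
    show "?K n 1 \<cdot> alg_lift V T (P n) (P 1) \<one> (\<lambda>k. curry_arr V \<one> (pow V (pow V X k) n) (pow V X k)
      (pproj V (pow V X k) n i \<cdot> Pr2 V \<one> (pow V (pow V X k) n))) = VProj ?W n i"
      if "i < n" for n i
      using lift[OF _ proj_nat[OF that]] that by (simp add: K full_theory_def)
    show "\<exists>h'. h' \<in> hom V Z (N k n) \<and> ?K k n \<cdot> h' = h"
      if Z: "Z \<in> Obj V" and h: "h \<in> hom V Z (VHom ?W k n)"
        and f: "\<And>i. i < n \<Longrightarrow> f i \<in> hom V Z (N k 1)"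
        and eq: "\<And>i. i < n \<Longrightarrow> ?K k 1 \<cdot> f i = gcomp V ?W k n 1 (VProj ?W n i \<cdot> bang V Z) h"
      for Z k n h f
    proof -
      have "\<exists>h'. h' \<in> hom V Z (VHom S k n) \<and> J k n \<cdot> h' = h"
      proof (rule closed[OF Z h, where f = "\<lambda>i. G k 1 \<cdot> f i"])
        fix i assume i: "i < n"
        show "G k 1 \<cdot> f i \<in> hom V Z (VHom S k 1)" using f[OF i] by simp
        have "J k 1 \<cdot> (G k 1 \<cdot> f i) = (J k 1 \<cdot> G k 1) \<cdot> f i" using f[OF i] by simp
        then show "J k 1 \<cdot> (G k 1 \<cdot> f i) = gcomp V ?W k n 1 (VProj ?W n i \<cdot> bang V Z) h"
          unfolding JG eq[OF i] .
      qed
      then obtain h' where h': "h' \<in> hom V Z (VHom S k n)" "J k n \<cdot> h' = h" by blast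
      have "?K k n \<cdot> (F k n \<cdot> h') = (?K k n \<cdot> F k n) \<cdot> h'" using h'(1) by simp
      then show ?thesis using h' unfolding KF by (intro exI[of _ "F k n \<cdot> h'"]) simp
    qed
  qed (simp_all add: K_mono)
  show ?thesis
    by (rule iso_over_mono[OF S T mono K_mono _ KF _ JG]) (simp_all add: T_simps)
qed

end

section \<open>The theory of affine spaces\<close>

context cartesian_closed
begin

lemma equalizer_mono:
  assumes "is_equalizer V f g E e" "f \<in> Arr V" "g \<in> Arr V" "Dom V g = Dom V f"
  shows "is_mono V e"
  unfolding is_mono_def
proof (intro conjI ballI impI)
  have e: "e \<in> hom V E (Dom V f)" "f \<cdot> e = g \<cdot> e" using assms(1) unfolding is_equalizer_def by blast+
  then show "e \<in> Arr V" by simp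
  fix Z h k
  assume Z: "Z \<in> Obj V" and h: "h \<in> hom V Z (Dom V e)" and k: "k \<in> hom V Z (Dom V e)"
    and eq: "e \<cdot> h = e \<cdot> k"
  have "f \<cdot> (e \<cdot> k) = (f \<cdot> e) \<cdot> k" using e(1) k assms(2) by simp
  also have "\<dots> = g \<cdot> (e \<cdot> k)" unfolding e(2) using e(1) k assms(3,4) by simp
  finally have "\<exists>!l. l \<in> hom V Z E \<and> e \<cdot> l = e \<cdot> k"
    using assms(1) Z e(1) k unfolding is_equalizer_def by simp
  from ex1_eqD[OF this] show "h = k" using e(1) h k eq by simp
qed

lemma factor_props:
  assumes m: "is_mono V m" and h: "h \<in> hom V (Dom V f) (Dom V m)" "m \<cdot> h = f"
  shows "factor V m f \<in> hom V (Dom V f) (Dom V m) \<and> m \<cdot> factor V m f = f"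
proof -
  have "\<exists>!h. h \<in> hom V (Dom V f) (Dom V m) \<and> m \<cdot> h = f"
  proof (rule ex_ex1I)
    show "k = l" if "k \<in> hom V (Dom V f) (Dom V m) \<and> m \<cdot> k = f"
      "l \<in> hom V (Dom V f) (Dom V m) \<and> m \<cdot> l = f" for k l
      using that by - (rule mono_cancel[OF m], simp_all)
  qed (use h in blast)
  from theI'[OF this] show ?thesis unfolding factor_def .
qed

end

locale rig_with_equalizers = rig_object V R
  for V :: "('o, 'a) ccc" (structure) and R :: "('o, 'a) rig" +
  assumes equalizers: "has_equalizers V"
begin

subsection \<open>Matrices acting on vectors and on matrices\<close>

lemma Mat_comp [simp]:
  "VComp (Mat V R) n m l \<in> Arr V"
  "Dom V (VComp (Mat V R) n m l) = pow V (pow V K m) l \<otimes> pow V (pow V K n) m"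
  "Cod V (VComp (Mat V R) n m l) = pow V (pow V K n) l"
  by (simp_all add: Mat_def Let_def)

lemma Mat_gcomp [simp]:
  assumes "u \<in> Arr V" "v \<in> Arr V" "Dom V v = Dom V u" "Cod V u = pow V (pow V K n) m"
    "Cod V v = pow V (pow V K m) l"
  shows "gcomp V (Mat V R) n m l v u \<in> Arr V"
    "Dom V (gcomp V (Mat V R) n m l v u) = Dom V u"
    "Cod V (gcomp V (Mat V R) n m l v u) = pow V (pow V K n) l"
    "k < l \<Longrightarrow> i < n \<Longrightarrow> ent V K n l (gcomp V (Mat V R) n m l v u) k i =
      gsum V R (Dom V u) (\<lambda>j. gmul V R (ent V K m l v k j) (ent V K n m u j i)) m"
    "p \<in> Arr V \<Longrightarrow> Cod V p = Dom V u \<Longrightarrow>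
      gcomp V (Mat V R) n m l v u \<cdot> p = gcomp V (Mat V R) n m l (v \<cdot> p) (u \<cdot> p)"
  using assms by (simp_all add: gcomp_def, simp add: Mat_def Let_def)

lemma Mat_mor_arr [simp]:
  "Mat_mor V R n m \<in> Arr V" "Dom V (Mat_mor V R n m) = pow V (pow V K n) m"
  "Cod V (Mat_mor V R n m) = Exp V (pow V K n) (pow V K m)"
  by (simp_all add: Mat_mor_def Let_def)

lemma Mat_mor_apply [simp]:
  assumes "a \<in> Arr V" "x \<in> Arr V" "Dom V a = Dom V x" "Cod V a = pow V (pow V K n) m"
    "Cod V x = pow V K n" "j < m"
  shows "pproj V K m j \<cdot> ap (pow V K n) (pow V K m) (Mat_mor V R n m \<cdot> a) x =
    gsum V R (Dom V x) (\<lambda>i. gmul V R (ent V K n m a j i) (pproj V K n i \<cdot> x)) n"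
  using assms by (simp add: Mat_mor_def Let_def)

lemma Mat_mor_gcomp:
  assumes "u \<in> hom V Z (pow V (pow V K n) m)" "v \<in> hom V Z (pow V (pow V K m) l)"
  shows "Mat_mor V R n l \<cdot> gcomp V (Mat V R) n m l v u =
    gcomp V (full_theory V K) n m l (Mat_mor V R m l \<cdot> v) (Mat_mor V R n m \<cdot> u)"
proof (rule exp_ext[of _ Z "pow V K n" "pow V K l"])
  fix Z' p x assume "Z' \<in> Obj V" "p \<in> hom V Z' Z" "x \<in> hom V Z' (pow V K n)"
  then show "ap (pow V K n) (pow V K l) ((Mat_mor V R n l \<cdot> gcomp V (Mat V R) n m l v u) \<cdot> p) x =
    ap (pow V K n) (pow V K l) (gcomp V (full_theory V K) n m l (Mat_mor V R m l \<cdot> v)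
      (Mat_mor V R n m \<cdot> u) \<cdot> p) x"
    using assms by - (rule pow_ext[of _ Z' K l], simp_all add: gsum_bilinear_assoc)
qed (use assms in simp_all)

text \<open>The entries of a matrix are the coordinates of its values on the standard basis vectors.\<close>

lemma Mat_mor_mono: "is_mono V (Mat_mor V R n m)"
  unfolding is_mono_def
proof (intro conjI ballI impI)
  fix Z a b
  assume Z: "Z \<in> Obj V" and a: "a \<in> hom V Z (Dom V (Mat_mor V R n m))"
    and b: "b \<in> hom V Z (Dom V (Mat_mor V R n m))" and eq: "Mat_mor V R n m \<cdot> a = Mat_mor V R n m \<cdot> b"
  show "a = b"
  proof (rule mat_ext[of _ Z K n m])
    fix j i assume ji: "j < m" "i < n"
    define x where "x = tuple V K n Z (\<lambda>i'. gdelta V R Z i' i)"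
    have "pproj V K m j \<cdot> ap (pow V K n) (pow V K m) (Mat_mor V R n m \<cdot> a) x =
        pproj V K m j \<cdot> ap (pow V K n) (pow V K m) (Mat_mor V R n m \<cdot> b) x"
      by (simp only: eq)
    then show "ent V K n m a j i = ent V K n m b j i"
      using Z a b ji by (simp add: x_def)
  qed (use a b in simp_all)
qed simp

text \<open>The action of matrices on the power \<open>n\<close> of \<open>R\<^sup>k\<close>.  An element of \<open>(R\<^sup>k)\<^sup>n\<close> is a
  matrix with \<open>n\<close> rows and \<open>k\<close> columns, and the action is matrix multiplication.\<close>

definition Mat_act :: "nat \<Rightarrow> nat \<Rightarrow> nat \<Rightarrow> 'a" where
  "Mat_act n m k = (let H = Mats V K n m; P = Mats V K k n in
     curry_arr V H P (Mats V K k m) (gcomp V (Mat V R) k n m (Pr1 V H P) (Pr2 V H P)))"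

lemma Mat_act_arr [simp]:
  "Mat_act n m k \<in> Arr V" "Dom V (Mat_act n m k) = pow V (pow V K n) m"
  "Cod V (Mat_act n m k) = Exp V (pow V (pow V K k) n) (pow V (pow V K k) m)"
  by (simp_all add: Mat_act_def Let_def)

lemma Mat_act_apply [simp]:
  assumes "a \<in> Arr V" "x \<in> Arr V" "Dom V a = Dom V x" "Cod V a = pow V (pow V K n) m"
    "Cod V x = pow V (pow V K k) n"
  shows "ap (pow V (pow V K k) n) (pow V (pow V K k) m) (Mat_act n m k \<cdot> a) x =
    gcomp V (Mat V R) k n m a x"
  using assms by (simp add: Mat_act_def Let_def)

lemma Mat_act_one: "Mat_act n m 1 = Mat_mor V R n m"
proof (rule exp_ext[of _ "pow V (pow V K n) m" "pow V K n" "pow V K m"])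
  fix Z p x
  assume *: "Z \<in> Obj V" "p \<in> hom V Z (pow V (pow V K n) m)" "x \<in> hom V Z (pow V K n)"
  have "pproj V K m j \<cdot> gcomp V (Mat V R) (Suc 0) n m p x =
      gsum V R Z (\<lambda>i. gmul V R (ent V K n m p j i) (pproj V K n i \<cdot> x)) n" if "j < m" for j
    using that * ent_col[of "gcomp V (Mat V R) (Suc 0) n m p x" K m j]
    by (simp del: ent_col, simp)
  then have "ap (pow V K n) (pow V K m) (Mat_mor V R n m \<cdot> p) x = gcomp V (Mat V R) (Suc 0) n m p x"
    using * by - (rule pow_ext[of _ Z K m], simp_all)
  then show "ap (pow V K n) (pow V K m) (Mat_act n m 1 \<cdot> p) x =
      ap (pow V K n) (pow V K m) (Mat_mor V R n m \<cdot> p) x"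
    using * Mat_act_apply[of p x n m 1] by simp
qed (use Mat_act_arr[of n m 1] in simp_all)

subsection \<open>Matrices whose rows sum to one\<close>

abbreviation (input) affine :: "nat \<Rightarrow> nat \<Rightarrow> 'a \<Rightarrow> bool" where
  "affine n m a \<equiv> \<forall>j<m. gsum V R (Dom V a) (ent V K n m a j) n = gone V R (Dom V a)"

lemma aff_equalizer:
  "is_equalizer V (row_sums V R n m) (const_ones V R n m) (fst (aff_equalizer V R n m)) (aff_incl V R n m)"
proof -
  have "row_sums V R n m \<in> hom V (pow V (pow V K n) m) (pow V K m)"
    "const_ones V R n m \<in> hom V (pow V (pow V K n) m) (pow V K m)"
    by (simp_all add: row_sums_def const_ones_def Let_def)
  moreover have "pow V (pow V K n) m \<in> Obj V" "pow V K m \<in> Obj V" by simp_all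
  ultimately have "\<exists>E e. is_equalizer V (row_sums V R n m) (const_ones V R n m) E e"
    using equalizers unfolding has_equalizers_def by blast
  then have "\<exists>Ee. is_equalizer V (row_sums V R n m) (const_ones V R n m) (fst Ee) (snd Ee)"
    by simp
  from someI_ex[OF this] show ?thesis unfolding aff_incl_def aff_equalizer_def .
qed

lemma row_sums_arr [simp]:
  "row_sums V R n m \<in> Arr V" "Dom V (row_sums V R n m) = pow V (pow V K n) m"
  "const_ones V R n m \<in> Arr V" "Dom V (const_ones V R n m) = pow V (pow V K n) m"
  "Cod V (row_sums V R n m) = pow V K m" "Cod V (const_ones V R n m) = pow V K m"
  by (simp_all add: row_sums_def const_ones_def Let_def)

abbreviation Aff :: "nat \<Rightarrow> nat \<Rightarrow> 'o" where
  "Aff n m \<equiv> fst (aff_equalizer V R n m)"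

lemma aff_incl_arr [simp]:
  "Aff n m \<in> Obj V" "aff_incl V R n m \<in> Arr V" "Dom V (aff_incl V R n m) = Aff n m"
  "Cod V (aff_incl V R n m) = pow V (pow V K n) m"
  using aff_equalizer[of n m] by (simp_all add: is_equalizer_def)

lemma aff_incl_mono: "is_mono V (aff_incl V R n m)"
  by (rule equalizer_mono[OF aff_equalizer]) simp_all

lemma row_sums_eq_iff:
  assumes "a \<in> hom V Z (pow V (pow V K n) m)"
  shows "row_sums V R n m \<cdot> a = const_ones V R n m \<cdot> a \<longleftrightarrow> affine n m a"
proof -
  have Z: "Z \<in> Obj V" using assms by auto
  have row: "pproj V K m j \<cdot> (row_sums V R n m \<cdot> a) = gsum V R Z (ent V K n m a j) n"
    and ones: "pproj V K m j \<cdot> (const_ones V R n m \<cdot> a) = gone V R Z" if "j < m" for j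
    using that assms Z by (simp_all add: row_sums_def const_ones_def Let_def)
  show ?thesis
  proof
    assume "row_sums V R n m \<cdot> a = const_ones V R n m \<cdot> a"
    then show "affine n m a" using row ones assms by auto
  next
    assume "affine n m a"
    then show "row_sums V R n m \<cdot> a = const_ones V R n m \<cdot> a"
      using row ones assms by - (rule pow_ext[of _ Z K m], simp_all)
  qed
qed

lemma aff_factor_exists:
  assumes "a \<in> hom V Z (pow V (pow V K n) m)" "affine n m a"
  shows "\<exists>h. h \<in> hom V Z (Aff n m) \<and> aff_incl V R n m \<cdot> h = a"
proof -
  have Z: "Z \<in> Obj V" using assms by auto
  have "row_sums V R n m \<cdot> a = const_ones V R n m \<cdot> a"
    using row_sums_eq_iff assms by blast
  then have "\<exists>!h. h \<in> hom V Z (Aff n m) \<and> aff_incl V R n m \<cdot> h = a"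
    using aff_equalizer[of n m] assms(1) Z unfolding is_equalizer_def by simp
  then show ?thesis by blast
qed

lemma aff_row_sums:
  assumes "h \<in> Arr V" "Cod V h = Aff n m" "j < m"
  shows "gsum V R (Dom V h) (ent V K n m (aff_incl V R n m \<cdot> h) j) n = gone V R (Dom V h)"
proof -
  have "row_sums V R n m \<cdot> aff_incl V R n m = const_ones V R n m \<cdot> aff_incl V R n m"
    using aff_equalizer[of n m] unfolding is_equalizer_def by blast
  then have "(row_sums V R n m \<cdot> aff_incl V R n m) \<cdot> h = (const_ones V R n m \<cdot> aff_incl V R n m) \<cdot> h"
    by simp
  then have "row_sums V R n m \<cdot> (aff_incl V R n m \<cdot> h) = const_ones V R n m \<cdot> (aff_incl V R n m \<cdot> h)"
    using assms by simp
  then show ?thesis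
    using row_sums_eq_iff[of "aff_incl V R n m \<cdot> h" "Dom V h" n m] assms by simp
qed

lemma aff_factor:
  assumes "a \<in> hom V Z (pow V (pow V K n) m)" "affine n m a"
  shows "factor V (aff_incl V R n m) a \<in> hom V Z (Aff n m)"
    "aff_incl V R n m \<cdot> factor V (aff_incl V R n m) a = a"
proof -
  obtain h where "h \<in> hom V Z (Aff n m)" "aff_incl V R n m \<cdot> h = a"
    using aff_factor_exists[OF assms] by blast
  then have "factor V (aff_incl V R n m) a \<in> hom V (Dom V a) (Dom V (aff_incl V R n m)) \<and>
      aff_incl V R n m \<cdot> factor V (aff_incl V R n m) a = a"
    using assms(1) by (intro factor_props[OF aff_incl_mono]) simp_all
  then show "factor V (aff_incl V R n m) a \<in> hom V Z (Aff n m)"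
    "aff_incl V R n m \<cdot> factor V (aff_incl V R n m) a = a"
    using assms(1) by simp_all
qed

lemma gsum_gdelta [simp]:
  assumes "Z \<in> Obj V" "k < n"
  shows "gsum V R Z (gdelta V R Z k) n = gone V R Z"
  using assms by (subst gsum_single[where k = k]) (simp_all add: gdelta_def)

text \<open>Exchange the two summations: the row sums of \<open>u\<close> are 1, which leaves the row sums of \<open>v\<close>.\<close>

lemma affine_gcomp:
  assumes u: "u \<in> hom V Z (pow V (pow V K n) m)" "affine n m u"
    and v: "v \<in> hom V Z (pow V (pow V K m) l)" "affine m l v"
  shows "affine n l (gcomp V (Mat V R) n m l v u)"
proof (intro allI impI)
  fix k assume k: "k < l"
  have Z: "Z \<in> Obj V" using u by auto
  have "gsum V R Z (ent V K n l (gcomp V (Mat V R) n m l v u) k) n =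
      gsum V R Z (\<lambda>i. gsum V R Z (\<lambda>j. gmul V R (ent V K m l v k j) (ent V K n m u j i)) m) n"
    using u v k by simp
  also have "\<dots> = gsum V R Z (\<lambda>j. gsum V R Z (\<lambda>i. gmul V R (ent V K m l v k j) (ent V K n m u j i)) n) m"
    using u v k Z by - (rule gsum_swap, simp_all)
  also have "\<dots> = gsum V R Z (\<lambda>j. gmul V R (ent V K m l v k j) (gsum V R Z (ent V K n m u j) n)) m"
    using u(1) v(1) k Z by (simp add: gsum_mul)
  also have "\<dots> = gone V R Z" using u v k Z by simp
  finally show "gsum V R (Dom V (gcomp V (Mat V R) n m l v u))
      (ent V K n l (gcomp V (Mat V R) n m l v u) k) n = gone V R (Dom V (gcomp V (Mat V R) n m l v u))"
    using u v by simp
qed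

lemma Mat_aff_mor_arr [simp]:
  "Mat_aff_mor V R n m \<in> Arr V" "Dom V (Mat_aff_mor V R n m) = Aff n m"
  "Cod V (Mat_aff_mor V R n m) = Exp V (pow V K n) (pow V K m)"
  by (simp_all add: Mat_aff_mor_def)

lemma Mat_aff_mor_mono: "is_mono V (Mat_aff_mor V R n m)"
  unfolding is_mono_def
proof (intro conjI ballI impI)
  fix Z f g
  assume "Z \<in> Obj V" and f: "f \<in> hom V Z (Dom V (Mat_aff_mor V R n m))"
    and g: "g \<in> hom V Z (Dom V (Mat_aff_mor V R n m))" and eq: "Mat_aff_mor V R n m \<cdot> f = Mat_aff_mor V R n m \<cdot> g"
  have "aff_incl V R n m \<cdot> f = aff_incl V R n m \<cdot> g"
    using eq f g by - (rule mono_cancel[OF Mat_mor_mono], simp_all add: Mat_aff_mor_def)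
  then show "f = g" using f g by - (rule mono_cancel[OF aff_incl_mono], simp_all)
qed simp

text \<open>The components of \<open>h\<close> are given by affine rows; stack these into a matrix.\<close>

lemma Mat_aff_closed:
  assumes Z: "Z \<in> Obj V" and h: "h \<in> hom V Z (VHom (full_theory V K) k n)"
    and f: "\<And>i. i < n \<Longrightarrow> f i \<in> hom V Z (Aff k 1)"
    and eq: "\<And>i. i < n \<Longrightarrow> Mat_aff_mor V R k 1 \<cdot> f i =
      gcomp V (full_theory V K) k n 1 (VProj (full_theory V K) n i \<cdot> bang V Z) h"
  shows "\<exists>h'. h' \<in> hom V Z (Aff k n) \<and> Mat_aff_mor V R k n \<cdot> h' = h"
proof -
  define a where "a = mat V K k n Z (\<lambda>j. ent V K k 1 (aff_incl V R k 1 \<cdot> f j) 0)"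
  have ent_a: "ent V K k n a j i = ent V K k 1 (aff_incl V R k 1 \<cdot> f j) 0 i" if "j < n" "i < k" for j i
    using Z f that by (simp add: a_def)
  have a: "a \<in> hom V Z (pow V (pow V K k) n)" using Z f by (simp add: a_def)
  have "affine k n a"
  proof (intro allI impI)
    fix j assume j: "j < n"
    then show "gsum V R (Dom V a) (ent V K k n a j) k = gone V R (Dom V a)"
      using a f[OF j] ent_a aff_row_sums[of "f j" k 1 0] by simp
  qed
  then obtain h' where h': "h' \<in> hom V Z (Aff k n)" "aff_incl V R k n \<cdot> h' = a"
    using aff_factor_exists[OF a] by blast
  have "Mat_mor V R k n \<cdot> a = h"
  proof (rule exp_ext[of _ Z "pow V K k" "pow V K n"])
    fix Z' p x assume *: "Z' \<in> Obj V" "p \<in> hom V Z' Z" "x \<in> hom V Z' (pow V K k)"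
    show "ap (pow V K k) (pow V K n) ((Mat_mor V R k n \<cdot> a) \<cdot> p) x = ap (pow V K k) (pow V K n) (h \<cdot> p) x"
    proof (rule pow_ext[of _ Z' K n])
      fix j assume j: "j < n"
      have "ent V K k n a j i \<cdot> p = ent V K k 1 (aff_incl V R k 1 \<cdot> f j) 0 i \<cdot> p" if "i < k" for i
        using ent_a[OF j that] by simp
      then have ent_ap: "ent V K k n (a \<cdot> p) j i = ent V K k 1 (aff_incl V R k 1 \<cdot> (f j \<cdot> p)) 0 i"
        if "i < k" for i
        using that j a f[OF j] * by simp
      have "pproj V K 1 0 \<cdot> ap (pow V K k) (pow V K 1) (Mat_mor V R k 1 \<cdot> (aff_incl V R k 1 \<cdot> (f j \<cdot> p))) x =
          pproj V K n j \<cdot> ap (pow V K k) (pow V K n) (h \<cdot> p) x"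
      proof -
        have "ap (pow V K k) K ((Mat_aff_mor V R k 1 \<cdot> f j) \<cdot> p) x =
            pproj V K n j \<cdot> ap (pow V K k) (pow V K n) (h \<cdot> p) x"
          unfolding eq[OF j] using * j Z h by simp
        then show ?thesis using * f[OF j] h j by (simp add: Mat_aff_mor_def del: Mat_mor_apply)
      qed
      moreover have "pproj V K 1 0 \<cdot> ap (pow V K k) (pow V K 1) (Mat_mor V R k 1 \<cdot> (aff_incl V R k 1 \<cdot> (f j \<cdot> p))) x =
          pproj V K n j \<cdot> ap (pow V K k) (pow V K n) (Mat_mor V R k n \<cdot> (a \<cdot> p)) x"
        using * a f[OF j] j ent_ap by (subst (1 2) Mat_mor_apply) simp_all
      ultimately show "pproj V K n j \<cdot> ap (pow V K k) (pow V K n) ((Mat_mor V R k n \<cdot> a) \<cdot> p) x =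
          pproj V K n j \<cdot> ap (pow V K k) (pow V K n) (h \<cdot> p) x"
        using a * by (simp del: Mat_mor_apply)
    qed (use a h * in simp_all)
  qed (use a h in simp_all)
  then show ?thesis using h' by (intro exI[of _ h']) (simp add: Mat_aff_mor_def)
qed

lemma Mat_aff_theory_over: "is_theory_over V (full_theory V K) (Mat_aff V R) (Mat_aff_mor V R)"
proof (rule subtheory)
  show "is_theory V (full_theory V K)" by (rule full_theory) simp
  show "is_mono V (Mat_aff_mor V R n m)" for n m by (rule Mat_aff_mor_mono)
  have id: "VId (Mat V R) n \<in> hom V \<one> (pow V (pow V K n) n)" "affine n n (VId (Mat V R) n)"
    and ent_id: "\<And>j i p. j < n \<Longrightarrow> i < n \<Longrightarrow> p \<in> Arr V \<Longrightarrow> Cod V p = \<one> \<Longrightarrow>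
      ent V K n n (VId (Mat V R) n \<cdot> p) j i = gdelta V R (Dom V p) j i" for n
    by (simp_all add: Mat_def)
  note id_factor = aff_factor[OF id]
  show "VId (Mat_aff V R) n \<in> hom V \<one> (VHom (Mat_aff V R) n n)" for n
    using id_factor(1)[of n] by (simp add: Mat_aff_def)
  show "Mat_aff_mor V R n n \<cdot> VId (Mat_aff V R) n = VId (full_theory V K) n" for n
  proof (rule exp_ext[of _ \<one> "pow V K n" "pow V K n"])
    fix Z p x assume *: "Z \<in> Obj V" "p \<in> hom V Z \<one>" "x \<in> hom V Z (pow V K n)"
    have "Mat_aff_mor V R n n \<cdot> VId (Mat_aff V R) n = Mat_mor V R n n \<cdot> VId (Mat V R) n"
      using id_factor[of n] by (simp add: Mat_aff_def Mat_aff_mor_def)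
    then show "ap (pow V K n) (pow V K n) ((Mat_aff_mor V R n n \<cdot> VId (Mat_aff V R) n) \<cdot> p) x =
        ap (pow V K n) (pow V K n) (VId (full_theory V K) n \<cdot> p) x"
      using * id(1)[of n] ent_id by - (rule pow_ext[of _ Z K n], simp_all)
  qed (use id_factor(1)[of n] in \<open>simp_all add: Mat_aff_def\<close>)
  have proj: "VProj (Mat V R) n i \<in> hom V \<one> (pow V (pow V K n) 1)" "affine n 1 (VProj (Mat V R) n i)"
    and ent_proj: "\<And>i' p. i' < n \<Longrightarrow> p \<in> Arr V \<Longrightarrow> Cod V p = \<one> \<Longrightarrow>
      ent V K n 1 (VProj (Mat V R) n i \<cdot> p) 0 i' = gdelta V R (Dom V p) i i'" if "i < n" for n i
    using that by (simp_all add: Mat_def)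
  have proj_factor: "factor V (aff_incl V R n 1) (VProj (Mat V R) n i) \<in> hom V \<one> (Aff n 1)"
    "aff_incl V R n 1 \<cdot> factor V (aff_incl V R n 1) (VProj (Mat V R) n i) = VProj (Mat V R) n i"
    if "i < n" for n i
    by (rule aff_factor[OF proj[OF that]])+
  show "VProj (Mat_aff V R) n i \<in> hom V \<one> (VHom (Mat_aff V R) n 1)" if "i < n" for n i
    using proj_factor(1)[OF that] by (simp add: Mat_aff_def)
  show "Mat_aff_mor V R n 1 \<cdot> VProj (Mat_aff V R) n i = VProj (full_theory V K) n i" if i: "i < n" for n i
  proof (rule exp_ext[of _ \<one> "pow V K n" K])
    fix Z p x assume *: "Z \<in> Obj V" "p \<in> hom V Z \<one>" "x \<in> hom V Z (pow V K n)"
    have "Mat_aff_mor V R n 1 \<cdot> VProj (Mat_aff V R) n i = Mat_mor V R n 1 \<cdot> VProj (Mat V R) n i"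
      using proj_factor[OF i] by (simp add: Mat_aff_def Mat_aff_mor_def)
    then show "ap (pow V K n) K ((Mat_aff_mor V R n 1 \<cdot> VProj (Mat_aff V R) n i) \<cdot> p) x =
        ap (pow V K n) K (VProj (full_theory V K) n i \<cdot> p) x"
      using * i proj(1)[OF i] ent_proj[OF i] Mat_mor_apply[of "VProj (Mat V R) n i \<cdot> p" x n 1 0]
      by (simp del: Mat_mor_apply)
  qed (use proj_factor(1)[OF i] i in \<open>simp_all add: Mat_aff_def\<close>)
  have comp: "VComp (Mat V R) n m l \<cdot> prod_arr V (aff_incl V R m l) (aff_incl V R n m)
      \<in> hom V (Aff m l \<otimes> Aff n m) (pow V (pow V K n) l)"
    "affine n l (VComp (Mat V R) n m l \<cdot> prod_arr V (aff_incl V R m l) (aff_incl V R n m))" for n m l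
  proof -
    let ?v = "aff_incl V R m l \<cdot> Pr1 V (Aff m l) (Aff n m)"
    let ?u = "aff_incl V R n m \<cdot> Pr2 V (Aff m l) (Aff n m)"
    have "affine n l (gcomp V (Mat V R) n m l ?v ?u)"
      by (rule affine_gcomp[where Z = "Aff m l \<otimes> Aff n m"])
        (use aff_row_sums[of "Pr1 V (Aff m l) (Aff n m)" m l]
          aff_row_sums[of "Pr2 V (Aff m l) (Aff n m)" n m] in simp_all)
    then show "affine n l (VComp (Mat V R) n m l \<cdot> prod_arr V (aff_incl V R m l) (aff_incl V R n m))"
      by (simp add: gcomp_def prod_arr_def)
  qed simp
  note comp_factor = aff_factor[OF comp]
  show comp_arr: "VComp (Mat_aff V R) n m l \<in>
      hom V (VHom (Mat_aff V R) m l \<otimes> VHom (Mat_aff V R) n m) (VHom (Mat_aff V R) n l)" for n m l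
    using comp_factor(1)[of n l m] by (simp add: Mat_aff_def)
  show "Mat_aff_mor V R n l \<cdot> VComp (Mat_aff V R) n m l =
      VComp (full_theory V K) n m l \<cdot> prod_arr V (Mat_aff_mor V R m l) (Mat_aff_mor V R n m)" for n m l
  proof (rule comp_preservedI[OF comp_arr])
    fix Z u v assume Z: "Z \<in> Obj V" and u: "u \<in> hom V Z (VHom (Mat_aff V R) n m)"
      and v: "v \<in> hom V Z (VHom (Mat_aff V R) m l)"
    have u': "u \<in> hom V Z (Aff n m)" and v': "v \<in> hom V Z (Aff m l)"
      using u v by (simp_all add: Mat_aff_def)
    have "Mat_aff_mor V R n l \<cdot> gcomp V (Mat_aff V R) n m l v u =
        Mat_mor V R n l \<cdot> ((aff_incl V R n l \<cdot> VComp (Mat_aff V R) n m l) \<cdot> \<langle>v, u\<rangle>)"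
      using u' v' comp_arr[of n m l] by (simp add: gcomp_def Mat_aff_mor_def Mat_aff_def)
    also have "\<dots> = Mat_mor V R n l \<cdot> gcomp V (Mat V R) n m l (aff_incl V R m l \<cdot> v) (aff_incl V R n m \<cdot> u)"
      using u' v' comp_factor(2)[of n l m] by (simp add: Mat_aff_def gcomp_def prod_arr_def)
    also have "\<dots> = gcomp V (full_theory V K) n m l (Mat_aff_mor V R m l \<cdot> v) (Mat_aff_mor V R n m \<cdot> u)"
      using u' v' by (subst Mat_mor_gcomp[of _ Z]) (simp_all add: Mat_aff_mor_def)
    finally show "Mat_aff_mor V R n l \<cdot> gcomp V (Mat_aff V R) n m l v u =
      gcomp V (full_theory V K) n m l (Mat_aff_mor V R m l \<cdot> v) (Mat_aff_mor V R n m \<cdot> u)" .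
  qed (simp_all add: Mat_aff_def)
  show "\<exists>h'. h' \<in> hom V Z (VHom (Mat_aff V R) k n) \<and> Mat_aff_mor V R k n \<cdot> h' = h"
    if "Z \<in> Obj V" "h \<in> hom V Z (VHom (full_theory V K) k n)"
      "\<And>i. i < n \<Longrightarrow> f i \<in> hom V Z (VHom (Mat_aff V R) k 1)"
      "\<And>i. i < n \<Longrightarrow> Mat_aff_mor V R k 1 \<cdot> f i =
        gcomp V (full_theory V K) k n 1 (VProj (full_theory V K) n i \<cdot> bang V Z) h"
    for Z k n h f
    using Mat_aff_closed[of Z h k n f] that by (simp add: Mat_aff_def)
qed (simp_all add: Mat_aff_def)

section \<open>Affine matrices as natural transformations\<close>

sublocale theory_action V K "PMat_op V R" "PMat_op_mor V R"
  by unfold_locales simp_all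

text \<open>An operation \<open>t\<close> from \<open>k\<close> to \<open>l\<close> acts on a matrix row by row.\<close>

lemma ent_P_apply [simp]:
  assumes "t \<in> Arr V" "x \<in> Arr V" "Dom V t = Dom V x" "Cod V t = pow V (pow V K (Suc k)) l"
    "Cod V x = pow V (pow V K k) n" "i < n" "q < l"
  shows "ent V K l n (ap (pow V (pow V K k) n) (pow V (pow V K l) n) (FArr (P n) k l \<cdot> t) x) i q =
    gsum V R (Dom V x) (\<lambda>c. gmul V R (prepend_one (Dom V x) (ent V K k n x i) c)
      (ent V K (Suc k) l t q c)) (Suc k)"
proof -
  have "ent V K k n x i = (\<lambda>c. pproj V K k c \<cdot> (pproj V (pow V K k) n i \<cdot> x))"
    by (simp add: ent_def fun_eq_iff)
  then show ?thesis
    using assms by (simp add: ent_def[where u = "ap _ _ _ _"] del: gsum.simps)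
qed

text \<open>Affine maps also act on homogeneous coordinates, since the coordinate 1 in front is multiplied by
  the row sum, which is 1.\<close>

lemma prepend_one_affine:
  assumes "a \<in> hom V Z (pow V (pow V K n) m)" "affine n m a" "x \<in> hom V Z (pow V (pow V K k) n)"
    "j < m" "c < Suc k"
  shows "prepend_one Z (ent V K k m (gcomp V (Mat V R) k n m a x) j) c =
    gsum V R Z (\<lambda>i. gmul V R (ent V K n m a j i) (prepend_one Z (ent V K k n x i) c)) n"
proof -
  have "Z \<in> Obj V" using assms(1) by auto
  then show ?thesis using assms by (cases c) simp_all
qed

text \<open>In homogeneous coordinates the operation \<open>t\<close> multiplies from the right and the affine matrix from
  the left, so naturality is associativity.\<close>

lemma Mat_act_natural:
  "is_vnat V (PMat_op V R) (self_vcat V) (P n) (P m) (Aff n m) (\<lambda>k. Mat_act n m k \<cdot> aff_incl V R n m)"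
proof (rule P_vnatI)
  fix k l Z p t x
  assume *: "Z \<in> Obj V" "p \<in> hom V Z (Aff n m)" "t \<in> hom V Z (VHom (PMat_op V R) k l)"
    "x \<in> hom V Z (pow V (pow V K k) n)"
  let ?a = "aff_incl V R n m \<cdot> p"
  have "affine n m ?a" using aff_row_sums[of p n m] * by simp
  then show "ap (pow V (pow V K k) m) (pow V (pow V K l) m) (FArr (P m) k l \<cdot> t)
      (ap (pow V (pow V K k) n) (pow V (pow V K k) m) ((Mat_act n m k \<cdot> aff_incl V R n m) \<cdot> p) x) =
    ap (pow V (pow V K l) n) (pow V (pow V K l) m) ((Mat_act n m l \<cdot> aff_incl V R n m) \<cdot> p)
      (ap (pow V (pow V K k) n) (pow V (pow V K l) n) (FArr (P n) k l \<cdot> t) x)"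
    using * by - (rule mat_ext[of _ Z K l m],
      simp_all del: gsum.simps add: prepend_one_affine gsum_bilinear_assoc)
qed simp_all

text \<open>The identity matrix is the generic element: \<open>\<theta>\<close> is determined by the value \<open>a\<close> of \<open>\<theta>\<^sub>n\<close> on it,
  and it can be transported to any other matrix by an operation of the theory.\<close>

lemma vnat_is_Mat_act:
  assumes Z: "Z \<in> Obj V"
    and \<theta>: "is_vnat V (PMat_op V R) (self_vcat V) (P n) (P m) Z \<theta>"
  obtains a where "a \<in> hom V Z (pow V (pow V K n) m)" "affine n m a" "\<And>l. \<theta> l = Mat_act n m l \<cdot> a"
proof -
  note [simp] = P_vnat_arr[OF \<theta>, simplified]
  define I where "I Z' = mat V K n n Z' (gdelta V R Z')" for Z'
  have I [simp]: "Z' \<in> Obj V \<Longrightarrow> I Z' \<in> Arr V" "Z' \<in> Obj V \<Longrightarrow> Dom V (I Z') = Z'"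
      "Z' \<in> Obj V \<Longrightarrow> Cod V (I Z') = pow V (pow V K n) n"
      "Z' \<in> Obj V \<Longrightarrow> i < n \<Longrightarrow> j < n \<Longrightarrow> ent V K n n (I Z') i j = gdelta V R Z' i j"
      "Z' \<in> Obj V \<Longrightarrow> p \<in> Arr V \<Longrightarrow> Cod V p = Z' \<Longrightarrow> I Z' \<cdot> p = I (Dom V p)" for Z' i j p
    by (simp_all add: I_def)
  define a where "a = ap (pow V (pow V K n) n) (pow V (pow V K n) m) (\<theta> n) (I Z)"
  have a: "a \<in> hom V Z (pow V (pow V K n) m)" using Z by (simp add: a_def)
  have transport: "ap (pow V (pow V K n) m) (pow V (pow V K l) m) (FArr (P m) n l \<cdot> t) (a \<cdot> p) =
      ap (pow V (pow V K l) n) (pow V (pow V K l) m) (\<theta> l \<cdot> p)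
        (ap (pow V (pow V K n) n) (pow V (pow V K l) n) (FArr (P n) n l \<cdot> t) (I Z'))"
    if "Z' \<in> Obj V" "p \<in> hom V Z' Z" "t \<in> hom V Z' (pow V (pow V K (Suc n)) l)" for l Z' p t
    using P_vnatD[OF \<theta> Z, of p Z' t n l "I Z'"] that Z by (simp add: a_def)
  have act: "\<theta> l = Mat_act n m l \<cdot> a" for l
  proof (rule exp_ext[of _ Z "pow V (pow V K l) n" "pow V (pow V K l) m"])
    fix Z' p x assume *: "Z' \<in> Obj V" "p \<in> hom V Z' Z" "x \<in> hom V Z' (pow V (pow V K l) n)"
    \<comment> \<open>The operation without constant term that carries the identity matrix to \<open>x\<close>; its coefficients
      are the transpose of \<open>x\<close>.\<close>
    define t where "t = mat V K (Suc n) l Z' (\<lambda>q c. case c of 0 \<Rightarrow> gzero V R Z' | Suc i \<Rightarrow> ent V K l n x i q)"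
    have t_arr: "(case c of 0 \<Rightarrow> gzero V R Z' | Suc i \<Rightarrow> ent V K l n x i q) \<in> hom V Z' K"
      if "c < Suc n" "q < l" for c q
      using that * by (cases c) simp_all
    have t: "t \<in> hom V Z' (pow V (pow V K (Suc n)) l)"
      "\<And>q. q < l \<Longrightarrow> ent V K (Suc n) l t q 0 = gzero V R Z'"
      "\<And>q i. q < l \<Longrightarrow> i < n \<Longrightarrow> ent V K (Suc n) l t q (Suc i) = ent V K l n x i q"
      using * t_arr by (simp_all add: t_def)
    have shift: "gsum V R Z' (\<lambda>c. gmul V R (prepend_one Z' b c) (ent V K (Suc n) l t q c)) (Suc n) =
        gsum V R Z' (\<lambda>i. gmul V R (b i) (ent V K l n x i q)) n"
      if "q < l" "\<And>i. i < n \<Longrightarrow> b i \<in> hom V Z' K" for q b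
      using that t * by (subst gsum_Suc_shift) simp_all
    have "ap (pow V (pow V K n) n) (pow V (pow V K l) n) (FArr (P n) n l \<cdot> t) (I Z') = x"
      using * t by - (rule mat_ext[of _ Z' K l n], simp_all del: gsum.simps add: shift)
    moreover have "ap (pow V (pow V K n) m) (pow V (pow V K l) m) (FArr (P m) n l \<cdot> t) (a \<cdot> p) =
        gcomp V (Mat V R) l n m (a \<cdot> p) x"
      using * a t by - (rule mat_ext[of _ Z' K l m], simp_all del: gsum.simps add: shift)
    ultimately show "ap (pow V (pow V K l) n) (pow V (pow V K l) m) (\<theta> l \<cdot> p) x =
        ap (pow V (pow V K l) n) (pow V (pow V K l) m) ((Mat_act n m l \<cdot> a) \<cdot> p) x"
      using transport[OF *(1,2) t(1)] * a by simp
  qed (use a Z in simp_all)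
  have "affine n m a"
  proof (intro allI impI)
    fix j assume j: "j < m"
    \<comment> \<open>The constant operation given by the point, whose coefficients are \<open>(1, 0, \<dots>, 0)\<close>; it carries
      every matrix to a column of ones.\<close>
    define t where "t = mat V K (Suc n) 1 Z (\<lambda>_ c. gdelta V R Z 0 c)"
    define ones where "ones = mat V K 1 n Z (\<lambda>_ _. gone V R Z)"
    have t: "t \<in> hom V Z (pow V (pow V K (Suc n)) 1)"
      "\<And>c. c < Suc n \<Longrightarrow> ent V K (Suc n) 1 t 0 c = gdelta V R Z 0 c"
      using Z by (simp_all add: t_def)
    have ones: "ones \<in> hom V Z (pow V (pow V K 1) n)" "\<And>i. i < n \<Longrightarrow> ent V K 1 n ones i 0 = gone V R Z"
      using Z by (simp_all add: ones_def del: ent_col)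
    have t_ones: "ent V K 1 r (ap (pow V (pow V K n) r) (pow V (pow V K 1) r) (FArr (P r) n 1 \<cdot> t) x) i 0 =
        gone V R Z" if "x \<in> hom V Z (pow V (pow V K n) r)" "i < r" for r x i
      using ent_P_apply[of t x n 1 r i 0] that t Z by (simp del: gsum.simps ent_P_apply ent_col)
    have "ap (pow V (pow V K n) n) (pow V (pow V K 1) n) (FArr (P n) n 1 \<cdot> t) (I Z) = ones"
    proof (rule mat_ext[of _ Z K 1 n])
      fix i q :: nat assume "i < n" "q < 1"
      then show "ent V K 1 n (ap (pow V (pow V K n) n) (pow V (pow V K 1) n) (FArr (P n) n 1 \<cdot> t) (I Z)) i q =
          ent V K 1 n ones i q"
        using t_ones[of "I Z" n i] ones Z by simp
    qed (use Z t ones in simp_all)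
    then have "ap (pow V (pow V K n) m) (pow V (pow V K 1) m) (FArr (P m) n 1 \<cdot> t) a =
        gcomp V (Mat V R) 1 n m a ones"
      using transport[of Z "Ide V Z" t 1] Z t ones a act[of 1] Mat_act_apply[of a ones n m 1] by simp
    then have "ent V K 1 m (gcomp V (Mat V R) 1 n m a ones) j 0 = gone V R Z"
      using t_ones[OF a j] by simp
    then show "gsum V R (Dom V a) (ent V K n m a j) n = gone V R (Dom V a)"
      using j a ones Z by (simp del: gsum.simps ent_col)
  qed
  then show ?thesis using that a act by blast
qed

text \<open>Existence is \<open>vnat_is_Mat_act\<close>; uniqueness holds already for the component at 1, which is the
  monomorphism \<open>Mat_aff_mor\<close>.\<close>

lemma Mat_aff_nat_object:
  "is_nat_object V (PMat_op V R) (self_vcat V) (P n) (P m) (Aff n m)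
    (\<lambda>k. Mat_act n m k \<cdot> aff_incl V R n m)"
  unfolding is_nat_object_def
proof (intro conjI ballI allI impI)
  show "Aff n m \<in> Obj V" by simp
  show "is_vnat V (PMat_op V R) (self_vcat V) (P n) (P m) (Aff n m)
      (\<lambda>k. Mat_act n m k \<cdot> aff_incl V R n m)"
    by (rule Mat_act_natural)
next
  fix Z \<theta>
  assume Z: "Z \<in> Obj V" and \<theta>: "is_vnat V (PMat_op V R) (self_vcat V) (P n) (P m) Z \<theta>"
  obtain a where a: "a \<in> hom V Z (pow V (pow V K n) m)" "affine n m a"
    and act: "\<And>l. \<theta> l = Mat_act n m l \<cdot> a"
    using vnat_is_Mat_act[OF Z \<theta>] by blast
  obtain h where h: "h \<in> hom V Z (Aff n m)" "aff_incl V R n m \<cdot> h = a"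
    using aff_factor_exists[OF a] by blast
  show "\<exists>!h. h \<in> hom V Z (Aff n m) \<and>
      (\<forall>k\<in>VObj (PMat_op V R). (Mat_act n m k \<cdot> aff_incl V R n m) \<cdot> h = \<theta> k)"
  proof (rule ex1I[of _ h])
    show "h \<in> hom V Z (Aff n m) \<and>
        (\<forall>k\<in>VObj (PMat_op V R). (Mat_act n m k \<cdot> aff_incl V R n m) \<cdot> h = \<theta> k)"
      using h act by simp
    fix h' assume h': "h' \<in> hom V Z (Aff n m) \<and>
        (\<forall>k\<in>VObj (PMat_op V R). (Mat_act n m k \<cdot> aff_incl V R n m) \<cdot> h' = \<theta> k)"
    then have "(Mat_act n m 1 \<cdot> aff_incl V R n m) \<cdot> h' = \<theta> 1" by simp
    also have "\<dots> = (Mat_act n m 1 \<cdot> aff_incl V R n m) \<cdot> h" using h act by simp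
    finally have "Mat_aff_mor V R n m \<cdot> h' = Mat_aff_mor V R n m \<cdot> h"
      unfolding Mat_act_one Mat_aff_mor_def .
    then show "h' = h" using h h' by - (rule mono_cancel[OF Mat_aff_mor_mono], simp_all)
  qed
qed

end

theorem theorem9p3:
  fixes V :: "('o, 'a) ccc" and R :: "('o, 'a) rig"
  assumes "is_base V"
    and "is_rig V R"
  shows "is_theory_over V (full_theory V (Car R)) (PMat_op V R) (PMat_op_mor V R) \<and>
    iso_over V (full_theory V (Car R))
      (Mat_aff V R) (Mat_aff_mor V R)
      (commutant V (Car R) (PMat_op V R) (PMat_op_mor V R))
      (commutant_mor V (Car R) (PMat_op V R) (PMat_op_mor V R))"
proof -
  interpret rig_with_equalizers V R
    using assms by unfold_locales (simp_all add: is_base_def)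
  have "is_theory_over V (full_theory V K) (PMat_op V R) (PMat_op_mor V R)"
    using full_theory[of K] PMat_theory PMat_mor by (simp add: is_theory_over_def)
  moreover have "iso_over V (full_theory V K) (Mat_aff V R) (Mat_aff_mor V R)
      (commutant V K (PMat_op V R) (PMat_op_mor V R))
      (commutant_mor V K (PMat_op V R) (PMat_op_mor V R))"
  proof (rule commutant_iso[OF Mat_aff_theory_over Mat_aff_mor_mono])
    have Hom: "VHom (Mat_aff V R) n m = Aff n m" for n m by (simp add: Mat_aff_def)
    show "is_nat_object V (PMat_op V R) (self_vcat V) (P n) (P m) (VHom (Mat_aff V R) n m)
        (\<lambda>k. Mat_act n m k \<cdot>\<^bsub>V\<^esub> aff_incl V R n m)" for n m
      unfolding Hom by (rule Mat_aff_nat_object)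
    show "Mat_act n m 1 \<cdot>\<^bsub>V\<^esub> aff_incl V R n m = Mat_aff_mor V R n m" for n m
      by (simp only: Mat_act_one Mat_aff_mor_def)
    show "\<exists>h'. h' \<in> hom V Z (VHom (Mat_aff V R) k n) \<and> Mat_aff_mor V R k n \<cdot>\<^bsub>V\<^esub> h' = h"
      if "Z \<in> Obj V" "h \<in> hom V Z (VHom (full_theory V K) k n)"
        "\<And>i. i < n \<Longrightarrow> f i \<in> hom V Z (VHom (Mat_aff V R) k 1)"
        "\<And>i. i < n \<Longrightarrow> Mat_aff_mor V R k 1 \<cdot>\<^bsub>V\<^esub> f i =
          gcomp V (full_theory V K) k n 1 (VProj (full_theory V K) n i \<cdot>\<^bsub>V\<^esub> bang V Z) h"
      for Z k n h f
      using Mat_aff_closed[of Z h k n f] that by (simp only: Hom)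
  qed
  ultimately show ?thesis by blast
qed

end
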